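(* Let $(\mathfrak g,\mathfrak h,(\rho,\mu),(\psi,\nu))$ be a matched pair of Lie-Yamaguti algebras and $r:\mathfrak h\to\mathfrak g$ be a deformation map on it. Let $(\mathfrak a=C^{\bullet+1}(\mathfrak h,\mathfrak g),\{l_k\}_{k=1}^\infty)$ be the $L_\infty$-algebra associated with the matched pair, given by $l_1(P)=p[\Pi,P]_{\mathsf{LY}}$, $l_2(P,Q)=p[[\Pi,P]_{\mathsf{LY}},Q]_{\mathsf{LY}}$, $l_3(P,Q,R)=p[[[\Pi,P]_{\mathsf{LY}},Q]_{\mathsf{LY}},R]_{\mathsf{LY}}$ and $l_k=0$ for $k\ge4$. Then $(\mathfrak a=C^{\bullet+1}(\mathfrak h,\mathfrak g),\{l_k^r\}_{k=1}^\infty)$ is an $L_\infty$-algebra, where $$l_1^r(P)=l_1(P)+l_2(r,P)+\tfrac12l_3(r,r,P),\quad l_2^r(P,Q)=l_2(P,Q)+l_3(r,P,Q),\quad l_3^r(P,Q,R)=l_3(P,Q,R),$$ and $l_k^r=0$ for $k\ge4$. Moreover, for any other linear map $r':\mathfrak h\to\mathfrak g$, the sum $r+r'$ is still a deformation map if and only if $r'$ is a Maurer-Cartan element of the $L_\infty$-algebra $(\mathfrak a,\{l_k^r\}_{k=1}^\infty)$.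
   Context: All vector spaces and (multi)linear maps are over a field $\mathbf k$ of characteristic $0$. **Lie-Yamaguti algebra.** A vector space $\mathfrak g$ with linear maps $[\,,]:\wedge^2\mathfrak g\to\mathfrak g$ and $\langle\,,,\rangle:\wedge^2\mathfrak g\otimes\mathfrak g\to\mathfrak g$ such that for all $x,y,z,w,t\in\mathfrak g$: $[[x,y],z]+[[y,z],x]+[[z,x],y]+\langle x,y,z\rangle+\langle y,z,x\rangle+\langle z,x,y\rangle=0$; $\langle[x,y],z,w\rangle+\langle[y,z],x,w\rangle+\langle[z,x],y,w\rangle=0$; $\langle x,y,[z,w]\rangle=[\langle x,y,z\rangle,w]+[z,\langle x,y,w\rangle]$; $\langle x,y,\langle z,w,t\rangle\rangle=\langle\langle x,y,z\rangle,w,t\rangle+\langle z,\langle x,y,w\rangle,t\rangle+\langle z,w,\langle x,y,t\rangle\rangle$. **Representation.** A representation $(V;\rho,\mu)$ of $\mathfrak g$ is a vector space $V$ with linear maps $\rho:\mathfrak g\to\mathrm{End}(V)$, $x\mapsto\rho_x$, and $\mu:\mathfrak g\otimes\mathfrak g\to\mathrm{End}(V)$ such that, with $D_{\rho,\mu}(x,y):=\rho_x\rho_y-\rho_y\rho_x-\rho_{[x,y]}-\mu(x,y)+\mu(y,x)$, for all $x,y,z,w\in\mathfrak g$: $\mu([x,y],z)=\mu(x,z)\rho_y-\mu(y,z)\rho_x$; $\mu(x,[y,z])=\rho_y\mu(x,z)-\rho_z\mu(x,y)$; $\rho_{\langle x,y,z\rangle}=D_{\rho,\mu}(x,y)\rho_z-\rho_zD_{\rho,\mu}(x,y)$;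 $\mu(z,w)\mu(x,y)-\mu(y,w)\mu(x,z)-\mu(x,\langle y,z,w\rangle)+D_{\rho,\mu}(y,z)\mu(x,w)=0$; $\mu(\langle x,y,z\rangle,w)+\mu(z,\langle x,y,w\rangle)=D_{\rho,\mu}(x,y)\mu(z,w)-\mu(z,w)D_{\rho,\mu}(x,y)$. **Matched pair.** A matched pair of Lie-Yamaguti algebras $(\mathfrak g,\mathfrak h,(\rho,\mu),(\psi,\nu))$ consists of Lie-Yamaguti algebras $(\mathfrak g,[\,,],\langle\,,,\rangle)$, $(\mathfrak h,[\,,]',\langle\,,,\rangle')$ and linear maps $\rho:\mathfrak g\to\mathrm{End}(\mathfrak h)$, $\mu:\mathfrak g\otimes\mathfrak g\to\mathrm{End}(\mathfrak h)$, $\psi:\mathfrak h\to\mathrm{End}(\mathfrak g)$, $\nu:\mathfrak h\otimes\mathfrak h\to\mathrm{End}(\mathfrak g)$ such that $(\mathfrak h;\rho,\mu)$ is a representation of $\mathfrak g$, $(\mathfrak g;\psi,\nu)$ is a representation of $\mathfrak h$, and for all $x,y,z\in\mathfrak g$, $\alpha,\beta,\gamma\in\mathfrak h$: (1) $\rho_x([\alpha,\beta]')=[\rho_x\alpha,\beta]'+[\alpha,\rho_x\beta]'+\rho_{\psi_\beta x}\alpha-\rho_{\psi_\alpha x}\beta$; (2) $\rho_x(\langle\alpha,\beta,\gamma\rangle')=\langle\alpha,\beta,\rho_x\gamma\rangle'-\rho_{D_{\psi,\nu}(\alpha,\beta)x}\gamma$; (3) $\langle\rho_x\alpha,\beta,\gamma\rangle'+\langle\alpha,\rho_x\beta,\gamma\rangle'=0$;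 (4) $\rho_{\nu(\alpha,\beta)x}\gamma=\rho_{\nu(\alpha,\gamma)x}\beta$; (5) $\mu(x,y)([\alpha,\beta]')=\mu(\psi_\beta x,y)\alpha-\mu(\psi_\alpha x,y)\beta$; (6) $\mu(x,y)\langle\alpha,\beta,\gamma\rangle'=\langle\alpha,\beta,\mu(x,y)\gamma\rangle'-\mu(D_{\psi,\nu}(\alpha,\beta)x,y)\gamma-\mu(x,D_{\psi,\nu}(\alpha,\beta)y)\gamma$; (7) $\mu(x,\psi_\alpha y)\beta=[\alpha,\mu(x,y)\beta]'$; (8) $\mu(\nu(\alpha,\beta)x,y)\gamma-\mu(\nu(\alpha,\gamma)x,y)\beta=\mu(x,D_{\psi,\nu}(\beta,\gamma)y)\alpha-\langle\beta,\gamma,\mu(x,y)\alpha\rangle'$; (9) $\mu(x,\nu(\alpha,\beta)y)\gamma=\langle\mu(x,y)\gamma,\alpha,\beta\rangle'-D_{\rho,\mu}(y,\nu(\gamma,\alpha)x)\beta+\mu(y,\nu(\gamma,\beta)x)\alpha$; (10) $\psi_\alpha([x,y])=[\psi_\alpha x,y]+[x,\psi_\alpha y]+\psi_{\rho_y\alpha}x-\psi_{\rho_x\alpha}y$; (11) $\psi_\alpha(\langle x,y,z\rangle)=\langle x,y,\psi_\alpha z\rangle-\psi_{D_{\rho,\mu}(x,y)\alpha}z$; (12) $\langle\psi_\alpha x,y,z\rangle+\langle x,\psi_\alpha y,z\rangle=0$; (13) $\psi_{\mu(x,y)\alpha}z=\psi_{\mu(x,z)\alpha}y$; (14) $\nu(\alpha,\beta)([x,y])=\nu(\rho_y\alpha,\beta)x-\nu(\rho_x\alpha,\beta)y$;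 (15) $\nu(\alpha,\beta)\langle x,y,z\rangle=\langle x,y,\nu(\alpha,\beta)z\rangle-\nu(D_{\rho,\mu}(x,y)\alpha,\beta)z-\nu(\alpha,D_{\rho,\mu}(x,y)\beta)z$; (16) $\nu(\alpha,\rho_x\beta)y=[x,\nu(\alpha,\beta)y]$; (17) $\nu(\mu(x,y)\alpha,\beta)z-\nu(\mu(x,z)\alpha,\beta)y=\nu(\alpha,D_{\rho,\mu}(y,z)\beta)x-\langle y,z,\nu(\alpha,\beta)x\rangle$; (18) $\nu(\alpha,\mu(x,y)\beta)z=\langle\nu(\alpha,\beta)z,x,y\rangle-D_{\psi,\nu}(\beta,\mu(z,x)\alpha)y+\nu(\beta,\mu(z,y)\alpha)x$. **Bicrossed product.** $\mathfrak g\bowtie\mathfrak h$ is the Lie-Yamaguti algebra on $\mathfrak g\oplus\mathfrak h$ with operations $[(x,\alpha),(y,\beta)]_{\bowtie}=([x,y]+\psi_\alpha y-\psi_\beta x,\ [\alpha,\beta]'+\rho_x\beta-\rho_y\alpha)$, $\langle(x,\alpha),(y,\beta),(z,\gamma)\rangle_{\bowtie}=(\langle x,y,z\rangle+D_{\psi,\nu}(\alpha,\beta)z+\nu(\beta,\gamma)x-\nu(\alpha,\gamma)y,\ \langle\alpha,\beta,\gamma\rangle'+D_{\rho,\mu}(x,y)\gamma+\mu(y,z)\alpha-\mu(x,z)\beta)$. (It is known that this is a Lie-Yamaguti algebra.) **Deformation map.** A linear map $r:\mathfrak h\to\mathfrak g$ is a deformation map in the matched pair if for all $\alpha,\beta,\gamma\in\mathfrak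 h$: $[r(\alpha),r(\beta)]+\psi_\alpha r(\beta)-\psi_\beta r(\alpha)=r([\alpha,\beta]'+\rho_{r(\alpha)}\beta-\rho_{r(\beta)}\alpha)$, and $\langle r(\alpha),r(\beta),r(\gamma)\rangle+D_{\psi,\nu}(\alpha,\beta)r(\gamma)+\nu(\beta,\gamma)r(\alpha)-\nu(\alpha,\gamma)r(\beta)=r(\langle\alpha,\beta,\gamma\rangle'+D_{\rho,\mu}(r(\alpha),r(\beta))\gamma+\mu(r(\beta),r(\gamma))\alpha-\mu(r(\alpha),r(\gamma))\beta)$. **The graded Lie algebra $(C^{\bullet+1}(W,W),[\,,]_{\mathsf{LY}})$.** For vector spaces $W,V$ put $C^1(W,V)=\mathrm{Hom}(W,V)$ and, for $p\ge1$, $C^{p+1}(W,V)=\mathrm{Hom}((\wedge^2W)^{\otimes p},V)\oplus\mathrm{Hom}((\wedge^2W)^{\otimes p}\otimes W,V)$; write $P=(P_{\mathrm I},P_{\mathrm{II}})$ for elements of the latter. The degree $p$ part of $C^{\bullet+1}(W,V)$ is $C^{p+1}(W,V)$, $p\ge0$. For $V=W$ define $\diamond:C^{p+1}(W,W)\times C^{q+1}(W,W)\to C^{p+q+1}(W,W)$ as follows, with $\mathfrak X_i=x_i\wedge y_i\in\wedge^2W$, $x\in W$, $\mathbb S_{(a,b)}$ the set of $(a,b)$-shuffles and $(-1)^\sigma$ the sign of $\sigma$. - $f,g\in C^1$: $f\diamond g=f\circ g$. - $f\in C^1$, $P\in C^{p+1}$, $p\ge1$: $(f\diamond P)_{\mathrm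 I}=f\circ P_{\mathrm I}$, $(f\diamond P)_{\mathrm{II}}=f\circ P_{\mathrm{II}}$, $(P\diamond f)_{\mathrm I}(\mathfrak X_1,\dots,\mathfrak X_p)=\sum_{k=1}^pP_{\mathrm I}(\mathfrak X_1,\dots,\mathfrak X_{k-1},f(x_k)\wedge y_k+x_k\wedge f(y_k),\mathfrak X_{k+1},\dots,\mathfrak X_p)$, $(P\diamond f)_{\mathrm{II}}(\mathfrak X_1,\dots,\mathfrak X_p,x)=\sum_{k=1}^pP_{\mathrm{II}}(\mathfrak X_1,\dots,\mathfrak X_{k-1},f(x_k)\wedge y_k+x_k\wedge f(y_k),\mathfrak X_{k+1},\dots,\mathfrak X_p,x)+P_{\mathrm{II}}(\mathfrak X_1,\dots,\mathfrak X_p,f(x))$. - $P\in C^{p+1}$, $Q\in C^{q+1}$, $p,q\ge1$: $(P\diamond Q)_{\mathrm I}(\mathfrak X_1,\dots,\mathfrak X_{p+q})=\sum_{\sigma\in\mathbb S_{(p,q)},\,\sigma(p+q)=p+q}(-1)^{pq}(-1)^\sigma P_{\mathrm{II}}(\mathfrak X_{\sigma(1)},\dots,\mathfrak X_{\sigma(p)},Q_{\mathrm I}(\mathfrak X_{\sigma(p+1)},\dots,\mathfrak X_{\sigma(p+q)}))$ $+\sum_{k=1}^p(-1)^{(k-1)q}\sum_{\sigma\in\mathbb S_{(k-1,q)}}(-1)^\sigma P_{\mathrm I}(\mathfrak X_{\sigma(1)},\dots,\mathfrak X_{\sigma(k-1)},Q_{\mathrm{II}}(\mathfrak X_{\sigma(k)},\dots,\mathfrak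 X_{\sigma(k+q-1)},x_{k+q})\wedge y_{k+q},\mathfrak X_{k+q+1},\dots,\mathfrak X_{p+q})$ $+\sum_{k=1}^p(-1)^{(k-1)q}\sum_{\sigma\in\mathbb S_{(k-1,q)}}(-1)^\sigma P_{\mathrm I}(\mathfrak X_{\sigma(1)},\dots,\mathfrak X_{\sigma(k-1)},x_{k+q}\wedge Q_{\mathrm{II}}(\mathfrak X_{\sigma(k)},\dots,\mathfrak X_{\sigma(k+q-1)},y_{k+q}),\mathfrak X_{k+q+1},\dots,\mathfrak X_{p+q})$; $(P\diamond Q)_{\mathrm{II}}(\mathfrak X_1,\dots,\mathfrak X_{p+q},x)=\sum_{\sigma\in\mathbb S_{(p,q)}}(-1)^{pq}(-1)^\sigma P_{\mathrm{II}}(\mathfrak X_{\sigma(1)},\dots,\mathfrak X_{\sigma(p)},Q_{\mathrm{II}}(\mathfrak X_{\sigma(p+1)},\dots,\mathfrak X_{\sigma(p+q)},x))$ $+\sum_{k=1}^p(-1)^{(k-1)q}\sum_{\sigma\in\mathbb S_{(k-1,q)}}(-1)^\sigma P_{\mathrm{II}}(\mathfrak X_{\sigma(1)},\dots,\mathfrak X_{\sigma(k-1)},Q_{\mathrm{II}}(\mathfrak X_{\sigma(k)},\dots,\mathfrak X_{\sigma(k+q-1)},x_{k+q})\wedge y_{k+q},\mathfrak X_{k+q+1},\dots,\mathfrak X_{p+q},x)$ $+\sum_{k=1}^p(-1)^{(k-1)q}\sum_{\sigma\in\mathbb S_{(k-1,q)}}(-1)^\sigma P_{\mathrm{II}}(\mathfrak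 X_{\sigma(1)},\dots,\mathfrak X_{\sigma(k-1)},x_{k+q}\wedge Q_{\mathrm{II}}(\mathfrak X_{\sigma(k)},\dots,\mathfrak X_{\sigma(k+q-1)},y_{k+q}),\mathfrak X_{k+q+1},\dots,\mathfrak X_{p+q},x)$. Set $[P,Q]_{\mathsf{LY}}=P\diamond Q-(-1)^{pq}Q\diamond P$. It is known that $(C^{\bullet+1}(W,W),[\,,]_{\mathsf{LY}})$ is a graded Lie algebra. **The maps $p$ and $\Pi$.** Take $W=\mathfrak g\oplus\mathfrak h$. The subspace $\mathfrak a=C^{\bullet+1}(\mathfrak h,\mathfrak g)$, with $\mathfrak a_0=\mathrm{Hom}(\mathfrak h,\mathfrak g)$, is embedded in $C^{\bullet+1}(\mathfrak g\oplus\mathfrak h,\mathfrak g\oplus\mathfrak h)$ by extending maps by zero on all inputs from $\mathfrak g$ and composing with $\mathfrak g\hookrightarrow\mathfrak g\oplus\mathfrak h$; the projection $p$ onto $\mathfrak a$ restricts all inputs to $\mathfrak h$ and projects the output to $\mathfrak g$. The element $\Pi=(\Pi_{\mathrm I},\Pi_{\mathrm{II}})\in C^2(\mathfrak g\oplus\mathfrak h,\mathfrak g\oplus\mathfrak h)$ is $\Pi_{\mathrm I}=[\,,]_{\bowtie}$, $\Pi_{\mathrm{II}}=\langle\,,,\rangle_{\bowtie}$. **$L_\infty$-algebra.** A graded vector space $\mathcal L=\oplus_{n\in\mathbb Z}\mathcal L_n$ with degree $1$ graded symmetric linear maps $l_k:\mathcal L^{\otimes k}\to\mathcal L$, $k\ge1$,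 such that for all $N\ge1$ and homogeneous $x_1,\dots,x_N$: $\sum_{i=1}^N\sum_{\sigma\in\mathbb S_{(i,N-i)}}\epsilon(\sigma)\,l_{N-i+1}(l_i(x_{\sigma(1)},\dots,x_{\sigma(i)}),x_{\sigma(i+1)},\dots,x_{\sigma(N)})=0$, where $\epsilon(\sigma)$ is the Koszul sign. A Maurer-Cartan element is $c\in\mathcal L_0$ with $\sum_{k\ge1}\frac1{k!}l_k(c,\dots,c)=0$.
   Formalization: That the bicrossed product g⋈h is a Lie-Yamaguti algebra is assumed explicitly: conditions (1)–(18) of a matched pair as printed do not imply it, and without it the L∞ claim can fail (already for r=0). *)

theory Defs
  imports
    "HOL-Analysis.Product_Vector"
    "HOL-Combinatorics.Permutations"
    "HOL-Library.Function_Algebras"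
begin

section \<open>Lie-Yamaguti algebras, representations and matched pairs\<close>

text \<open>Maps on exterior squares are given as alternating bilinear maps, and maps on tensor
  products as multilinear maps in curried form.\<close>

locale lie_yamaguti_algebra = vector_space scale
  for scale :: "'k::field_char_0 \<Rightarrow> 'g::ab_group_add \<Rightarrow> 'g" +
  fixes br :: "'g \<Rightarrow> 'g \<Rightarrow> 'g"
    and tri :: "'g \<Rightarrow> 'g \<Rightarrow> 'g \<Rightarrow> 'g"
  assumes br_linear1: "Vector_Spaces.linear scale scale (\<lambda>x. br x y)"
    and br_linear2: "Vector_Spaces.linear scale scale (\<lambda>y. br x y)"
    and br_alt: "br x x = 0"
    and tri_linear1: "Vector_Spaces.linear scale scale (\<lambda>x. tri x y z)"
    and tri_linear2: "Vector_Spaces.linear scale scale (\<lambda>y. tri x y z)"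
    and tri_linear3: "Vector_Spaces.linear scale scale (\<lambda>z. tri x y z)"
    and tri_alt: "tri x x z = 0"
    and LY1: "br (br x y) z + br (br y z) x + br (br z x) y
               + tri x y z + tri y z x + tri z x y = 0"
    and LY2: "tri (br x y) z w + tri (br y z) x w + tri (br z x) y w = 0"
    and LY3: "tri x y (br z w) = br (tri x y z) w + br z (tri x y w)"
    and LY4: "tri x y (tri z w t) =
               tri (tri x y z) w t + tri z (tri x y w) t + tri z w (tri x y t)"

definition rep_D ::
  "('g \<Rightarrow> 'g \<Rightarrow> 'g) \<Rightarrow> ('g \<Rightarrow> 'v \<Rightarrow> 'v::ab_group_add) \<Rightarrow> ('g \<Rightarrow> 'g \<Rightarrow> 'v \<Rightarrow> 'v)
    \<Rightarrow> 'g \<Rightarrow> 'g \<Rightarrow> 'v \<Rightarrow> 'v" where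
  "rep_D br \<rho> \<mu> x y v =
     \<rho> x (\<rho> y v) - \<rho> y (\<rho> x v) - \<rho> (br x y) v - \<mu> x y v + \<mu> y x v"

locale ly_representation =
  lie_yamaguti_algebra sg br tri + V: vector_space sv
  for sg :: "'k::field_char_0 \<Rightarrow> 'g::ab_group_add \<Rightarrow> 'g"
    and br :: "'g \<Rightarrow> 'g \<Rightarrow> 'g" and tri :: "'g \<Rightarrow> 'g \<Rightarrow> 'g \<Rightarrow> 'g"
    and sv :: "'k \<Rightarrow> 'v::ab_group_add \<Rightarrow> 'v" +
  fixes \<rho> :: "'g \<Rightarrow> 'v \<Rightarrow> 'v"
    and \<mu> :: "'g \<Rightarrow> 'g \<Rightarrow> 'v \<Rightarrow> 'v"
  assumes \<rho>_linear1: "Vector_Spaces.linear sg sv (\<lambda>x. \<rho> x v)"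
    and \<rho>_linear2: "Vector_Spaces.linear sv sv (\<lambda>v. \<rho> x v)"
    and \<mu>_linear1: "Vector_Spaces.linear sg sv (\<lambda>x. \<mu> x y v)"
    and \<mu>_linear2: "Vector_Spaces.linear sg sv (\<lambda>y. \<mu> x y v)"
    and \<mu>_linear3: "Vector_Spaces.linear sv sv (\<lambda>v. \<mu> x y v)"
    and rep1: "\<mu> (br x y) z v = \<mu> x z (\<rho> y v) - \<mu> y z (\<rho> x v)"
    and rep2: "\<mu> x (br y z) v = \<rho> y (\<mu> x z v) - \<rho> z (\<mu> x y v)"
    and rep3: "\<rho> (tri x y z) v = rep_D br \<rho> \<mu> x y (\<rho> z v) - \<rho> z (rep_D br \<rho> \<mu> x y v)"
    and rep4: "\<mu> z w (\<mu> x y v) - \<mu> y w (\<mu> x z v) - \<mu> x (tri y z w) v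
                + rep_D br \<rho> \<mu> y z (\<mu> x w v) = 0"
    and rep5: "\<mu> (tri x y z) w v + \<mu> z (tri x y w) v =
                rep_D br \<rho> \<mu> x y (\<mu> z w v) - \<mu> z w (rep_D br \<rho> \<mu> x y v)"

locale ly_matched_pair =
  G: ly_representation sg brg trg sh \<rho> \<mu> +
  H: ly_representation sh brh trh sg \<psi> \<nu>
  for sg :: "'k::field_char_0 \<Rightarrow> 'g::ab_group_add \<Rightarrow> 'g"
    and brg :: "'g \<Rightarrow> 'g \<Rightarrow> 'g" and trg :: "'g \<Rightarrow> 'g \<Rightarrow> 'g \<Rightarrow> 'g"
    and sh :: "'k \<Rightarrow> 'h::ab_group_add \<Rightarrow> 'h"
    and brh :: "'h \<Rightarrow> 'h \<Rightarrow> 'h" and trh :: "'h \<Rightarrow> 'h \<Rightarrow> 'h \<Rightarrow> 'h"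
    and \<rho> :: "'g \<Rightarrow> 'h \<Rightarrow> 'h" and \<mu> :: "'g \<Rightarrow> 'g \<Rightarrow> 'h \<Rightarrow> 'h"
    and \<psi> :: "'h \<Rightarrow> 'g \<Rightarrow> 'g" and \<nu> :: "'h \<Rightarrow> 'h \<Rightarrow> 'g \<Rightarrow> 'g" +
  assumes mp1: "\<rho> x (brh \<alpha> \<beta>) =
      brh (\<rho> x \<alpha>) \<beta> + brh \<alpha> (\<rho> x \<beta>) + \<rho> (\<psi> \<beta> x) \<alpha> - \<rho> (\<psi> \<alpha> x) \<beta>"
    and mp2: "\<rho> x (trh \<alpha> \<beta> \<gamma>) = trh \<alpha> \<beta> (\<rho> x \<gamma>) - \<rho> (rep_D brh \<psi> \<nu> \<alpha> \<beta> x) \<gamma>"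
    and mp3: "trh (\<rho> x \<alpha>) \<beta> \<gamma> + trh \<alpha> (\<rho> x \<beta>) \<gamma> = 0"
    and mp4: "\<rho> (\<nu> \<alpha> \<beta> x) \<gamma> = \<rho> (\<nu> \<alpha> \<gamma> x) \<beta>"
    and mp5: "\<mu> x y (brh \<alpha> \<beta>) = \<mu> (\<psi> \<beta> x) y \<alpha> - \<mu> (\<psi> \<alpha> x) y \<beta>"
    and mp6: "\<mu> x y (trh \<alpha> \<beta> \<gamma>) =
      trh \<alpha> \<beta> (\<mu> x y \<gamma>) - \<mu> (rep_D brh \<psi> \<nu> \<alpha> \<beta> x) y \<gamma> - \<mu> x (rep_D brh \<psi> \<nu> \<alpha> \<beta> y) \<gamma>"
    and mp7: "\<mu> x (\<psi> \<alpha> y) \<beta> = brh \<alpha> (\<mu> x y \<beta>)"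
    and mp8: "\<mu> (\<nu> \<alpha> \<beta> x) y \<gamma> - \<mu> (\<nu> \<alpha> \<gamma> x) y \<beta> =
      \<mu> x (rep_D brh \<psi> \<nu> \<beta> \<gamma> y) \<alpha> - trh \<beta> \<gamma> (\<mu> x y \<alpha>)"
    and mp9: "\<mu> x (\<nu> \<alpha> \<beta> y) \<gamma> =
      trh (\<mu> x y \<gamma>) \<alpha> \<beta> - rep_D brg \<rho> \<mu> y (\<nu> \<gamma> \<alpha> x) \<beta> + \<mu> y (\<nu> \<gamma> \<beta> x) \<alpha>"
    and mp10: "\<psi> \<alpha> (brg x y) =
      brg (\<psi> \<alpha> x) y + brg x (\<psi> \<alpha> y) + \<psi> (\<rho> y \<alpha>) x - \<psi> (\<rho> x \<alpha>) y"
    and mp11: "\<psi> \<alpha> (trg x y z) = trg x y (\<psi> \<alpha> z) - \<psi> (rep_D brg \<rho> \<mu> x y \<alpha>) z"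
    and mp12: "trg (\<psi> \<alpha> x) y z + trg x (\<psi> \<alpha> y) z = 0"
    and mp13: "\<psi> (\<mu> x y \<alpha>) z = \<psi> (\<mu> x z \<alpha>) y"
    and mp14: "\<nu> \<alpha> \<beta> (brg x y) = \<nu> (\<rho> y \<alpha>) \<beta> x - \<nu> (\<rho> x \<alpha>) \<beta> y"
    and mp15: "\<nu> \<alpha> \<beta> (trg x y z) =
      trg x y (\<nu> \<alpha> \<beta> z) - \<nu> (rep_D brg \<rho> \<mu> x y \<alpha>) \<beta> z - \<nu> \<alpha> (rep_D brg \<rho> \<mu> x y \<beta>) z"
    and mp16: "\<nu> \<alpha> (\<rho> x \<beta>) y = brg x (\<nu> \<alpha> \<beta> y)"
    and mp17: "\<nu> (\<mu> x y \<alpha>) \<beta> z - \<nu> (\<mu> x z \<alpha>) \<beta> y =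
      \<nu> \<alpha> (rep_D brg \<rho> \<mu> y z \<beta>) x - trg y z (\<nu> \<alpha> \<beta> x)"
    and mp18: "\<nu> \<alpha> (\<mu> x y \<beta>) z =
      trg (\<nu> \<alpha> \<beta> z) x y - rep_D brh \<psi> \<nu> \<beta> (\<mu> z x \<alpha>) y + \<nu> \<beta> (\<mu> z y \<alpha>) x"

text \<open>
  The operations of the bicrossed product, on the type of pairs.  The conditions of
  \<open>ly_matched_pair\<close> alone do not force them to form a Lie-Yamaguti algebra: LY2 and LY3 also
  need \<open>D\<^bsub>\<rho>,\<mu>\<^esub>(\<psi>\<^sub>\<alpha> x, y) + D\<^bsub>\<rho>,\<mu>\<^esub>(x, \<psi>\<^sub>\<alpha> y) = 0\<close> on \<open>h\<close> and the
  mirrored identity on \<open>g\<close>.  For instance let \<open>g\<close> have basis \<open>x, y, w, z\<close> and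
  \<open>[x,y] = w\<close>, let \<open>h\<close> have basis \<open>u, u', v\<close>, with \<open>\<rho>\<^sub>y u = u'\<close>, \<open>\<nu>(u,v) w = z\<close>,
  \<open>\<nu>(u',v) x = z\<close> and everything else zero.  That the bicrossed product is a Lie-Yamaguti
  algebra is therefore stated separately where it is needed.
\<close>

fun bicrossed_br where
  "bicrossed_br brg brh \<rho> \<psi> (x, \<alpha>) (y, \<beta>) =
     (brg x y + \<psi> \<alpha> y - \<psi> \<beta> x, brh \<alpha> \<beta> + \<rho> x \<beta> - \<rho> y \<alpha>)"

fun bicrossed_tri where
  "bicrossed_tri brg trg brh trh \<rho> \<mu> \<psi> \<nu> (x, \<alpha>) (y, \<beta>) (z, \<gamma>) =
     (trg x y z + rep_D brh \<psi> \<nu> \<alpha> \<beta> z + \<nu> \<beta> \<gamma> x - \<nu> \<alpha> \<gamma> y,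
      trh \<alpha> \<beta> \<gamma> + rep_D brg \<rho> \<mu> x y \<gamma> + \<mu> y z \<alpha> - \<mu> x z \<beta>)"

definition deformation_map where
  "deformation_map sg brg trg sh brh trh \<rho> \<mu> \<psi> \<nu> r \<longleftrightarrow>
     Vector_Spaces.linear sh sg r \<and>
     (\<forall>\<alpha> \<beta>. brg (r \<alpha>) (r \<beta>) + \<psi> \<alpha> (r \<beta>) - \<psi> \<beta> (r \<alpha>) =
        r (brh \<alpha> \<beta> + \<rho> (r \<alpha>) \<beta> - \<rho> (r \<beta>) \<alpha>)) \<and>
     (\<forall>\<alpha> \<beta> \<gamma>. trg (r \<alpha>) (r \<beta>) (r \<gamma>) + rep_D brh \<psi> \<nu> \<alpha> \<beta> (r \<gamma>)
          + \<nu> \<beta> \<gamma> (r \<alpha>) - \<nu> \<alpha> \<gamma> (r \<beta>) =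
        r (trh \<alpha> \<beta> \<gamma> + rep_D brg \<rho> \<mu> (r \<alpha>) (r \<beta>) \<gamma>
          + \<mu> (r \<beta>) (r \<gamma>) \<alpha> - \<mu> (r \<alpha>) (r \<gamma>) \<beta>))"


section \<open>The graded Lie algebra of cochains\<close>

text \<open>
  An element of the direct sum of all the spaces \<open>C\<^sup>p\<^sup>+\<^sup>1(W,V)\<close> is encoded as a single pair of
  functions \<open>(P\<^sub>I, P\<^sub>I\<^sub>I)\<close>.  The list argument \<open>[(x\<^sub>1,y\<^sub>1), \<dots>, (x\<^sub>p,y\<^sub>p)]\<close> stands for
  \<open>(x\<^sub>1 \<and> y\<^sub>1) \<otimes> \<dots> \<otimes> (x\<^sub>p \<and> y\<^sub>p)\<close>, and the values on lists of length \<open>p\<close> are the component of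
  degree \<open>p\<close>.  In degree \<open>0\<close> the first component is required to vanish and \<open>f : W \<rightarrow> V\<close> is
  the pair \<open>(0, f)\<close>.  Addition is pointwise, by the library instances for functions and pairs.
\<close>

type_synonym ('w, 'v) cochain = "(('w \<times> 'w) list \<Rightarrow> 'v) \<times> (('w \<times> 'w) list \<Rightarrow> 'w \<Rightarrow> 'v)"

definition cochain_scale ::
  "('k \<Rightarrow> 'v \<Rightarrow> 'v) \<Rightarrow> 'k \<Rightarrow> ('w, 'v) cochain \<Rightarrow> ('w, 'v) cochain" where
  "cochain_scale s c P = (\<lambda>Xs. s c (fst P Xs), \<lambda>Xs x. s c (snd P Xs x))"

definition wedge_multilinear ::
  "('k::field_char_0 \<Rightarrow> 'w::ab_group_add \<Rightarrow> 'w) \<Rightarrow> ('k \<Rightarrow> 'v::ab_group_add \<Rightarrow> 'v) \<Rightarrow> nat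
    \<Rightarrow> (('w \<times> 'w) list \<Rightarrow> 'v) \<Rightarrow> bool" where
  "wedge_multilinear sw sv p F \<longleftrightarrow>
     (\<forall>Xs. length Xs \<noteq> p \<longrightarrow> F Xs = 0) \<and>
     (\<forall>Xs i. length Xs = p \<longrightarrow> i < p \<longrightarrow>
        (\<forall>y. Vector_Spaces.linear sw sv (\<lambda>x. F (Xs[i := (x, y)]))) \<and>
        (\<forall>x. Vector_Spaces.linear sw sv (\<lambda>y. F (Xs[i := (x, y)]))) \<and>
        (\<forall>x. F (Xs[i := (x, x)]) = 0))"

definition cochains ::
  "('k::field_char_0 \<Rightarrow> 'w::ab_group_add \<Rightarrow> 'w) \<Rightarrow> ('k \<Rightarrow> 'v::ab_group_add \<Rightarrow> 'v) \<Rightarrow> nat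
    \<Rightarrow> ('w, 'v) cochain set" where
  "cochains sw sv p =
     {P. (p = 0 \<longrightarrow> fst P = 0) \<and>
         wedge_multilinear sw sv p (fst P) \<and>
         (\<forall>x. wedge_multilinear sw sv p (\<lambda>Xs. snd P Xs x)) \<and>
         (\<forall>Xs. Vector_Spaces.linear sw sv (snd P Xs))}"

definition cochain_grading ::
  "('k::field_char_0 \<Rightarrow> 'w::ab_group_add \<Rightarrow> 'w) \<Rightarrow> ('k \<Rightarrow> 'v::ab_group_add \<Rightarrow> 'v) \<Rightarrow> int
    \<Rightarrow> ('w, 'v) cochain set" where
  "cochain_grading sw sv n = (if n < 0 then {0} else cochains sw sv (nat n))"

definition shuffle_perms :: "nat \<Rightarrow> nat \<Rightarrow> (nat \<Rightarrow> nat) set" where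
  "shuffle_perms a b =
     {\<sigma>. \<sigma> permutes {1..a+b} \<and> strict_mono_on {1..a} \<sigma> \<and> strict_mono_on {a+1..a+b} \<sigma>}"

text \<open>The sublist \<open>X\<^bsub>\<sigma>(m)\<^esub>, \<dots>, X\<^bsub>\<sigma>(n)\<^esub>\<close>, with positions counted from \<open>1\<close>.\<close>

definition perm_sublist :: "(nat \<Rightarrow> nat) \<Rightarrow> 'x list \<Rightarrow> nat \<Rightarrow> nat \<Rightarrow> 'x list" where
  "perm_sublist \<sigma> Xs m n = map (\<lambda>i. Xs ! (\<sigma> i - 1)) [m..<Suc n]"

text \<open>The sums over \<open>k = 1, \<dots>, p\<close> in the definition of \<open>\<diamond>\<close>, which have the same shape in
  both components: \<open>F\<close> is \<open>P\<^sub>I\<close> or \<open>P\<^sub>I\<^sub>I(\<dots>, x)\<close>, and \<open>G\<close> is \<open>Q\<^sub>I\<^sub>I\<close>.\<close>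

definition ly_insertions ::
  "('k::field_char_0 \<Rightarrow> 'w::ab_group_add \<Rightarrow> 'w) \<Rightarrow> nat \<Rightarrow> nat \<Rightarrow> (('w \<times> 'w) list \<Rightarrow> 'w)
    \<Rightarrow> (('w \<times> 'w) list \<Rightarrow> 'w \<Rightarrow> 'w) \<Rightarrow> ('w \<times> 'w) list \<Rightarrow> 'w" where
  "ly_insertions s p q F G Xs =
     (\<Sum>k = 1..p. s ((-1) ^ ((k - 1) * q)) (\<Sum>\<sigma>\<in>shuffle_perms (k - 1) q. s (of_int (sign \<sigma>))
        (let (x, y) = Xs ! (k + q - 1) in
           F (perm_sublist \<sigma> Xs 1 (k - 1)
              @ [(G (perm_sublist \<sigma> Xs k (k + q - 1)) x, y)] @ drop (k + q) Xs)
         + F (perm_sublist \<sigma> Xs 1 (k - 1)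
              @ [(x, G (perm_sublist \<sigma> Xs k (k + q - 1)) y)] @ drop (k + q) Xs))))"

text \<open>The product \<open>\<diamond>\<close> of an element of degree \<open>p\<close> with an element of degree \<open>q\<close>.  The separate
  formulas for \<open>p = 0\<close> or \<open>q = 0\<close> are instances of the general one, because the first component
  of an element of degree \<open>0\<close> vanishes; see the lemmas \<open>ly_diamond_0_left\<close> and
  \<open>ly_diamond_0_right\<close> below.\<close>

definition ly_diamond ::
  "('k::field_char_0 \<Rightarrow> 'w::ab_group_add \<Rightarrow> 'w) \<Rightarrow> nat \<Rightarrow> nat
    \<Rightarrow> ('w, 'w) cochain \<Rightarrow> ('w, 'w) cochain \<Rightarrow> ('w, 'w) cochain" where
  "ly_diamond s p q P Q =
    (\<lambda>Xs. if length Xs = p + q then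
        (\<Sum>\<sigma>\<in>{\<sigma>\<in>shuffle_perms p q. \<sigma> (p + q) = p + q}. s ((-1) ^ (p * q) * of_int (sign \<sigma>))
           (snd P (perm_sublist \<sigma> Xs 1 p) (fst Q (perm_sublist \<sigma> Xs (p + 1) (p + q)))))
        + ly_insertions s p q (fst P) (snd Q) Xs
      else 0,
     \<lambda>Xs x. if length Xs = p + q then
        (\<Sum>\<sigma>\<in>shuffle_perms p q. s ((-1) ^ (p * q) * of_int (sign \<sigma>))
           (snd P (perm_sublist \<sigma> Xs 1 p) (snd Q (perm_sublist \<sigma> Xs (p + 1) (p + q)) x)))
        + ly_insertions s p q (\<lambda>Ys. snd P Ys x) (snd Q) Xs
      else 0)"

definition ly_bracket_hom ::
  "('k::field_char_0 \<Rightarrow> 'w::ab_group_add \<Rightarrow> 'w) \<Rightarrow> nat \<Rightarrow> nat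
    \<Rightarrow> ('w, 'w) cochain \<Rightarrow> ('w, 'w) cochain \<Rightarrow> ('w, 'w) cochain" where
  "ly_bracket_hom s p q P Q =
     ly_diamond s p q P Q - cochain_scale s ((-1) ^ (p * q)) (ly_diamond s q p Q P)"

text \<open>The bilinear extension of the bracket to sums of homogeneous elements: the component of
  degree \<open>n\<close> is the sum over \<open>p + q = n\<close> of the brackets of the component of degree \<open>p\<close> of \<open>P\<close>
  with the component of degree \<open>q\<close> of \<open>Q\<close>.  On homogeneous elements it agrees with
  \<open>ly_bracket_hom\<close>; see the lemma \<open>ly_bracket_homogeneous\<close> below.\<close>

definition ly_bracket ::
  "('k::field_char_0 \<Rightarrow> 'w::ab_group_add \<Rightarrow> 'w)
    \<Rightarrow> ('w, 'w) cochain \<Rightarrow> ('w, 'w) cochain \<Rightarrow> ('w, 'w) cochain" where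
  "ly_bracket s P Q =
     (\<lambda>Xs. \<Sum>p\<le>length Xs. fst (ly_bracket_hom s p (length Xs - p) P Q) Xs,
      \<lambda>Xs x. \<Sum>p\<le>length Xs. snd (ly_bracket_hom s p (length Xs - p) P Q) Xs x)"

lemma shuffle_perms_0_left: "shuffle_perms 0 q = {id}"
proof -
  have "\<sigma> = id" if p: "\<sigma> permutes {1..q}" and m: "strict_mono_on {1..q} \<sigma>" for \<sigma>
  proof (rule permutes_natset_ge[OF p])
    have "i \<in> {1..q} \<longrightarrow> i \<le> \<sigma> i" for i
    proof (induction i)
      case (Suc i)
      show ?case
      proof
        assume a: "Suc i \<in> {1..q}"
        show "Suc i \<le> \<sigma> (Suc i)"
        proof (cases "i = 0")
          case True
          then show ?thesis using permutes_in_image[OF p, of "Suc i"] a by auto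
        next
          case False
          then have "\<sigma> i < \<sigma> (Suc i)" "i \<le> \<sigma> i"
            using a Suc strict_mono_onD[OF m, of i "Suc i"] by auto
          then show ?thesis by simp
        qed
      qed
    qed simp
    then show "\<forall>i\<in>{1..q}. i \<le> \<sigma> i" by blast
  qed
  then show ?thesis
    by (auto simp: shuffle_perms_def permutes_id strict_mono_on_def)
qed

lemma shuffle_perms_0_right: "shuffle_perms p 0 = {id}"
  using shuffle_perms_0_left[of p] by (auto simp: shuffle_perms_def strict_mono_on_def)

lemma perm_sublist_id: "n \<le> length Xs \<Longrightarrow> perm_sublist id Xs 1 n = take n Xs"
  by (rule nth_equalityI) (auto simp: perm_sublist_def simp del: upt_Suc)

lemma vs_linear_0: "Vector_Spaces.linear s t f \<Longrightarrow> f 0 = 0"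
  by (rule module_hom.zero[OF Vector_Spaces.linear.axioms(3)])

lemma length_perm_sublist [simp]: "length (perm_sublist \<sigma> Xs m n) = Suc n - m"
  by (simp add: perm_sublist_def del: upt_Suc)

lemma ly_diamond_0_left:
  fixes s :: "'k::field_char_0 \<Rightarrow> 'w::ab_group_add \<Rightarrow> 'w"
  assumes f: "f \<in> cochains s s 0" and Q: "Q \<in> cochains s s q"
  shows "ly_diamond s 0 q f Q = (\<lambda>Xs. snd f [] (fst Q Xs), \<lambda>Xs x. snd f [] (snd Q Xs x))"
proof -
  have lin: "Vector_Spaces.linear s s (snd f [])"
    using f by (auto simp: cochains_def)
  then interpret vector_space s by (simp add: Vector_Spaces.linear_def)
  have Q1: "fst Q Xs = 0" "snd Q Xs x = 0" if "length Xs \<noteq> q" for Xs x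
    using that Q by (auto simp: cochains_def wedge_multilinear_def)
  have c: "{\<sigma> \<in> shuffle_perms 0 q. \<sigma> (0 + q) = 0 + q} = {id}"
    by (auto simp: shuffle_perms_0_left)
  have nil: "perm_sublist \<sigma> Xs 1 0 = []" for \<sigma> and Xs :: "('w \<times> 'w) list"
    by (simp add: perm_sublist_def)
  have whole: "perm_sublist id Xs (0 + 1) (0 + q) = Xs" if "length Xs = 0 + q"
    for Xs :: "('w \<times> 'w) list"
    using that perm_sublist_id[of q Xs] by simp
  show ?thesis
    unfolding ly_diamond_def c
    unfolding shuffle_perms_0_left nil
    by (intro prod_eqI ext; simp add: whole[simplified] ly_insertions_def Q1 vs_linear_0[OF lin])
qed

lemma ly_diamond_0_right:
  fixes s :: "'k::field_char_0 \<Rightarrow> 'w::ab_group_add \<Rightarrow> 'w"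
  assumes P: "P \<in> cochains s s p" and f: "f \<in> cochains s s 0"
  shows "ly_diamond s p 0 P f =
    (\<lambda>Xs. if length Xs = p then
        (\<Sum>k = 1..p. let (x, y) = Xs ! (k - 1) in
           fst P (Xs[k - 1 := (snd f [] x, y)]) + fst P (Xs[k - 1 := (x, snd f [] y)]))
      else 0,
     \<lambda>Xs z. if length Xs = p then
        (\<Sum>k = 1..p. let (x, y) = Xs ! (k - 1) in
           snd P (Xs[k - 1 := (snd f [] x, y)]) z + snd P (Xs[k - 1 := (x, snd f [] y)]) z)
        + snd P Xs (snd f [] z)
      else 0)"
proof -
  have lin: "Vector_Spaces.linear s s (snd P Xs)" for Xs
    using P by (auto simp: cochains_def)
  then interpret vector_space s by (simp add: Vector_Spaces.linear_def)
  have f0: "fst f = 0" using f by (auto simp: cochains_def)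
  have c: "{\<sigma> \<in> shuffle_perms p 0. \<sigma> (p + 0) = p + 0} = {id}"
    by (auto simp: shuffle_perms_0_right)
  have nil: "perm_sublist \<sigma> Xs k (k - 1) = []" if "1 \<le> k" for \<sigma> k and Xs :: "('w \<times> 'w) list"
    using that by (simp add: perm_sublist_def)
  have upd: "perm_sublist id Xs 1 (k - 1) @ [z] @ drop k Xs = Xs[k - 1 := z]"
    if "1 \<le> k" "k \<le> length Xs" for k z and Xs :: "('w \<times> 'w) list"
  proof -
    have "perm_sublist id Xs 1 (k - 1) = take (k - 1) Xs"
      using that by (intro perm_sublist_id) simp
    then show ?thesis using that by (simp add: upd_conv_take_nth_drop)
  qed
  have ins: "ly_insertions s p 0 F G Xs = (\<Sum>k = 1..p. let (x, y) = Xs ! (k - 1) in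
       F (Xs[k - 1 := (G [] x, y)]) + F (Xs[k - 1 := (x, G [] y)]))"
    if L: "length Xs = p" for F G Xs
    unfolding ly_insertions_def
  proof (rule sum.cong[OF refl])
    fix k assume "k \<in> {1..p}"
    then have k: "1 \<le> k" "k \<le> length Xs" using L by auto
    show "s ((- 1) ^ ((k - 1) * 0)) (\<Sum>\<sigma>\<in>shuffle_perms (k - 1) 0. s (of_int (sign \<sigma>))
        (let (x, y) = Xs ! (k + 0 - 1) in
           F (perm_sublist \<sigma> Xs 1 (k - 1)
              @ [(G (perm_sublist \<sigma> Xs k (k + 0 - 1)) x, y)] @ drop (k + 0) Xs)
         + F (perm_sublist \<sigma> Xs 1 (k - 1)
              @ [(x, G (perm_sublist \<sigma> Xs k (k + 0 - 1)) y)] @ drop (k + 0) Xs))) =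
      (let (x, y) = Xs ! (k - 1) in
       F (Xs[k - 1 := (G [] x, y)]) + F (Xs[k - 1 := (x, G [] y)]))"
      unfolding shuffle_perms_0_right add_0_right nil[OF k(1)]
      by (simp add: upd[OF k, simplified])
  qed
  have nil': "perm_sublist id Xs (p + 1) (p + 0) = []" for Xs :: "('w \<times> 'w) list"
    by (simp add: perm_sublist_def)
  have whole: "perm_sublist id Xs 1 p = Xs" if "length Xs = p" for Xs :: "('w \<times> 'w) list"
    using that perm_sublist_id[of p Xs] by simp
  show ?thesis
    unfolding ly_diamond_def c
    unfolding shuffle_perms_0_right nil'
    by (intro prod_eqI ext; simp add: ins[simplified] f0 vs_linear_0[OF lin] nil'[simplified] whole[simplified]
        add.commute)
qed

lemma ly_diamond_wrong_degree:
  fixes s :: "'k::field_char_0 \<Rightarrow> 'w::ab_group_add \<Rightarrow> 'w"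
  assumes PQ: "P \<in> cochains s s p" "Q \<in> cochains s s q" and ne: "p' \<noteq> p \<or> q' \<noteq> q"
  shows "ly_diamond s p' q' P Q = 0"
proof -
  have lP: "Vector_Spaces.linear s s (snd P Xs)" for Xs
    using PQ by (auto simp: cochains_def)
  then interpret vector_space s by (simp add: Vector_Spaces.linear_def)
  have P1: "fst P Xs = 0" "snd P Xs x = 0" if "length Xs \<noteq> p" for Xs x
    using that PQ by (auto simp: cochains_def wedge_multilinear_def)
  have Q1: "fst Q Xs = 0" "snd Q Xs x = 0" if "length Xs \<noteq> q" for Xs x
    using that PQ by (auto simp: cochains_def wedge_multilinear_def)
  have ins: "ly_insertions s p' q' F (snd Q) Xs = 0"
    if w: "wedge_multilinear s s p F" and L: "length Xs = p' + q'" for F Xs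
  proof -
    have F1: "F Ys = 0" if "length Ys \<noteq> p" for Ys
      using w that by (simp add: wedge_multilinear_def)
    have F2: "F (Ys @ [(0, y)] @ Zs) = 0" "F (Ys @ [(y, 0)] @ Zs) = 0" for Ys Zs y
    proof -
      let ?L = "Ys @ [(y, y)] @ Zs"
      have "F (?L[length Ys := (0, y)]) = 0 \<and> F (?L[length Ys := (y, 0)]) = 0"
      proof (cases "length ?L = p")
        case True
        then have i: "length Ys < p" by auto
        have "Vector_Spaces.linear s s (\<lambda>x. F (?L[length Ys := (x, y)]))"
          "Vector_Spaces.linear s s (\<lambda>x. F (?L[length Ys := (y, x)]))"
          using w True i unfolding wedge_multilinear_def by blast+
        from this[THEN vs_linear_0] show ?thesis by blast
      next
        case False
        then have "length (?L[length Ys := z]) \<noteq> p" for z by simp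
        then show ?thesis using F1 by blast
      qed
      then show "F (Ys @ [(0, y)] @ Zs) = 0" "F (Ys @ [(y, 0)] @ Zs) = 0" by simp_all
    qed
    have "F (perm_sublist \<sigma> Xs 1 (k - 1)
              @ [(snd Q (perm_sublist \<sigma> Xs k (k + q' - 1)) x, y)] @ drop (k + q') Xs) = 0 \<and>
          F (perm_sublist \<sigma> Xs 1 (k - 1)
              @ [(x, snd Q (perm_sublist \<sigma> Xs k (k + q' - 1)) y)] @ drop (k + q') Xs) = 0"
      if k: "k \<in> {1..p'}" for k \<sigma> x y
    proof (cases "q' = q")
      case True
      then have "p' \<noteq> p" using ne by simp
      then show ?thesis
        using k L by (auto intro!: F1)
    next
      case False
      then have "snd Q (perm_sublist \<sigma> Xs k (k + q' - 1)) z = 0" for z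
        using k by (intro Q1) simp
      then show ?thesis by (simp only: F2 simp_thms)
    qed
    then show ?thesis
      unfolding ly_insertions_def by (simp add: Let_def split_def)
  qed
  have w: "wedge_multilinear s s p (fst P)" "wedge_multilinear s s p (\<lambda>Xs. snd P Xs x)" for x
    using PQ by (auto simp: cochains_def)
  have z: "snd P Ys (fst Q Zs) = 0" "snd P Ys (snd Q Zs x) = 0"
    if "length Ys = p'" "length Zs = q'" for Ys Zs x
    using that ne by (auto simp: P1 Q1 vs_linear_0[OF lP])
  show ?thesis
    unfolding ly_diamond_def by (intro prod_eqI ext; simp add: ins w z)
qed

lemma ly_bracket_homogeneous:
  fixes s :: "'k::field_char_0 \<Rightarrow> 'w::ab_group_add \<Rightarrow> 'w"
  assumes P: "P \<in> cochains s s p" and Q: "Q \<in> cochains s s q"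
  shows "ly_bracket s P Q = ly_bracket_hom s p q P Q"
proof -
  have "Vector_Spaces.linear s s (snd P [])" using P by (auto simp: cochains_def)
  then interpret vector_space s by (simp add: Vector_Spaces.linear_def)
  have wrong: "ly_bracket_hom s p' q' P Q = 0" if "p' \<noteq> p \<or> q' \<noteq> q" for p' q'
  proof -
    have "ly_diamond s p' q' P Q = 0" "ly_diamond s q' p' Q P = 0"
      using that by (auto intro: ly_diamond_wrong_degree[OF P Q] ly_diamond_wrong_degree[OF Q P])
    then show ?thesis
      by (simp add: ly_bracket_hom_def cochain_scale_def prod_eq_iff fun_eq_iff)
  qed
  have len: "fst (ly_bracket_hom s p q P Q) Xs = 0" "snd (ly_bracket_hom s p q P Q) Xs x = 0"
    if "length Xs \<noteq> p + q" for Xs x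
    using that by (simp_all add: ly_bracket_hom_def ly_diamond_def cochain_scale_def)
  have H: "(\<Sum>i\<le>n. H (ly_bracket_hom s i (n - i) P Q)) =
      (if n = p + q then H (ly_bracket_hom s p q P Q) else 0)"
    if H0: "H 0 = 0" for n and H :: "('w, 'w) cochain \<Rightarrow> 'w"
  proof -
    have "H (ly_bracket_hom s i (n - i) P Q) =
        (if i = p then (if n = p + q then H (ly_bracket_hom s p q P Q) else 0) else 0)"
      if "i \<le> n" for i
    proof (cases "i = p \<and> n - i = q")
      case True
      then show ?thesis using that by auto
    next
      case False
      then have "ly_bracket_hom s i (n - i) P Q = 0" by (intro wrong) auto
      then show ?thesis using False H0 by auto
    qed
    then have "(\<Sum>i\<le>n. H (ly_bracket_hom s i (n - i) P Q)) =
       (\<Sum>i\<le>n. if i = p then (if n = p + q then H (ly_bracket_hom s p q P Q) else 0) else 0)"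
      by (intro sum.cong) auto
    then show ?thesis by simp
  qed
  have "fst (ly_bracket s P Q) Xs = fst (ly_bracket_hom s p q P Q) Xs" for Xs
    using H[of "\<lambda>F. fst F Xs" "length Xs"] len(1)[of Xs] by (simp add: ly_bracket_def)
  moreover have "snd (ly_bracket s P Q) Xs x = snd (ly_bracket_hom s p q P Q) Xs x" for Xs x
    using H[of "\<lambda>F. snd F Xs x" "length Xs"] len(2)[of Xs x] by (simp add: ly_bracket_def)
  ultimately show ?thesis by (intro prod_eqI ext)
qed


section \<open>\<open>L\<^sub>\<infinity>\<close>-algebras\<close>

locale graded_vector_space = vector_space scale
  for scale :: "'k::field_char_0 \<Rightarrow> 'v::ab_group_add \<Rightarrow> 'v" +
  fixes grade :: "int \<Rightarrow> 'v set"
  assumes grade_subspace: "subspace (grade n)"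
    and grade_independent:
      "finite F \<Longrightarrow> (\<And>n. n \<in> F \<Longrightarrow> v n \<in> grade n) \<Longrightarrow> (\<Sum>n\<in>F. v n) = 0 \<Longrightarrow> n \<in> F \<Longrightarrow> v n = 0"
begin

definition direct_sum :: "'v set" where
  "direct_sum = span (\<Union>n. grade n)"

end

definition koszul_sign :: "int list \<Rightarrow> (nat \<Rightarrow> nat) \<Rightarrow> int" where
  "koszul_sign ds \<sigma> =
     (\<Prod>(i, j)\<in>{(i, j). 1 \<le> i \<and> i < j \<and> j \<le> length ds \<and> \<sigma> j < \<sigma> i}.
        if odd (ds ! (\<sigma> i - 1) * ds ! (\<sigma> j - 1)) then -1 else 1)"

text \<open>The map \<open>l\<^sub>k\<close> is the restriction of \<open>l\<close> to lists of length \<open>k\<close>; the value \<open>l []\<close> is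
  irrelevant.\<close>

locale L_infinity_algebra = graded_vector_space scale grade
  for scale :: "'k::field_char_0 \<Rightarrow> 'v::ab_group_add \<Rightarrow> 'v"
    and grade :: "int \<Rightarrow> 'v set" +
  fixes l :: "'v list \<Rightarrow> 'v"
  assumes l_add: "set vs \<subseteq> direct_sum \<Longrightarrow> i < length vs \<Longrightarrow> u \<in> direct_sum \<Longrightarrow> w \<in> direct_sum \<Longrightarrow>
        l (vs[i := u + w]) = l (vs[i := u]) + l (vs[i := w])"
    and l_scale: "set vs \<subseteq> direct_sum \<Longrightarrow> i < length vs \<Longrightarrow> u \<in> direct_sum \<Longrightarrow>
        l (vs[i := scale c u]) = scale c (l (vs[i := u]))"
    and l_degree: "vs \<noteq> [] \<Longrightarrow> list_all2 (\<lambda>v d. v \<in> grade d) vs ds \<Longrightarrow>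
        l vs \<in> grade (sum_list ds + 1)"
    and l_symmetric: "vs \<noteq> [] \<Longrightarrow> list_all2 (\<lambda>v d. v \<in> grade d) vs ds \<Longrightarrow>
        \<sigma> permutes {1..length vs} \<Longrightarrow>
        l vs = scale (of_int (koszul_sign ds \<sigma>)) (l (perm_sublist \<sigma> vs 1 (length vs)))"
    and l_jacobi: "1 \<le> N \<Longrightarrow> length vs = N \<Longrightarrow> list_all2 (\<lambda>v d. v \<in> grade d) vs ds \<Longrightarrow>
        (\<Sum>i = 1..N. \<Sum>\<sigma>\<in>shuffle_perms i (N - i). scale (of_int (koszul_sign ds \<sigma>))
           (l (l (perm_sublist \<sigma> vs 1 i) # perm_sublist \<sigma> vs (i + 1) N))) = 0"

text \<open>The Maurer-Cartan equation is required to be a finite sum.\<close>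

definition maurer_cartan ::
  "('k::field_char_0 \<Rightarrow> 'v::ab_group_add \<Rightarrow> 'v) \<Rightarrow> (int \<Rightarrow> 'v set) \<Rightarrow> ('v list \<Rightarrow> 'v) \<Rightarrow> 'v \<Rightarrow> bool"
  where
  "maurer_cartan s grade l c \<longleftrightarrow>
     c \<in> grade 0 \<and>
     finite {k. 1 \<le> k \<and> l (replicate k c) \<noteq> 0} \<and>
     (\<Sum>k | 1 \<le> k \<and> l (replicate k c) \<noteq> 0. s (1 / fact k) (l (replicate k c))) = 0"


section \<open>The brackets associated with a matched pair\<close>

definition embed_cochain ::
  "('h, 'g::zero) cochain \<Rightarrow> ('g \<times> 'h, 'g \<times> 'h::zero) cochain" where
  "embed_cochain P =
     (\<lambda>Xs. (fst P (map (\<lambda>(u, v). (snd u, snd v)) Xs), 0),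
      \<lambda>Xs w. (snd P (map (\<lambda>(u, v). (snd u, snd v)) Xs) (snd w), 0))"

definition project_cochain ::
  "('g \<times> 'h, 'g::zero \<times> 'h) cochain \<Rightarrow> ('h, 'g) cochain" where
  "project_cochain F =
     (\<lambda>Xs. fst (fst F (map (\<lambda>(\<alpha>, \<beta>). ((0, \<alpha>), (0, \<beta>))) Xs)),
      \<lambda>Xs \<gamma>. fst (snd F (map (\<lambda>(\<alpha>, \<beta>). ((0, \<alpha>), (0, \<beta>))) Xs) (0, \<gamma>)))"

text \<open>A linear map as an element of degree \<open>0\<close>, and a pair of operations as an element of
  degree \<open>1\<close>.\<close>

definition linear_cochain :: "('w \<Rightarrow> 'v::zero) \<Rightarrow> ('w, 'v) cochain" where
  "linear_cochain f = (\<lambda>Xs. 0, \<lambda>Xs x. if Xs = [] then f x else 0)"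

definition structure_cochain ::
  "('w \<Rightarrow> 'w \<Rightarrow> 'w::zero) \<Rightarrow> ('w \<Rightarrow> 'w \<Rightarrow> 'w \<Rightarrow> 'w) \<Rightarrow> ('w, 'w) cochain" where
  "structure_cochain br tri =
     (\<lambda>Xs. case Xs of [(x, y)] \<Rightarrow> br x y | _ \<Rightarrow> 0,
      \<lambda>Xs z. case Xs of [(x, y)] \<Rightarrow> tri x y z | _ \<Rightarrow> 0)"

fun derived_brackets ::
  "('k::field_char_0 \<Rightarrow> 'g \<times> 'h \<Rightarrow> 'g \<times> 'h) \<Rightarrow> ('g::ab_group_add \<times> 'h::ab_group_add, 'g \<times> 'h) cochain
    \<Rightarrow> ('h, 'g) cochain list \<Rightarrow> ('h, 'g) cochain" where
  "derived_brackets s \<Theta> [P] = project_cochain (ly_bracket s \<Theta> (embed_cochain P))"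
| "derived_brackets s \<Theta> [P, Q] =
     project_cochain (ly_bracket s (ly_bracket s \<Theta> (embed_cochain P)) (embed_cochain Q))"
| "derived_brackets s \<Theta> [P, Q, R] =
     project_cochain (ly_bracket s (ly_bracket s (ly_bracket s \<Theta> (embed_cochain P))
       (embed_cochain Q)) (embed_cochain R))"
| "derived_brackets s \<Theta> _ = 0"

fun twisted_brackets ::
  "('k::field_char_0 \<Rightarrow> 'v::ab_group_add \<Rightarrow> 'v) \<Rightarrow> ('v list \<Rightarrow> 'v) \<Rightarrow> 'v \<Rightarrow> 'v list \<Rightarrow> 'v" where
  "twisted_brackets s l r [P] = l [P] + l [r, P] + s (1 / 2) (l [r, r, P])"
| "twisted_brackets s l r [P, Q] = l [P, Q] + l [r, P, Q]"
| "twisted_brackets s l r [P, Q, R] = l [P, Q, R]"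
| "twisted_brackets s l r _ = 0"

end

(*
  Both components of the product on cochains are built from signed shuffle operations, which obey a
  Leibniz rule for inserting the first letter.  By induction on the length of words this gives the
  graded pre-Lie identity, hence the graded Jacobi identity of the bracket.  The subspace a of maps
  from h to g is abelian and the kernel of the projection is a subalgebra, so the derived brackets
  of a Maurer-Cartan element in that kernel satisfy the higher Jacobi identities (Voronov).  A
  weight argument shows that four brackets with elements of a kill Pi; hence exp([_, r]) Pi is a
  finite sum, it is again Maurer-Cartan, its derived brackets are the twisted ones, and its
  projection is the defect of r as a deformation map.  Evaluating at r + r' gives the
  Maurer-Cartan criterion.
*)
theory Submission
  imports Defs
begin

section \<open>Signed shuffle operations\<close>

text \<open>The product is given by sums over permutations, where identities of associativity type
  cannot be followed letter by letter. Recursions on words replace it; they make sense for functions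
  without a fixed degree and with values in any abelian group, a sign being the operator
  \<open>psign\<close>, which acts alike on values, functions and pairs. The comparison with
  permutations happens once, in \<open>ly_diamond_circ\<close>, by way of sums over splittings of a
  list (\<open>koszul_sum\<close>); the same sums with other degrees express the higher Jacobi
  identities.

  Cochains are functions on words of all lengths. Bilinearity of the bracket is available on the
  space \<open>ml_cochains\<close>, graded identities on homogeneous elements; hence the abstract
  setting for derived brackets has an ambient space \<open>M\<close> beside the graded pieces.

  Deformation maps enter geometrically. The map \<open>f\<close> sending (x, \<alpha>) to (r
  \<alpha>, 0) squares to zero, and the exponential of bracketing with it conjugates the operations
  by the shear 1 + f. The shear carries \<open>h\<close> to the graph of \<open>r\<close>, so the
  projected result measures how far this graph is from being a subalgebra.\<close>

definition psign :: "int \<Rightarrow> 'a \<Rightarrow> 'a::ab_group_add" where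
  "psign n x = (if even n then x else - x)"

lemma psign_0 [simp]: "psign n 0 = 0"
  by (simp add: psign_def)

lemma psign_even [simp]: "even n \<Longrightarrow> psign n x = x"
  by (simp add: psign_def)

lemma psign_odd [simp]: "odd n \<Longrightarrow> psign n x = - x"
  by (simp add: psign_def)

lemma psign_add: "psign n (x + y) = psign n x + psign n y"
  by (simp add: psign_def)

lemma psign_diff: "psign n (x - y) = psign n x - psign n y"
  by (simp add: psign_def)

lemma psign_psign [simp]: "psign m (psign n x) = psign (m + n) x"
  by (simp add: psign_def)

lemma psign_apply [simp]: "psign n f x = psign n (f x)"
  by (simp add: psign_def)

lemma psign_sum: "psign n (\<Sum>i\<in>A. f i) = (\<Sum>i\<in>A. psign n (f i))"
  by (simp add: psign_def sum_negf)

definition twist :: "('x list \<Rightarrow> 'c) \<Rightarrow> 'x list \<Rightarrow> 'c::ab_group_add" where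
  "twist F w = psign (int (length w)) (F w)"

definition shift :: "'x \<Rightarrow> ('x list \<Rightarrow> 'c) \<Rightarrow> 'x list \<Rightarrow> 'c" where
  "shift X F w = F (X # w)"

text \<open>
  The three sums over shuffles in \<open>\<diamond>\<close>, for functions that need not be homogeneous, by recursion on
  the first letter: it is the first argument of \<open>P\<close> or the first argument of \<open>Q\<close>.  With
  \<open>twist\<close> absorbing the sign \<open>(-1)^q\<close> of moving a letter past \<open>Q\<close>, the sign \<open>(-1)^(pq) sign \<sigma>\<close>
  of a shuffle needs no further factor, and \<open>shift X\<close> acts as a derivation.  In
  \<open>last_comp\<close> the last letter always goes to \<open>Q\<close>, as \<open>\<sigma>(p+q) = p+q\<close> demands.
\<close>

fun shuffle_comp :: "('x list \<Rightarrow> 'b \<Rightarrow> 'c) \<Rightarrow> ('x list \<Rightarrow> 'a \<Rightarrow> 'b::ab_group_add) \<Rightarrow> 'x list \<Rightarrow> 'a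
    \<Rightarrow> 'c::ab_group_add" where
  "shuffle_comp P Q [] x = P [] (Q [] x)"
| "shuffle_comp P Q (X # w) x = shuffle_comp (shift X P) (twist Q) w x + shuffle_comp P (shift X Q) w x"

fun insertion :: "(('w \<times> 'w) list \<Rightarrow> 'c) \<Rightarrow> (('w \<times> 'w) list \<Rightarrow> 'w \<Rightarrow> 'w::ab_group_add) \<Rightarrow> ('w \<times> 'w) list
    \<Rightarrow> 'c::ab_group_add" where
  "insertion F Q [] = 0"
| "insertion F Q (X # w) = insertion (shift X F) (twist Q) w + insertion F (shift X Q) w
     + (F ((Q [] (fst X), snd X) # w) + F ((fst X, Q [] (snd X)) # w))"

fun last_comp :: "('x list \<Rightarrow> 'b \<Rightarrow> 'c) \<Rightarrow> ('x list \<Rightarrow> 'b::ab_group_add) \<Rightarrow> 'x list \<Rightarrow> 'c::ab_group_add" where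
  "last_comp P Q [] = 0"
| "last_comp P Q [X] = P [] (Q [X])"
| "last_comp P Q (X # Y # w) = last_comp (shift X P) (twist Q) (Y # w) + last_comp P (shift X Q) (Y # w)"

definition add_values :: "('x list \<Rightarrow> 'a::ab_group_add \<Rightarrow> 'b::ab_group_add) \<Rightarrow> bool" where
  "add_values P \<longleftrightarrow> (\<forall>w x y. P w (x + y) = P w x + P w y)"

definition add_letters :: "(('w::ab_group_add \<times> 'w) list \<Rightarrow> 'c::ab_group_add) \<Rightarrow> bool" where
  "add_letters F \<longleftrightarrow> (\<forall>u v x x' y. F (u @ (x + x', y) # v) = F (u @ (x, y) # v) + F (u @ (x', y) # v) \<and>
      F (u @ (y, x + x') # v) = F (u @ (y, x) # v) + F (u @ (y, x') # v))"

text \<open>Signs see a degree only modulo 2, and modulo 2 the loss of a letter under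
  \<open>shift\<close> amounts to adding one. No lower bound on \<open>p\<close> has to be carried
  through the inductions.\<close>

definition parity :: "int \<Rightarrow> ('x list \<Rightarrow> 'c::ab_group_add) \<Rightarrow> bool" where
  "parity p F \<longleftrightarrow> (\<forall>w. odd (int (length w) + p) \<longrightarrow> F w = 0)"

lemma add_valuesD: "add_values P \<Longrightarrow> P w (x + y) = P w x + P w y"
  by (simp add: add_values_def)

lemma add_values_0: "add_values P \<Longrightarrow> P w 0 = 0"
  using add_valuesD[of P w 0 0] by simp

lemma add_values_minus: "add_values P \<Longrightarrow> P w (- x) = - P w x"
  using add_valuesD[of P w x "- x"] by (simp add: add_values_0 eq_neg_iff_add_eq_0 add.commute)

lemma add_values_psign: "add_values P \<Longrightarrow> P w (psign n x) = psign n (P w x)"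
  by (simp add: psign_def add_values_minus)

lemma add_values_shift [simp]: "add_values P \<Longrightarrow> add_values (shift X P)"
  by (simp add: add_values_def shift_def)

lemma add_values_twist [simp]: "add_values P \<Longrightarrow> add_values (twist P)"
  by (simp add: add_values_def twist_def psign_add)

lemma add_lettersD1: "add_letters F \<Longrightarrow> F ((x + x', y) # v) = F ((x, y) # v) + F ((x', y) # v)"
  unfolding add_letters_def by (metis append_Nil)

lemma add_lettersD2: "add_letters F \<Longrightarrow> F ((y, x + x') # v) = F ((y, x) # v) + F ((y, x') # v)"
  unfolding add_letters_def by (metis append_Nil)

lemma add_letters_0: "add_letters F \<Longrightarrow> F ((0, y) # v) = 0" "add_letters F \<Longrightarrow> F ((y, 0) # v) = 0"
  using add_lettersD1[of F 0 0 y v] add_lettersD2[of F y 0 0 v] by simp_all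

lemma add_letters_shift [simp]: "add_letters F \<Longrightarrow> add_letters (shift X F)"
  unfolding add_letters_def shift_def by (metis append_Cons)

lemma add_letters_twist [simp]: "add_letters F \<Longrightarrow> add_letters (twist F)"
  by (simp add: add_letters_def twist_def psign_add)

lemma add_letters_apply: "add_letters F \<Longrightarrow> add_letters (\<lambda>w. F w x)"
  by (simp add: add_letters_def)

text \<open>Inside \<open>shift X\<close> the operator \<open>twist\<close> counts the letter
  \<open>X\<close>, outside it does not; so the two anticommute.\<close>

lemma twist_shift: "shift X (twist F) = - twist (shift X F)"
  by (auto simp: fun_eq_iff shift_def twist_def psign_def)

lemma parity_shift [simp]: "parity p F \<Longrightarrow> parity (p + 1) (shift X F)"
  by (auto simp: parity_def shift_def)

lemma parity_twist: "parity p F \<Longrightarrow> twist F = psign p F"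
  by (rule ext) (auto simp: parity_def twist_def psign_def)

lemma twist_add: "twist (F + F') = twist F + twist F'"
  by (simp add: twist_def psign_add fun_eq_iff)

lemma shift_add: "shift X (F + F') = shift X F + shift X F'"
  by (simp add: shift_def fun_eq_iff)

lemma shift_pair_add:
  assumes "add_letters G"
  shows "shift (x + x', y) G = shift (x, y) G + shift (x', y) G"
    and "shift (y, x + x') G = shift (y, x) G + shift (y, x') G"
  using assms by (simp_all add: fun_eq_iff shift_def add_lettersD1 add_lettersD2)

lemma shift_pair_0:
  assumes "add_letters G"
  shows "shift (0, y) G = 0" "shift (y, 0) G = 0"
  using assms by (simp_all add: fun_eq_iff shift_def add_letters_0)

lemma insertion_apply: "insertion F Q w x = insertion (\<lambda>v. F v x) Q w"
  by (induction w arbitrary: F Q) (simp_all add: shift_def[abs_def])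

lemma insertion_add_left: "insertion (F + F') Q w = insertion F Q w + insertion F' Q w"
  by (induction w arbitrary: F F' Q) (simp_all add: shift_add add_ac)

lemma insertion_zero_left: "insertion 0 Q w = 0"
  using insertion_add_left[of 0 0 Q w] by simp

lemma insertion_minus_left: "insertion (- F) Q w = - insertion F Q w"
  by (intro minus_unique[symmetric]) (simp add: insertion_zero_left flip: insertion_add_left)

lemma insertion_psign_left: "insertion (psign n F) Q w = psign n (insertion F Q w)"
  by (simp add: psign_def insertion_minus_left)

lemma insertion_add_right:
  assumes "add_letters F"
  shows "insertion F (Q + Q') w = insertion F Q w + insertion F Q' w"
proof -
  have "insertion F R w = insertion F Q w + insertion F Q' w"
    if "add_letters F" "R = Q + Q'" for F :: "('a \<times> 'a) list \<Rightarrow> 'b" and R Q Q' w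
    using that
  proof (induction w arbitrary: F R Q Q')
    case (Cons X w)
    note F = Cons.prems(1) and R = Cons.prems(2)
    have 1: "insertion (shift X F) (twist R) w = insertion (shift X F) (twist Q) w + insertion (shift X F) (twist Q') w"
      using F by (intro Cons.IH) (simp_all only: R twist_add add_letters_shift)
    have 2: "insertion F (shift X R) w = insertion F (shift X Q) w + insertion F (shift X Q') w"
      using F by (intro Cons.IH) (simp_all only: R shift_add)
    show ?case unfolding insertion.simps 1 2 by (simp add: R add_lettersD1[OF F] add_lettersD2[OF F] add_ac)
  qed simp
  from this[OF assms refl] show ?thesis .
qed

lemma insertion_zero_right: "add_letters F \<Longrightarrow> insertion F 0 w = 0"
  using insertion_add_right[of F 0 0 w] by simp

lemma insertion_minus_right: "add_letters F \<Longrightarrow> insertion F (- Q) w = - insertion F Q w"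
  by (intro minus_unique[symmetric]) (simp add: insertion_zero_right flip: insertion_add_right)

lemma insertion_psign_right: "add_letters F \<Longrightarrow> insertion F (psign n Q) w = psign n (insertion F Q w)"
  by (simp add: psign_def insertion_minus_right)

lemma insertion_twist_right:
  "add_letters F \<Longrightarrow> parity q Q \<Longrightarrow> insertion F (twist Q) w = psign q (insertion F Q w)"
  by (simp add: parity_twist insertion_psign_right)

text \<open>Additivity of \<open>Q\<close> in its last argument enters because one entry of the
  letter that takes up the output is itself fed to \<open>Q\<close>.\<close>

lemma add_letters_insertion:
  "add_letters F \<Longrightarrow> add_letters Q \<Longrightarrow> add_values Q \<Longrightarrow> add_letters (insertion F Q)"
proof -
  have "insertion F Q (u @ (x + x', y) # v) = insertion F Q (u @ (x, y) # v) + insertion F Q (u @ (x', y) # v) \<and>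
      insertion F Q (u @ (y, x + x') # v) = insertion F Q (u @ (y, x) # v) + insertion F Q (u @ (y, x') # v)"
    if "add_letters F" "add_letters Q" "add_values Q" for F and Q :: "('a \<times> 'a) list \<Rightarrow> 'a \<Rightarrow> 'a" and u v x x' y
    using that
  proof (induction u arbitrary: F Q)
    case Nil
    then show ?case
      by (simp add: shift_pair_add insertion_add_left insertion_add_right add_valuesD[of Q] add_lettersD1[of F] add_lettersD2[of F] add_ac)
  next
    case (Cons Z u)
    have 1: "F (Z # u @ (x + x', y) # v) = F (Z # u @ (x, y) # v) + F (Z # u @ (x', y) # v)"
      "F (Z # u @ (y, x + x') # v) = F (Z # u @ (y, x) # v) + F (Z # u @ (y, x') # v)" for Z
      using Cons.prems(1) unfolding add_letters_def by (metis append_Cons)+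
    show ?case using Cons.prems by (simp add: Cons.IH 1, (simp add: add_ac)?)
  qed
  then show "add_letters F \<Longrightarrow> add_letters Q \<Longrightarrow> add_values Q \<Longrightarrow> add_letters (insertion F Q)"
    unfolding add_letters_def[of "insertion F Q"] by blast
qed

text \<open>\<open>Q\<close> reads \<open>q\<close> letters and one entry of a further letter, which
  \<open>F\<close> still receives; so lengths add up without a shift by one.\<close>

lemma parity_insertion: "add_letters F \<Longrightarrow> parity p F \<Longrightarrow> parity q Q \<Longrightarrow> parity (p + q) (insertion F Q)"
proof -
  have "insertion F Q w = 0" if "add_letters F" "parity p F" "parity q Q" "odd (int (length w) + (p + q))"
    for F and Q :: "('a \<times> 'a) list \<Rightarrow> 'a \<Rightarrow> 'a" and w p q
    using that
  proof (induction w arbitrary: F Q p q)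
    case (Cons X w)
    have 1: "insertion (shift X F) Q w = 0" "insertion F (shift X Q) w = 0"
      using Cons.prems by (auto intro: Cons.IH[where p = "p + 1" and q = q] Cons.IH[where p = p and q = "q + 1"])
    \<comment> \<open>For even \<open>q\<close> the word has the wrong parity for \<open>F\<close>;
      for odd \<open>q\<close> already \<open>Q []\<close> is zero.\<close>
    have "F ((Q [] (fst X), snd X) # w) + F ((fst X, Q [] (snd X)) # w) = 0"
    proof (cases "even q")
      case True
      then show ?thesis using Cons.prems by (simp add: parity_def)
    next
      case False
      then have "Q [] = 0" using Cons.prems by (simp add: parity_def)
      then show ?thesis using Cons.prems by (simp add: add_letters_0)
    qed
    then show ?case using Cons.prems 1
      by (simp add: insertion_twist_right[of _ q])
  qed simp
  then show "add_letters F \<Longrightarrow> parity p F \<Longrightarrow> parity q Q \<Longrightarrow> parity (p + q) (insertion F Q)"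
    unfolding parity_def[of "p + q"] by blast
qed


lemma shuffle_comp_add_left: "shuffle_comp (P + P') Q w x = shuffle_comp P Q w x + shuffle_comp P' Q w x"
  by (induction w arbitrary: P P' Q) (simp_all add: shift_add add_ac)

lemma shuffle_comp_zero_left: "shuffle_comp 0 Q w x = 0"
  using shuffle_comp_add_left[of 0 0 Q w x] by simp

lemma shuffle_comp_minus_left: "shuffle_comp (- P) Q w x = - shuffle_comp P Q w x"
  by (intro minus_unique[symmetric]) (simp add: shuffle_comp_zero_left flip: shuffle_comp_add_left)

lemma shuffle_comp_psign_left: "shuffle_comp (psign n P) Q w x = psign n (shuffle_comp P Q w x)"
  by (simp add: psign_def shuffle_comp_minus_left)

lemma shuffle_comp_add_right:
  "add_values P \<Longrightarrow> shuffle_comp P (Q + Q') w x = shuffle_comp P Q w x + shuffle_comp P Q' w x"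
  by (induction w arbitrary: P Q Q') (simp_all add: shift_add twist_add add_valuesD add_ac)

lemma shuffle_comp_zero_right: "add_values P \<Longrightarrow> shuffle_comp P 0 w x = 0"
  using shuffle_comp_add_right[of P 0 0 w x] by simp

lemma shuffle_comp_minus_right: "add_values P \<Longrightarrow> shuffle_comp P (- Q) w x = - shuffle_comp P Q w x"
  by (intro minus_unique[symmetric]) (simp add: shuffle_comp_zero_right flip: shuffle_comp_add_right)

lemma shuffle_comp_psign_right: "add_values P \<Longrightarrow> shuffle_comp P (psign n Q) w x = psign n (shuffle_comp P Q w x)"
  by (simp add: psign_def shuffle_comp_minus_right)

lemma shuffle_comp_twist_right:
  "add_values P \<Longrightarrow> parity q Q \<Longrightarrow> shuffle_comp P (twist Q) w x = psign q (shuffle_comp P Q w x)"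
  by (simp add: parity_twist shuffle_comp_psign_right)

lemma shift_shuffle_comp:
  "shift X (shuffle_comp P Q) = shuffle_comp (shift X P) (twist Q) + shuffle_comp P (shift X Q)"
  by (simp add: fun_eq_iff shift_def)

lemma shift_insertion:
  "shift X (insertion F Q) = insertion (shift X F) (twist Q) + insertion F (shift X Q)
     + (shift (Q [] (fst X), snd X) F + shift (fst X, Q [] (snd X)) F)"
  by (simp add: fun_eq_iff shift_def)

lemma add_values_shuffle_comp: "add_values P \<Longrightarrow> add_values Q \<Longrightarrow> add_values (shuffle_comp P Q)"
proof -
  have "shuffle_comp P Q w (x + y) = shuffle_comp P Q w x + shuffle_comp P Q w y" if "add_values P" "add_values Q"
    for P :: "'a list \<Rightarrow> 'b \<Rightarrow> 'c" and Q :: "'a list \<Rightarrow> 'd \<Rightarrow> 'b" and w x y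
    using that by (induction w arbitrary: P Q) (simp_all add: add_valuesD add_ac)
  then show "add_values P \<Longrightarrow> add_values Q \<Longrightarrow> add_values (shuffle_comp P Q)" by (simp add: add_values_def)
qed

lemma add_values_insertion: "add_values P \<Longrightarrow> add_values (insertion P Q)"
proof -
  have "insertion P Q w (x + y) = insertion P Q w x + insertion P Q w y" if "add_values P"
    for P :: "('a \<times> 'a) list \<Rightarrow> 'b \<Rightarrow> 'c" and Q w x y
    using that by (induction w arbitrary: P Q) (simp_all add: add_valuesD add_ac)
  then show "add_values P \<Longrightarrow> add_values (insertion P Q)" by (simp add: add_values_def)
qed

text \<open>A word is as long as its two subwords together, so \<open>twist\<close> is
  multiplicative.\<close>

lemma twist_shuffle_comp: "add_values P \<Longrightarrow> twist (shuffle_comp P Q) = shuffle_comp (twist P) (twist Q)"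
proof -
  have "twist (shuffle_comp P Q) w x = shuffle_comp (twist P) (twist Q) w x" if "add_values P"
    for P :: "'a list \<Rightarrow> 'b \<Rightarrow> 'c" and Q :: "'a list \<Rightarrow> 'd \<Rightarrow> 'b" and w x
    using that
  proof (induction w arbitrary: P Q)
    case (Cons X w)
    have "twist (shuffle_comp P Q) (X # w) x =
        - (twist (shuffle_comp (shift X P) (twist Q)) w x + twist (shuffle_comp P (shift X Q)) w x)"
      by (simp add: twist_def psign_def)
    then show ?case using Cons
      by (simp add: twist_shift shuffle_comp_minus_left shuffle_comp_minus_right)
  qed (simp add: twist_def)
  then show "add_values P \<Longrightarrow> twist (shuffle_comp P Q) = shuffle_comp (twist P) (twist Q)"
    by (simp add: fun_eq_iff)
qed

text \<open>On both sides a letter goes to \<open>P\<close>, \<open>Q\<close> or \<open>R\<close>.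
  Going to \<open>P\<close> twists both other factors, and by multiplicativity of
  \<open>twist\<close> the three cases agree.\<close>

lemma shuffle_comp_assoc:
  "add_values P \<Longrightarrow> add_values Q \<Longrightarrow> shuffle_comp (shuffle_comp P Q) R w x = shuffle_comp P (shuffle_comp Q R) w x"
proof (induction w arbitrary: P Q R)
  case (Cons X w)
  then show ?case
    by (simp add: shift_shuffle_comp shuffle_comp_add_left shuffle_comp_add_right twist_shuffle_comp add_ac)
qed simp

lemma parity_shuffle_comp: "add_values P \<Longrightarrow> parity p P \<Longrightarrow> parity q Q \<Longrightarrow> parity (p + q) (shuffle_comp P Q)"
proof -
  have "shuffle_comp P Q w x = 0" if "add_values P" "parity p P" "parity q Q" "odd (int (length w) + (p + q))"
    for P :: "'a list \<Rightarrow> 'b \<Rightarrow> 'c" and Q :: "'a list \<Rightarrow> 'd \<Rightarrow> 'b" and w x p q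
    using that
  proof (induction w arbitrary: P Q p q)
    case Nil
    then have "odd p \<or> odd q" by simp
    then have "P [] = 0 \<or> Q [] = 0" using Nil by (auto simp: parity_def)
    then show ?case using Nil by (auto simp: add_values_0)
  next
    case (Cons X w)
    have 1: "shuffle_comp (shift X P) Q w x = 0" "shuffle_comp P (shift X Q) w x = 0"
      using Cons.prems by (auto intro: Cons.IH[where p = "p + 1" and q = q] Cons.IH[where p = p and q = "q + 1"])
    then show ?case using Cons.prems by (simp add: shuffle_comp_twist_right[of _ q])
  qed
  then show "add_values P \<Longrightarrow> parity p P \<Longrightarrow> parity q Q \<Longrightarrow> parity (p + q) (shuffle_comp P Q)"
    unfolding parity_def[of "p + q"] zero_fun_def by blast
qed

lemma add_letters_shuffle_comp: "add_letters P \<Longrightarrow> add_letters Q \<Longrightarrow> add_values P \<Longrightarrow> add_letters (shuffle_comp P Q)"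
proof -
  have "shuffle_comp P Q (u @ (x + x', y) # v) z = shuffle_comp P Q (u @ (x, y) # v) z + shuffle_comp P Q (u @ (x', y) # v) z \<and>
      shuffle_comp P Q (u @ (y, x + x') # v) z = shuffle_comp P Q (u @ (y, x) # v) z + shuffle_comp P Q (u @ (y, x') # v) z"
    if "add_letters P" "add_letters Q" "add_values P" for P :: "('a \<times> 'a) list \<Rightarrow> 'b \<Rightarrow> 'c"
      and Q :: "('a \<times> 'a) list \<Rightarrow> 'd \<Rightarrow> 'b" and u v x x' y z
    using that
  proof (induction u arbitrary: P Q)
    case Nil
    then show ?case
      by (simp add: shift_pair_add shuffle_comp_add_left shuffle_comp_add_right add_ac)
  next
    case (Cons Z u)
    then show ?case by (simp add: Cons.IH, (simp add: add_ac)?)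
  qed
  then show "add_letters P \<Longrightarrow> add_letters Q \<Longrightarrow> add_values P \<Longrightarrow> add_letters (shuffle_comp P Q)"
    unfolding add_letters_def[of "shuffle_comp P Q"] fun_eq_iff plus_fun_apply by blast
qed

lemma last_comp_Cons:
  "w \<noteq> [] \<Longrightarrow> last_comp P Q (X # w) = last_comp (shift X P) (twist Q) w + last_comp P (shift X Q) w"
  by (cases w) auto

lemma last_comp_add_left: "last_comp (P + P') Q w = last_comp P Q w + last_comp P' Q w"
proof -
  have "last_comp R Q w = last_comp P Q w + last_comp P' Q w" if "R = P + P'" for R P P' Q w
    using that
  proof (induction w arbitrary: R P P' Q)
    case (Cons X w)
    note R = Cons.prems
    have 1: "last_comp (shift X R) (twist Q) w = last_comp (shift X P) (twist Q) w + last_comp (shift X P') (twist Q) w"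
      by (intro Cons.IH) (simp only: R shift_add)
    have 2: "last_comp R (shift X Q) w = last_comp P (shift X Q) w + last_comp P' (shift X Q) w"
      by (intro Cons.IH R)
    show ?case
    proof (cases "w = []")
      case False
      show ?thesis unfolding last_comp_Cons[OF False] 1 2 by (simp only: add_ac)
    qed (simp add: R)
  qed simp
  from this[OF refl] show ?thesis .
qed

lemma last_comp_zero_left: "last_comp 0 Q w = 0"
  using last_comp_add_left[of 0 0 Q w] by simp

lemma last_comp_minus_left: "last_comp (- P) Q w = - last_comp P Q w"
  by (intro minus_unique[symmetric]) (simp add: last_comp_zero_left flip: last_comp_add_left)

lemma last_comp_psign_left: "last_comp (psign n P) Q w = psign n (last_comp P Q w)"
  by (simp add: psign_def last_comp_minus_left)

lemma last_comp_add_right: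
  assumes "add_values P"
  shows "last_comp P (Q + Q') w = last_comp P Q w + last_comp P Q' w"
proof -
  have "last_comp P R w = last_comp P Q w + last_comp P Q' w"
    if "add_values P" "R = Q + Q'" for P R Q Q' w
    using that
  proof (induction w arbitrary: P R Q Q')
    case (Cons X w)
    note P = Cons.prems(1) and R = Cons.prems(2)
    have 1: "last_comp (shift X P) (twist R) w = last_comp (shift X P) (twist Q) w + last_comp (shift X P) (twist Q') w"
      using P by (intro Cons.IH) (simp_all only: R twist_add add_values_shift)
    have 2: "last_comp P (shift X R) w = last_comp P (shift X Q) w + last_comp P (shift X Q') w"
      using P by (intro Cons.IH) (simp_all only: R shift_add)
    show ?case
    proof (cases "w = []")
      case False
      show ?thesis unfolding last_comp_Cons[OF False] 1 2 by (simp only: add_ac)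
    qed (simp add: R add_valuesD[OF P])
  qed simp
  from this[OF assms refl] show ?thesis .
qed

lemma last_comp_zero_right: "add_values P \<Longrightarrow> last_comp P 0 w = 0"
  using last_comp_add_right[of P 0 0 w] by simp

lemma last_comp_minus_right: "add_values P \<Longrightarrow> last_comp P (- Q) w = - last_comp P Q w"
  by (intro minus_unique[symmetric]) (simp add: last_comp_zero_right flip: last_comp_add_right)

lemma last_comp_psign_right: "add_values P \<Longrightarrow> last_comp P (psign n Q) w = psign n (last_comp P Q w)"
  by (simp add: psign_def last_comp_minus_right)

text \<open>\<open>Q\<close> always receives the last letter and is never evaluated at
  \<open>[]\<close>. This matters because the recursion \<open>last_comp_Cons\<close> fails on
  one-letter words, so the derivation rule for \<open>shift X (last_comp Q R)\<close> is available
  only off \<open>[]\<close>.\<close>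

lemma last_comp_cong:
  assumes "\<And>v. v \<noteq> [] \<Longrightarrow> Q v = Q' v"
  shows "last_comp P Q w = last_comp P Q' w"
proof -
  have "last_comp P Q w = last_comp P Q' w" if "\<forall>v. v \<noteq> [] \<longrightarrow> Q v = Q' v" for P Q Q' w
    using that
  proof (induction w arbitrary: P Q Q')
    case (Cons X w)
    have 1: "last_comp (shift X P) (twist Q) w = last_comp (shift X P) (twist Q') w"
      using Cons.prems by (intro Cons.IH) (auto simp: twist_def)
    have 2: "last_comp P (shift X Q) w = last_comp P (shift X Q') w"
      using Cons.prems by (intro Cons.IH) (auto simp: shift_def)
    show ?case
    proof (cases "w = []")
      case False
      show ?thesis unfolding last_comp_Cons[OF False] 1 2 ..
    qed (use Cons.prems in simp)
  qed simp
  then show ?thesis using assms by blast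
qed

text \<open>The outer function always receives at least the modified letter.\<close>

lemma insertion_cong:
  assumes "\<And>v. v \<noteq> [] \<Longrightarrow> F v = F' v"
  shows "insertion F Q w = insertion F' Q w"
proof -
  have "insertion F Q w = insertion F' Q w" if "\<forall>v. v \<noteq> [] \<longrightarrow> F v = F' v" for F F' Q w
    using that
  proof (induction w arbitrary: F F' Q)
    case (Cons X w)
    have 1: "shift X F = shift X F'"
      using Cons.prems by (auto simp: shift_def)
    have 2: "insertion F (shift X Q) w = insertion F' (shift X Q) w"
      by (intro Cons.IH Cons.prems)
    show ?case unfolding insertion.simps 1 2 using Cons.prems by simp
  qed simp
  then show ?thesis using assms by blast
qed

lemma twist_last_comp:
  "add_values P \<Longrightarrow> twist (last_comp P Q) = last_comp (twist P) (twist Q)"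
proof -
  have "twist (last_comp P Q) w = last_comp (twist P) (twist Q) w" if "add_values P"
    for P :: "'a list \<Rightarrow> 'b \<Rightarrow> 'c" and Q w
    using that
  proof (induction w arbitrary: P Q)
    case (Cons X w)
    show ?case
    proof (cases "w = []")
      case True
      then show ?thesis using Cons by (simp add: twist_def add_values_minus)
    next
      case False
      then have "twist (last_comp P Q) (X # w) =
          - (twist (last_comp (shift X P) (twist Q)) w + twist (last_comp P (shift X Q)) w)"
        by (simp add: twist_def psign_def last_comp_Cons)
      then show ?thesis using Cons False
        by (simp add: last_comp_Cons twist_shift last_comp_minus_left last_comp_minus_right)
    qed
  qed (simp add: twist_def)
  then show "add_values P \<Longrightarrow> twist (last_comp P Q) = last_comp (twist P) (twist Q)"
    by (simp add: fun_eq_iff)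
qed

lemma last_comp_assoc:
  "add_values P \<Longrightarrow> add_values Q \<Longrightarrow> last_comp (shuffle_comp P Q) R w = last_comp P (last_comp Q R) w"
proof (induction w arbitrary: P Q R)
  case (Cons X w)
  show ?case
  proof (cases "w = []")
    case False
    then have "last_comp P (shift X (last_comp Q R)) w =
        last_comp P (last_comp (shift X Q) (twist R) + last_comp Q (shift X R)) w"
      by (intro last_comp_cong) (simp add: shift_def last_comp_Cons)
    then show ?thesis using Cons False
      by (simp add: last_comp_Cons shift_shuffle_comp last_comp_add_left last_comp_add_right twist_last_comp add_ac)
  qed simp
qed simp

lemma add_letters_last_comp: "add_letters P \<Longrightarrow> add_letters Q \<Longrightarrow> add_values P \<Longrightarrow> add_letters (last_comp P Q)"
proof -
  have "last_comp P Q (u @ (x + x', y) # v) = last_comp P Q (u @ (x, y) # v) + last_comp P Q (u @ (x', y) # v) \<and>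
      last_comp P Q (u @ (y, x + x') # v) = last_comp P Q (u @ (y, x) # v) + last_comp P Q (u @ (y, x') # v)"
    if "add_letters P" "add_letters Q" "add_values P" for P :: "('a \<times> 'a) list \<Rightarrow> 'b \<Rightarrow> 'c"
      and Q :: "('a \<times> 'a) list \<Rightarrow> 'b" and u v x x' y
    using that
  proof (induction u arbitrary: P Q)
    case Nil
    then show ?case
      by (cases "v = []") (simp_all add: last_comp_Cons shift_pair_add last_comp_add_left
        last_comp_add_right add_lettersD1[of Q] add_lettersD2[of Q] add_valuesD add_ac)
  next
    case (Cons Z u)
    then show ?case by (simp add: Cons.IH last_comp_Cons, (simp add: add_ac)?)
  qed
  then show "add_letters P \<Longrightarrow> add_letters Q \<Longrightarrow> add_values P \<Longrightarrow> add_letters (last_comp P Q)"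
    unfolding add_letters_def[of "last_comp P Q"] by blast
qed

lemma shuffle_comp_psign_fun:
  "shuffle_comp (psign n P) Q = psign n (shuffle_comp P Q)"
  "add_values P \<Longrightarrow> shuffle_comp P (psign n Q) = psign n (shuffle_comp P Q)"
  by (simp_all add: fun_eq_iff shuffle_comp_psign_left shuffle_comp_psign_right)

lemma last_comp_psign_fun:
  "last_comp (psign n P) Q = psign n (last_comp P Q)"
  "add_values P \<Longrightarrow> last_comp P (psign n Q) = psign n (last_comp P Q)"
  by (simp_all add: fun_eq_iff last_comp_psign_left last_comp_psign_right)

lemma insertion_psign_fun:
  "insertion (psign n P) Q = psign n (insertion P Q)"
  "add_letters P \<Longrightarrow> insertion P (psign n Q) = psign n (insertion P Q)"
  by (simp_all only: fun_eq_iff insertion_psign_left insertion_psign_right psign_apply simp_thms)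

text \<open>The letter modified by \<open>Q\<close> belongs either to \<open>R\<close> or to
  \<open>P\<close>. In the second case \<open>Q\<close> has to be moved past \<open>R\<close>, at
  the cost of (-1)^(rq).\<close>

lemma insertion_shuffle_comp:
  "add_values P \<Longrightarrow> add_letters P \<Longrightarrow> add_letters R \<Longrightarrow> parity r R \<Longrightarrow> parity q Q \<Longrightarrow>
    insertion (shuffle_comp P R) Q w x = shuffle_comp P (insertion R Q) w x + psign (r * q) (shuffle_comp (insertion P Q) R w x)"
proof (induction w arbitrary: P R Q r q)
  case (Cons X w)
  note prems = Cons.prems
  have IH1: "insertion (shuffle_comp (shift X P) R) Q w x =
      shuffle_comp (shift X P) (insertion R Q) w x + psign (r * q) (shuffle_comp (insertion (shift X P) Q) R w x)"
    using prems by (intro Cons.IH) auto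
  have IH2: "insertion (shuffle_comp P (shift X R)) Q w x =
      shuffle_comp P (insertion (shift X R) Q) w x + psign ((r + 1) * q) (shuffle_comp (insertion P Q) (shift X R) w x)"
    using prems by (intro Cons.IH) auto
  have IH3: "insertion (shuffle_comp P R) (shift X Q) w x =
      shuffle_comp P (insertion R (shift X Q)) w x + psign (r * (q + 1)) (shuffle_comp (insertion P (shift X Q)) R w x)"
    using prems by (intro Cons.IH) auto
  have pr: "parity (r + q) (insertion R Q)" using prems by (intro parity_insertion) auto
  \<comment> \<open>The terms in which \<open>X\<close> itself is modified contain
    \<open>Q []\<close>; they survive only for even \<open>q\<close>, where moving \<open>Q\<close>
    costs no sign.\<close>
  have zq: "Q [] = 0" if "odd q" using prems that by (simp add: parity_def)
  have tw: "twist R = psign r R" "twist Q = psign q Q" "twist (insertion R Q) = psign (r + q) (insertion R Q)"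
    using prems pr by (simp_all add: parity_twist)
  have b: "add_letters (shuffle_comp P R)" "add_letters (shuffle_comp (shift X P) R)" "add_letters (shuffle_comp P (shift X R))"
    "add_values (insertion P G)" "add_values (insertion (shift X P) G)" "add_letters (shift X P)" "add_letters (shift X R)"
    "add_values (shift Y P)" for G Y
    using prems by (auto intro!: add_letters_shuffle_comp add_values_insertion)
  show ?case
    \<comment> \<open>Once both parities are fixed, every \<open>psign\<close> is a plain sign and
      an identity in an abelian group is left.\<close>
    apply (cases "even q"; cases "even r")
    apply (simp_all only: insertion.simps shuffle_comp.simps plus_fun_apply shift_shuffle_comp shift_insertion
      shuffle_comp_add_left shuffle_comp_add_right insertion_add_left insertion_psign_fun shuffle_comp_psign_fun
      tw b prems psign_apply IH1 IH2 IH3 psign_add psign_psign)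
    by (simp_all add: zq prems shift_pair_0 shuffle_comp_zero_left shuffle_comp_zero_right algebra_simps)
qed (simp add: add_values_0)

lemma insertion_last_comp:
  "add_values P \<Longrightarrow> add_letters P \<Longrightarrow> add_letters R \<Longrightarrow> parity r R \<Longrightarrow> parity q Q \<Longrightarrow>
    insertion (last_comp P R) Q w = last_comp P (insertion R Q) w + psign (r * q) (last_comp (insertion P Q) R w)"
proof (induction w arbitrary: P R Q r q)
  case (Cons X w)
  note prems = Cons.prems
  have zq: "Q [] = 0" if "odd q" using prems that by (simp add: parity_def)
  have b: "add_letters (last_comp P R)" "add_letters (last_comp (shift X P) R)" "add_letters (last_comp P (shift X R))"
    "add_values (insertion P G)" "add_values (insertion (shift X P) G)" "add_letters (shift X P)" "add_letters (shift X R)"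
    "add_values (shift Y P)" for G Y
    using prems by (auto intro!: add_letters_last_comp add_values_insertion)
  show ?case
  proof (cases "w = []")
    case True
    then show ?thesis by (simp add: prems add_valuesD)
  next
    case False
    have IH1: "insertion (last_comp (shift X P) R) Q w =
        last_comp (shift X P) (insertion R Q) w + psign (r * q) (last_comp (insertion (shift X P) Q) R w)"
      using prems by (intro Cons.IH) auto
    have IH2: "insertion (last_comp P (shift X R)) Q w =
        last_comp P (insertion (shift X R) Q) w + psign ((r + 1) * q) (last_comp (insertion P Q) (shift X R) w)"
      using prems by (intro Cons.IH) auto
    have IH3: "insertion (last_comp P R) (shift X Q) w =
        last_comp P (insertion R (shift X Q)) w + psign (r * (q + 1)) (last_comp (insertion P (shift X Q)) R w)"
      using prems by (intro Cons.IH) auto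
    have pr: "parity (r + q) (insertion R Q)" using prems by (intro parity_insertion) auto
    have tw: "twist R = psign r R" "twist Q = psign q Q" "twist (insertion R Q) = psign (r + q) (insertion R Q)"
      using prems pr by (simp_all add: parity_twist)
    \<comment> \<open>The derivation rule of \<open>last_comp\<close> excludes the empty word, at
      which \<open>insertion\<close> does not look.\<close>
    have sh: "insertion (shift X (last_comp P R)) G w =
       insertion (last_comp (shift X P) (twist R) + last_comp P (shift X R)) G w" for G
      by (rule insertion_cong) (simp add: shift_def last_comp_Cons)
    show ?thesis
      apply (cases "even q"; cases "even r")
      apply (simp_all only: insertion.simps last_comp_Cons[OF False] plus_fun_apply sh shift_insertion
        last_comp_add_left last_comp_add_right insertion_add_left insertion_psign_fun last_comp_psign_fun
        tw b prems psign_apply IH1 IH2 IH3 psign_add psign_psign)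
      by (simp_all add: zq prems shift_pair_0 last_comp_zero_left last_comp_zero_right algebra_simps)
  qed
qed simp

section \<open>The graded right pre-Lie identity\<close>

definition circ_II where "circ_II P Q = shuffle_comp P Q + insertion P Q"

lemma shift_circ_II:
  "shift X (circ_II P Q) = circ_II (shift X P) (twist Q) + circ_II P (shift X Q)
     + (shift (Q [] (fst X), snd X) P + shift (fst X, Q [] (snd X)) P)"
  by (simp add: circ_II_def shift_shuffle_comp shift_insertion shift_add add_ac)

text \<open>The subtracted term collects all cases where \<open>Q\<close> acts inside
  \<open>P\<close>: on the entry fed to \<open>P\<close> (\<open>shuffle_comp\<close>) or on a
  letter read by \<open>P\<close> (\<open>insertion\<close>). What remains are the cases where
  \<open>P\<close> and \<open>Q\<close> act on different letters of \<open>F\<close> or on the two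
  entries of one letter, and these are graded symmetric in \<open>P\<close> and
  \<open>Q\<close>.\<close>

lemma insertion_insertion:
  assumes "add_letters F" "add_letters P" "add_letters Q" "add_values P" "add_values Q" "parity p P" "parity q Q"
  shows "insertion (insertion F P) Q w - insertion F (circ_II P Q) w =
    psign (p * q) (insertion (insertion F Q) P w - insertion F (circ_II Q P) w)"
  using assms
proof (induction w arbitrary: F P Q p q)
  case (Cons X w)
  note prems = Cons.prems
  obtain x y where X: "X = (x, y)" by (cases X)
  define S where "S F P Q = insertion (insertion F P) Q w - insertion F (circ_II P Q) w"
    for F :: "('a \<times> 'a) list \<Rightarrow> 'b" and P Q
  \<comment> \<open>The first letter splits the associator into three associators on the shorter
    word, terms where \<open>X\<close> takes up one output, and terms where its two entries take up
    both. The pair is arbitrary, so that the expansion also applies with \<open>P\<close> and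
    \<open>Q\<close> exchanged.\<close>
  have exp: "insertion (insertion F P) Q (X # w) - insertion F (circ_II P Q) (X # w) =
      psign (p + q) (S (shift X F) P Q) + psign q (S F (shift X P) Q) + S F P (shift X Q)
      + psign q (insertion (shift (P [] x, y) F) Q w + insertion (shift (x, P [] y) F) Q w)
      + psign p (insertion (shift (Q [] x, y) F) P w + insertion (shift (x, Q [] y) F) P w)
      + (F ((Q [] x, P [] y) # w) + F ((P [] x, Q [] y) # w))"
    if prems: "add_letters F" "add_letters P" "add_letters Q" "add_values P" "add_values Q" "parity p P" "parity q Q" for P Q p q
  proof -
    have tw: "twist P = psign p P" "twist Q = psign q Q"
      using prems by (simp_all add: parity_twist)
    have pb: "parity (p + q) (circ_II P Q)"
      using prems parity_shuffle_comp[of P p q Q] parity_insertion[of P p q Q] by (simp add: circ_II_def parity_def)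
    have b: "add_letters (insertion F P)" "add_letters (insertion (shift Y F) P)" "add_letters (insertion F (shift Y P))"
       "add_letters (shift Y F)" for Y
      using prems by (auto intro!: add_letters_insertion)
    have bb: "circ_II P (psign n Q) = psign n (circ_II P Q)" "circ_II (shift Y P) (psign n Q) = psign n (circ_II (shift Y P) Q)" for n Y
      using prems by (simp_all add: circ_II_def shuffle_comp_psign_fun insertion_psign_fun psign_add fun_eq_iff)
    have b0: "circ_II P Q [] z = P [] (Q [] z)" for z
      by (simp add: circ_II_def)
    show ?thesis
      apply (simp only: insertion.simps shift_insertion parity_twist[OF pb] tw shift_circ_II bb insertion_psign_fun prems b
         psign_apply insertion_add_left insertion_add_right psign_add psign_psign X fst_conv snd_conv b0 S_def)
      by (simp add: psign_diff algebra_simps)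
  qed
  have IH: "S (shift X F) P Q = psign (p * q) (S (shift X F) Q P)"
    "S F (shift X P) Q = psign ((p + 1) * q) (S F Q (shift X P))"
    "S F P (shift X Q) = psign (p * (q + 1)) (S F (shift X Q) P)"
    unfolding S_def using prems by (intro Cons.IH; simp)+
  have z: "odd p \<Longrightarrow> P [] = 0" "odd q \<Longrightarrow> Q [] = 0"
    using prems by (simp_all add: parity_def)
  show ?case
    unfolding exp[OF prems(1-7)] exp[OF prems(1,3,2,5,4,7,6)] IH
    by (cases "even p"; cases "even q")
      (simp_all add: z prems shift_pair_0 insertion_zero_left add_letters_0 algebra_simps)
qed simp

text \<open>As \<open>shuffle_comp\<close> is associative, the rule
  \<open>insertion_shuffle_comp\<close> reduces the associator to that of \<open>insertion\<close>
  and two mixed terms. These change places, up to (-1)^(pq), when \<open>P\<close> and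
  \<open>Q\<close> do.\<close>

lemma shuffle_comp_circ_II:
  assumes "add_letters F" "add_letters P" "add_letters Q" "add_values F" "add_values P" "add_values Q" "parity p P" "parity q Q"
  shows "circ_II (circ_II F P) Q - circ_II F (circ_II P Q) =
    psign (p * q) (circ_II (circ_II F Q) P - circ_II F (circ_II Q P))"
proof -
  have 1: "circ_II (circ_II F P) Q w x - circ_II F (circ_II P Q) w x =
      shuffle_comp (insertion F P) Q w x + psign (p * q) (shuffle_comp (insertion F Q) P w x)
       + (insertion (insertion F P) Q w - insertion F (circ_II P Q) w) x"
    if "add_letters P" "add_letters Q" "add_values P" "add_values Q" "parity p P" "parity q Q" for P Q p q w x
    using assms that unfolding circ_II_def
    by (simp add: shuffle_comp_add_left shuffle_comp_add_right insertion_add_left shuffle_comp_assoc insertion_shuffle_comp)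
  have "circ_II (circ_II F P) Q w x - circ_II F (circ_II P Q) w x =
    psign (p * q) (circ_II (circ_II F Q) P w x - circ_II F (circ_II Q P) w x)" for w x
    unfolding 1[OF assms(2,3,5,6,7,8)] 1[OF assms(3,2,6,5,8,7)]
      insertion_insertion[OF assms(1,2,3,5,6,7,8)]
    by (cases "even p"; cases "even q") (simp_all add: algebra_simps)
  then show ?thesis by (simp add: fun_eq_iff)
qed

text \<open>The same cancellation for first components, for which \<open>F1\<close>,
  \<open>P1\<close> and \<open>Q1\<close> stand; the outer composition is now
  \<open>last_comp\<close>.\<close>

lemma last_comp_circ_II:
  assumes "add_letters F1" "add_letters P1" "add_letters Q1" "parity p P1" "parity q Q1"
    "add_letters F" "add_letters P" "add_letters Q" "add_values F" "add_values P" "add_values Q" "parity p P" "parity q Q"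
  shows "last_comp (circ_II F P) Q1 + insertion (last_comp F P1 + insertion F1 P) Q
      - (last_comp F (last_comp P Q1 + insertion P1 Q) + insertion F1 (circ_II P Q)) =
    psign (p * q) (last_comp (circ_II F Q) P1 + insertion (last_comp F Q1 + insertion F1 Q) P
      - (last_comp F (last_comp Q P1 + insertion Q1 P) + insertion F1 (circ_II Q P)))"
proof -
  have 1: "(last_comp (circ_II F P) Q1 + insertion (last_comp F P1 + insertion F1 P) Q
      - (last_comp F (last_comp P Q1 + insertion P1 Q) + insertion F1 (circ_II P Q))) w =
      last_comp (insertion F P) Q1 w + psign (p * q) (last_comp (insertion F Q) P1 w)
       + (insertion (insertion F1 P) Q w - insertion F1 (circ_II P Q) w)"
    if "add_letters P1" "add_letters Q1" "parity p P1" "parity q Q1"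
      "add_letters P" "add_letters Q" "add_values P" "add_values Q" "parity p P" "parity q Q" for P Q P1 Q1 p q w
    using assms(1,6,9) that unfolding circ_II_def[of F P]
    by (simp add: last_comp_add_left last_comp_add_right insertion_add_left last_comp_assoc insertion_last_comp)
  show ?thesis
    apply (rule ext)
    unfolding psign_apply 1[OF assms(2,3,4,5,7,8,10-13)] 1[OF assms(3,2,5,4,8,7,11,10,13,12)]
      insertion_insertion[OF assms(1,7,8,10-13)]
    by (cases "even p"; cases "even q") (simp_all add: algebra_simps)
qed

section \<open>Sums over shuffle permutations\<close>

text \<open>The sum runs over all splittings of the list into complementary subsequences
  \<open>S\<close> and \<open>T\<close> of any lengths. The sign is that of bringing
  \<open>S\<close> to the front: an element sent to \<open>T\<close> is passed by all later elements
  of \<open>S\<close>. Constant degree 1 yields the signs of shuffles, degrees of cochains yield the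
  Koszul signs of the higher Jacobi identities.\<close>

fun koszul_sum :: "('a \<Rightarrow> int) \<Rightarrow> ('a list \<Rightarrow> 'a list \<Rightarrow> 'c::ab_group_add) \<Rightarrow> 'a list \<Rightarrow> 'c" where
  "koszul_sum d H [] = H [] []"
| "koszul_sum d H (x # xs) = koszul_sum d (\<lambda>S T. H (x # S) T) xs
     + koszul_sum d (\<lambda>S T. psign (d x * sum_list (map d S)) (H S (x # T))) xs"

lemma koszul_sum_cong:
  "(\<And>S T. xs \<in> shuffles S T \<Longrightarrow> H S T = H' S T) \<Longrightarrow> koszul_sum d H xs = koszul_sum d H' xs"
proof (induction xs arbitrary: H H')
  case (Cons x xs)
  have "koszul_sum d (\<lambda>S T. H (x # S) T) xs = koszul_sum d (\<lambda>S T. H' (x # S) T) xs"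
    using Cons.prems by (intro Cons.IH) (simp add: Cons_in_shuffles_leftI)
  moreover have "koszul_sum d (\<lambda>S T. psign (d x * sum_list (map d S)) (H S (x # T))) xs =
      koszul_sum d (\<lambda>S T. psign (d x * sum_list (map d S)) (H' S (x # T))) xs"
    using Cons.prems by (intro Cons.IH) (simp add: Cons_in_shuffles_rightI)
  ultimately show ?case by simp
qed simp

lemma koszul_sum_zero: "koszul_sum d (\<lambda>S T. 0) xs = 0"
  by (induction xs) simp_all

lemma koszul_sum_add: "koszul_sum d (\<lambda>S T. H S T + H' S T) xs = koszul_sum d H xs + koszul_sum d H' xs"
  by (induction xs arbitrary: H H') (simp_all add: psign_add algebra_simps)

lemma koszul_sum_map:
  assumes "\<And>x y. \<phi> (x + y) = \<phi> x + \<phi> y"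
  shows "\<phi> (koszul_sum d H xs) = koszul_sum d (\<lambda>S T. \<phi> (H S T)) xs"
proof -
  have z: "\<phi> 0 = 0" using assms[of 0 0] by simp
  have m: "\<phi> (- x) = - \<phi> x" for x
    using assms[of x "- x"] z by (simp add: eq_neg_iff_add_eq_0 add.commute)
  have "\<phi> (psign n x) = psign n (\<phi> x)" for n x by (simp add: psign_def m)
  then show ?thesis
    by (induction xs arbitrary: H) (simp_all add: assms)
qed

lemma koszul_sum_psign: "psign n (koszul_sum d H xs) = koszul_sum d (\<lambda>S T. psign n (H S T)) xs"
  by (rule koszul_sum_map) (rule psign_add)

text \<open>Exchanging the two subsequences moves one of them as a whole past the other.\<close>

lemma koszul_sum_swap:
  "koszul_sum d H xs = koszul_sum d (\<lambda>S T. psign (sum_list (map d S) * sum_list (map d T)) (H T S)) xs"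
proof (induction xs arbitrary: H)
  case (Cons x xs)
  show ?case
    by (simp add: Cons.IH[of "\<lambda>S T. H (x # S) T"]
        Cons.IH[of "\<lambda>S T. psign (d x * sum_list (map d S)) (H S (x # T))"] algebra_simps)
      (simp add: psign_def)
qed simp

lemma koszul_sum_length_0: "koszul_sum d (\<lambda>S T. if length S = 0 then H S T else 0) xs = H [] xs"
proof (induction xs arbitrary: H)
  case (Cons x xs)
  have "koszul_sum d (\<lambda>S T. psign (d x * sum_list (map d S)) (if length S = 0 then H S (x # T) else 0)) xs =
      koszul_sum d (\<lambda>S T. if length S = 0 then H S (x # T) else 0) xs"
    by (rule koszul_sum_cong) simp
  then show ?case by (simp add: Cons.IH[of "\<lambda>S T. H S (x # T)", simplified] koszul_sum_zero)
qed simp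

lemma koszul_sum_length_all:
  "koszul_sum d (\<lambda>S T. if length S = length xs then H S T else 0) xs = H xs []"
proof (induction xs arbitrary: H)
  case (Cons x xs)
  have "koszul_sum d (\<lambda>S T. psign (d x * sum_list (map d S)) (if length S = length (x # xs) then H S (x # T) else 0)) xs =
      koszul_sum d (\<lambda>S T. 0) xs"
    by (rule koszul_sum_cong) (auto dest: length_shuffles)
  then show ?case by (simp add: Cons.IH[of "\<lambda>S T. H (x # S) T"] koszul_sum_zero)
qed simp

section \<open>Koszul signs and the recursive description of shuffles\<close>

definition inversions :: "nat \<Rightarrow> (nat \<Rightarrow> nat) \<Rightarrow> (nat \<times> nat) set" where
  "inversions n \<sigma> = {(i, j). 1 \<le> i \<and> i < j \<and> j \<le> n \<and> \<sigma> j < \<sigma> i}"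

text \<open>The exponent of \<open>koszul_sign\<close>, in the form in which \<open>psign\<close>
  takes it.\<close>

definition inversion_sum :: "int list \<Rightarrow> (nat \<Rightarrow> nat) \<Rightarrow> int" where
  "inversion_sum ds \<sigma> = (\<Sum>(i, j)\<in>inversions (length ds) \<sigma>. ds ! (\<sigma> i - 1) * ds ! (\<sigma> j - 1))"

lemma finite_inversions [simp]: "finite (inversions n \<sigma>)"
  by (rule finite_subset[of _ "{1..n} \<times> {1..n}"]) (auto simp: inversions_def)

lemma koszul_sign_inversion_sum: "koszul_sign ds \<sigma> = (if even (inversion_sum ds \<sigma>) then 1 else - 1)"
proof -
  have "(\<Prod>(i, j)\<in>A. if odd (f i j) then -1 else 1 :: int) =
      (if even (\<Sum>(i, j)\<in>A. f i j) then 1 else - 1)" if "finite A"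
    for A :: "(nat \<times> nat) set" and f :: "nat \<Rightarrow> nat \<Rightarrow> int"
    using that by induction (auto split: if_splits)
  from this[OF finite_inversions, of "\<lambda>i j. ds ! (\<sigma> i - 1) * ds ! (\<sigma> j - 1)"] show ?thesis
    by (simp only: koszul_sign_def inversion_sum_def inversions_def)
qed

lemma (in module) scale_koszul_sign: "scale (of_int (koszul_sign ds \<sigma>)) x = psign (inversion_sum ds \<sigma>) x"
  by (simp add: koszul_sign_inversion_sum)

text \<open>
  A shuffle \<open>\<sigma>\<close> of \<open>{1..Suc n}\<close> has \<open>1\<close> as its value at \<open>1\<close> or at \<open>Suc a\<close>, the first place of the
  second block.  It is then \<open>lift_perm \<tau>\<close>, respectively \<open>lift_perm \<tau> \<circ> front_cycle a\<close>,
  for a shuffle \<open>\<tau>\<close> of \<open>{1..n}\<close>.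
\<close>

definition lift_perm :: "(nat \<Rightarrow> nat) \<Rightarrow> nat \<Rightarrow> nat" where
  "lift_perm \<sigma> i = (if i \<le> 1 then i else Suc (\<sigma> (i - 1)))"

definition front_cycle :: "nat \<Rightarrow> nat \<Rightarrow> nat" where
  "front_cycle a i = (if i = Suc a then 1 else if 1 \<le> i \<and> i \<le> a then Suc i else i)"

lemma lift_perm_Suc: "1 \<le> i \<Longrightarrow> lift_perm \<sigma> (Suc i) = Suc (\<sigma> i)"
  by (simp add: lift_perm_def)

lemma lift_perm_1 [simp]: "lift_perm \<sigma> (Suc 0) = Suc 0"
  by (simp add: lift_perm_def)

text \<open>Read as a conjugate by \<open>Suc\<close>, the lifted permutation inherits
  \<open>permutes\<close> and \<open>sign\<close> from general facts on
  \<open>map_permutation\<close>.\<close>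

lemma lift_perm_map_permutation:
  assumes "\<sigma> permutes {1..n}"
  shows "lift_perm \<sigma> = map_permutation {1..n} Suc \<sigma>"
proof
  fix i
  have p: "map_permutation {1..n} Suc \<sigma> permutes Suc ` {1..n}"
    using assms by (intro map_permutation_permutes) (auto simp: bij_betw_def)
  show "lift_perm \<sigma> i = map_permutation {1..n} Suc \<sigma> i"
  proof (cases "i \<in> Suc ` {1..n}")
    case True
    then obtain j where j: "i = Suc j" "j \<in> {1..n}" by blast
    then show ?thesis by (simp add: map_permutation_apply lift_perm_def)
  next
    case False
    then have "i \<le> 1 \<or> i > Suc n" by (cases i) (auto simp: image_iff)
    moreover have "lift_perm \<sigma> i = i" if i: "i > Suc n"
    proof -
      have "\<sigma> (i - 1) = i - 1" using i by (intro permutes_not_in[OF assms]) auto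
      then show ?thesis using i by (simp add: lift_perm_def)
    qed
    ultimately show ?thesis using False permutes_not_in[OF p] by (auto simp: lift_perm_def)
  qed
qed

lemma permutes_lift_perm: "\<sigma> permutes {1..n} \<Longrightarrow> lift_perm \<sigma> permutes {1..Suc n}"
proof -
  assume p: "\<sigma> permutes {1..n}"
  have "map_permutation {1..n} Suc \<sigma> permutes Suc ` {1..n}"
    using p by (intro map_permutation_permutes) (auto simp: bij_betw_def)
  then show ?thesis
    unfolding lift_perm_map_permutation[OF p] by (rule permutes_subset) auto
qed

lemma sign_lift_perm: "\<sigma> permutes {1..n} \<Longrightarrow> sign (lift_perm \<sigma>) = sign \<sigma>"
  by (simp add: lift_perm_map_permutation sign_map_permutation)

lemma lift_perm_exists:
  assumes t: "\<tau> permutes {1..Suc n}" and 1: "\<tau> 1 = 1"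
  obtains \<sigma> where "\<sigma> permutes {1..n}" "\<tau> = lift_perm \<sigma>"
proof -
  define \<sigma> where "\<sigma> i = (if i \<in> {1..n} then \<tau> (Suc i) - 1 else i)" for i
  have ge: "\<tau> (Suc i) \<in> {2..Suc n}" if "i \<in> {1..n}" for i
  proof -
    have "\<tau> (Suc i) \<in> {1..Suc n}" using that permutes_in_image[OF t, of "Suc i"] by simp
    moreover have "\<tau> (Suc i) \<noteq> \<tau> 1" using permutes_inj[OF t] that by (auto dest: injD)
    ultimately show ?thesis using 1 by auto
  qed
  have "bij_betw \<sigma> {1..n} {1..n}"
  proof -
    have "inj_on \<sigma> {1..n}"
    proof (rule inj_onI)
      fix i j assume ij: "i \<in> {1..n}" "j \<in> {1..n}" "\<sigma> i = \<sigma> j"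
      then have "\<tau> (Suc i) - 1 = \<tau> (Suc j) - 1" by (simp add: \<sigma>_def)
      moreover have "\<tau> (Suc i) \<ge> 1" "\<tau> (Suc j) \<ge> 1" using ge[OF ij(1)] ge[OF ij(2)] by auto
      ultimately have "\<tau> (Suc i) = \<tau> (Suc j)" by linarith
      then show "i = j" using permutes_inj[OF t] by (auto dest: injD)
    qed
    moreover have "\<sigma> ` {1..n} \<subseteq> {1..n}"
    proof
      fix k assume "k \<in> \<sigma> ` {1..n}"
      then obtain i where i: "i \<in> {1..n}" "k = \<sigma> i" by blast
      then show "k \<in> {1..n}" using ge[OF i(1)] by (simp add: \<sigma>_def) arith
    qed
    ultimately show ?thesis by (simp add: bij_betw_def endo_inj_surj)
  qed
  then have "\<sigma> permutes {1..n}" by (rule bij_imp_permutes) (auto simp: \<sigma>_def)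
  moreover have "\<tau> = lift_perm \<sigma>"
  proof
    fix i
    consider "i = 0" | "i = 1" | j where "i = Suc j" "j \<in> {1..n}" | "i > Suc n"
      by (metis Suc_eq_plus1 add_0 atLeastAtMost_iff le_add2 less_one linorder_not_le not0_implies_Suc not_less_eq_eq)
    then show "\<tau> i = lift_perm \<sigma> i"
    proof cases
      case (3 j)
      then show ?thesis using ge[of j] by (auto simp: lift_perm_def \<sigma>_def)
    qed (use 1 permutes_not_in[OF t] in \<open>auto simp: lift_perm_def \<sigma>_def\<close>)
  qed
  ultimately show ?thesis using that by blast
qed

text \<open>This factorization into adjacent transpositions gives the sign (-1)^a by
  induction.\<close>

lemma front_cycle_Suc: "front_cycle (Suc a) = front_cycle a \<circ> transpose (Suc a) (Suc (Suc a))"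
  by (auto simp: fun_eq_iff front_cycle_def transpose_def)

lemma permutes_front_cycle: "a < n \<Longrightarrow> front_cycle a permutes {1..n}"
proof (induction a)
  case 0
  have "front_cycle 0 = id" by (auto simp: fun_eq_iff front_cycle_def)
  then show ?case by (simp only: permutes_id)
next
  case (Suc a)
  then show ?case unfolding front_cycle_Suc by (intro permutes_compose permutes_swap_id) auto
qed

lemma sign_front_cycle: "sign (front_cycle a) = (-1) ^ a"
proof (induction a)
  case 0
  have "front_cycle 0 = id" by (auto simp: fun_eq_iff front_cycle_def)
  then show ?case by simp
next
  case (Suc a)
  have "permutation (front_cycle a)"
    using permutes_front_cycle[of a "Suc a"] by (auto simp: permutation_permutes)
  then show ?case
    unfolding front_cycle_Suc by (subst sign_compose) (simp_all add: permutation_swap_id sign_swap_id Suc)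
qed

lemma shuffle_permsD:
  assumes "\<sigma> \<in> shuffle_perms a b"
  shows "\<sigma> permutes {1..a+b}" "strict_mono_on {1..a} \<sigma>" "strict_mono_on {a+1..a+b} \<sigma>"
  using assms by (auto simp: shuffle_perms_def)

lemma lift_perm_in_shuffle_perms: "\<sigma> \<in> shuffle_perms a b \<Longrightarrow> lift_perm \<sigma> \<in> shuffle_perms (Suc a) b"
proof -
  assume "\<sigma> \<in> shuffle_perms a b"
  note s = shuffle_permsD[OF this]
  have pos: "\<sigma> i \<ge> 1" if "1 \<le> i" "i \<le> a + b" for i
    using permutes_in_image[OF s(1), of i] that by auto
  have 1: "strict_mono_on {1..Suc a} (lift_perm \<sigma>)"
  proof (rule strict_mono_onI)
    fix i j assume ij: "i \<in> {1..Suc a}" "j \<in> {1..Suc a}" "i < j"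
    then obtain j' where j: "j = Suc j'" "1 \<le> j'" "j' \<le> a" by (cases j) auto
    show "lift_perm \<sigma> i < lift_perm \<sigma> j"
    proof (cases "i = 1")
      case True
      then show ?thesis using j pos[of j'] by (simp add: lift_perm_def)
    next
      case False
      then obtain i' where i: "i = Suc i'" "1 \<le> i'" using ij by (cases i) auto
      then show ?thesis using strict_mono_onD[OF s(2), of i' j'] ij j by (simp add: lift_perm_Suc)
    qed
  qed
  have 2: "strict_mono_on {Suc a + 1..Suc a + b} (lift_perm \<sigma>)"
  proof (rule strict_mono_onI)
    fix i j assume ij: "i \<in> {Suc a + 1..Suc a + b}" "j \<in> {Suc a + 1..Suc a + b}" "i < j"
    then obtain i' j' where "i = Suc i'" "j = Suc j'" by (cases i; cases j) auto
    then show "lift_perm \<sigma> i < lift_perm \<sigma> j" using ij strict_mono_onD[OF s(3), of i' j'] by (simp add: lift_perm_Suc)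
  qed
  show ?thesis using permutes_lift_perm[OF s(1)] 1 2 by (simp add: shuffle_perms_def)
qed

lemma lift_perm_front_cycle_le: "1 \<le> i \<Longrightarrow> i \<le> a \<Longrightarrow> (lift_perm \<sigma> \<circ> front_cycle a) i = Suc (\<sigma> i)"
  and lift_perm_front_cycle_mid: "(lift_perm \<sigma> \<circ> front_cycle a) (Suc a) = 1"
  and lift_perm_front_cycle_gt: "a < i \<Longrightarrow> (lift_perm \<sigma> \<circ> front_cycle a) (Suc i) = Suc (\<sigma> i)"
  by (simp_all add: front_cycle_def lift_perm_def)

lemma lift_perm_front_cycle_in_shuffle_perms:
  "\<sigma> \<in> shuffle_perms a b \<Longrightarrow> lift_perm \<sigma> \<circ> front_cycle a \<in> shuffle_perms a (Suc b)"
proof -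
  assume "\<sigma> \<in> shuffle_perms a b"
  note s = shuffle_permsD[OF this]
  have pos: "\<sigma> i \<ge> 1" if "1 \<le> i" "i \<le> a + b" for i
    using permutes_in_image[OF s(1), of i] that by auto
  have "front_cycle a permutes {1..Suc (a + b)}" by (rule permutes_front_cycle) simp
  from permutes_compose[OF this permutes_lift_perm[OF s(1)]]
  have p: "lift_perm \<sigma> \<circ> front_cycle a permutes {1..a + Suc b}" by simp
  have 1: "strict_mono_on {1..a} (lift_perm \<sigma> \<circ> front_cycle a)"
  proof (rule strict_mono_onI)
    fix i j assume ij: "i \<in> {1..a}" "j \<in> {1..a}" "i < j"
    have "\<sigma> i < \<sigma> j" using strict_mono_onD[OF s(2) ij] .
    then show "(lift_perm \<sigma> \<circ> front_cycle a) i < (lift_perm \<sigma> \<circ> front_cycle a) j"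
      using ij by (simp add: lift_perm_front_cycle_le del: comp_apply)
  qed
  have 2: "strict_mono_on {a + 1..a + Suc b} (lift_perm \<sigma> \<circ> front_cycle a)"
  proof (rule strict_mono_onI)
    fix i j assume ij: "i \<in> {a + 1..a + Suc b}" "j \<in> {a + 1..a + Suc b}" "i < j"
    then obtain j' where j: "j = Suc j'" "a < j'" "j' \<le> a + b" by (cases j) auto
    show "(lift_perm \<sigma> \<circ> front_cycle a) i < (lift_perm \<sigma> \<circ> front_cycle a) j"
    proof (cases "i = Suc a")
      case True
      then show ?thesis using j pos[of j'] by (simp only: lift_perm_front_cycle_mid lift_perm_front_cycle_gt) simp
    next
      case False
      then obtain i' where i: "i = Suc i'" "a < i'" using ij by (cases i) auto
      then have "\<sigma> i' < \<sigma> j'" using strict_mono_onD[OF s(3), of i' j'] ij j by simp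
      then show ?thesis using i j by (simp only: lift_perm_front_cycle_gt)
    qed
  qed
  show ?thesis using p 1 2 by (simp add: shuffle_perms_def)
qed

lemma lift_perm_inj: "lift_perm \<sigma> = lift_perm \<tau> \<Longrightarrow> \<sigma> permutes {1..n} \<Longrightarrow> \<tau> permutes {1..m} \<Longrightarrow> \<sigma> = \<tau>"
proof
  fix i assume e: "lift_perm \<sigma> = lift_perm \<tau>" and p: "\<sigma> permutes {1..n}" "\<tau> permutes {1..m}"
  show "\<sigma> i = \<tau> i"
  proof (cases "i = 0")
    case True
    then show ?thesis using permutes_not_in[OF p(1), of 0] permutes_not_in[OF p(2), of 0] by simp
  next
    case False
    then have "lift_perm \<sigma> (Suc i) = Suc (\<sigma> i)" "lift_perm \<tau> (Suc i) = Suc (\<tau> i)" by (simp_all add: lift_perm_Suc)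
    then show ?thesis using e by simp
  qed
qed

text \<open>Both blocks are non-empty here, so that the value 1 may start either; for an empty block
  only the identity is left.\<close>

lemma shuffle_perms_Suc:
  "shuffle_perms (Suc a) (Suc b) =
     lift_perm ` shuffle_perms a (Suc b) \<union> (\<lambda>\<sigma>. lift_perm \<sigma> \<circ> front_cycle (Suc a)) ` shuffle_perms (Suc a) b"
    (is "?L = ?R1 \<union> ?R2")
proof
  show "?R1 \<union> ?R2 \<subseteq> ?L"
    using lift_perm_in_shuffle_perms lift_perm_front_cycle_in_shuffle_perms by blast
  show "?L \<subseteq> ?R1 \<union> ?R2"
  proof
    fix \<tau> assume "\<tau> \<in> ?L"
    note t = shuffle_permsD[OF this]
    let ?n = "a + Suc b"
    have tp: "\<tau> permutes {1..Suc ?n}" using t(1) by simp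
    obtain k where k: "\<tau> k = 1" "k \<in> {1..Suc ?n}"
      using permutes_image[OF tp] by (metis (no_types, lifting) One_nat_def Suc_le_mono atLeastAtMost_iff image_iff le0 order_refl)
    have pos: "\<tau> i \<ge> 1" if "i \<in> {1..Suc ?n}" for i
      using permutes_in_image[OF tp, of i] that by auto
    \<comment> \<open>An increasing block takes its least value at its first place.\<close>
    have "k = 1 \<or> k = Suc (Suc a)"
    proof (rule ccontr)
      assume n: "\<not> ?thesis"
      have "\<tau> (k - 1) < \<tau> k"
      proof (cases "k \<le> Suc a")
        case True
        then show ?thesis using n k by (intro strict_mono_onD[OF t(2)]) auto
      next
        case False
        then show ?thesis using n k by (intro strict_mono_onD[OF t(3)]) auto
      qed
      moreover have "\<tau> (k - 1) \<ge> 1" using n k by (intro pos) auto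
      ultimately show False using k by simp
    qed
    then show "\<tau> \<in> ?R1 \<union> ?R2"
    proof
      assume "k = 1"
      then obtain \<sigma> where s: "\<sigma> permutes {1..?n}" "\<tau> = lift_perm \<sigma>"
        using lift_perm_exists[OF tp] k by blast
      have u: "lift_perm \<sigma> (Suc i) = Suc (\<sigma> i)" if "1 \<le> i" for i using that by (rule lift_perm_Suc)
      have "strict_mono_on {1..a} \<sigma>"
      proof (rule strict_mono_onI)
        fix i j assume "i \<in> {1..a}" "j \<in> {1..a}" "i < j"
        then show "\<sigma> i < \<sigma> j" using strict_mono_onD[OF t(2), of "Suc i" "Suc j"] by (simp add: s u)
      qed
      moreover have "strict_mono_on {a+1..a + Suc b} \<sigma>"
      proof (rule strict_mono_onI)
        fix i j assume "i \<in> {a+1..a + Suc b}" "j \<in> {a+1..a + Suc b}" "i < j"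
        then show "\<sigma> i < \<sigma> j" using strict_mono_onD[OF t(3), of "Suc i" "Suc j"] by (simp add: s u)
      qed
      ultimately have "\<sigma> \<in> shuffle_perms a (Suc b)" using s by (simp add: shuffle_perms_def)
      then show ?thesis using s by blast
    next
      assume k2: "k = Suc (Suc a)"
      let ?c = "front_cycle (Suc a)"
      have c: "?c permutes {1..Suc ?n}" by (rule permutes_front_cycle) simp
      have ci: "inv ?c 1 = Suc (Suc a)" using permutes_inverses(2)[OF c, of "Suc (Suc a)"]
        by (simp add: front_cycle_def)
      have "\<tau> \<circ> inv ?c permutes {1..Suc ?n}" by (intro permutes_compose permutes_inv c tp)
      moreover have "(\<tau> \<circ> inv ?c) 1 = 1" using ci k k2 by simp
      ultimately obtain \<sigma> where s: "\<sigma> permutes {1..?n}" "\<tau> \<circ> inv ?c = lift_perm \<sigma>"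
        using lift_perm_exists by blast
      then have e: "\<tau> = lift_perm \<sigma> \<circ> ?c"
        by (metis comp_assoc comp_id permutes_inv_o(2) c)
      have "strict_mono_on {1..Suc a} \<sigma>"
      proof (rule strict_mono_onI)
        fix i j assume ij: "i \<in> {1..Suc a}" "j \<in> {1..Suc a}" "i < j"
        then show "\<sigma> i < \<sigma> j" using strict_mono_onD[OF t(2), of i j]
          unfolding e by (simp only: lift_perm_front_cycle_le atLeastAtMost_iff) simp
      qed
      moreover have "strict_mono_on {Suc a+1..Suc a + b} \<sigma>"
      proof (rule strict_mono_onI)
        fix i j assume ij: "i \<in> {Suc a+1..Suc a + b}" "j \<in> {Suc a+1..Suc a + b}" "i < j"
        then have "Suc a < i" "Suc a < j" by auto
        then show "\<sigma> i < \<sigma> j" using ij strict_mono_onD[OF t(3), of "Suc i" "Suc j"]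
          unfolding e by (simp only: lift_perm_front_cycle_gt) simp
      qed
      ultimately have "\<sigma> \<in> shuffle_perms (Suc a) b" using s by (simp add: shuffle_perms_def)
      then show ?thesis using e by blast
    qed
  qed
qed

lemma finite_shuffle_perms [simp]: "finite (shuffle_perms a b)"
  by (rule finite_subset[OF _ finite_permutations[of "{1..a+b}"]]) (auto simp: shuffle_perms_def)

lemma sum_shuffle_perms_Suc:
  "(\<Sum>\<sigma>\<in>shuffle_perms (Suc a) (Suc b). f \<sigma>) =
     (\<Sum>\<sigma>\<in>shuffle_perms a (Suc b). f (lift_perm \<sigma>)) + (\<Sum>\<sigma>\<in>shuffle_perms (Suc a) b. f (lift_perm \<sigma> \<circ> front_cycle (Suc a)))"
proof -
  let ?c = "front_cycle (Suc a)"
  have c: "?c permutes {1..Suc (Suc a)}" by (rule permutes_front_cycle) simp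
  \<comment> \<open>The value at place 1 separates the two images: it is 1 on the first and at least
    2 on the second.\<close>
  have "lift_perm \<sigma> 1 \<noteq> (lift_perm \<tau> \<circ> ?c) 1" if "\<tau> \<in> shuffle_perms (Suc a) b" for \<sigma> \<tau>
    using permutes_in_image[OF shuffle_permsD(1)[OF that], of 1] by (simp add: front_cycle_def lift_perm_Suc)
  then have d: "lift_perm ` shuffle_perms a (Suc b) \<inter> (\<lambda>\<sigma>. lift_perm \<sigma> \<circ> ?c) ` shuffle_perms (Suc a) b = {}"
    by (metis (no_types, lifting) One_nat_def disjoint_iff image_iff lift_perm_1)
  have i1: "inj_on lift_perm (shuffle_perms a (Suc b))"
    by (rule inj_onI) (metis lift_perm_inj shuffle_permsD(1))
  have "inj_on (\<lambda>\<sigma>. lift_perm \<sigma> \<circ> ?c) (shuffle_perms (Suc a) b)"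
  proof (rule inj_onI)
    fix \<sigma> \<tau> assume a: "\<sigma> \<in> shuffle_perms (Suc a) b" "\<tau> \<in> shuffle_perms (Suc a) b"
      "lift_perm \<sigma> \<circ> ?c = lift_perm \<tau> \<circ> ?c"
    then have "lift_perm \<sigma> = lift_perm \<tau>" by (metis comp_assoc comp_id permutes_inv_o(1) c)
    then show "\<sigma> = \<tau>" using lift_perm_inj shuffle_permsD(1) a by blast
  qed
  then show ?thesis using i1 d
    by (simp add: shuffle_perms_Suc sum.union_disjoint sum.reindex)
qed

lemma inversion_sum_lift_perm:
  assumes "\<sigma> permutes {1..length ds}"
  shows "inversion_sum (d # ds) (lift_perm \<sigma>) = inversion_sum ds \<sigma>"
proof -
  have pos: "\<sigma> i \<ge> 1" if "1 \<le> i" "i \<le> length ds" for i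
    using permutes_in_image[OF assms, of i] that by auto
  have "inversions (Suc (length ds)) (lift_perm \<sigma>) = map_prod Suc Suc ` inversions (length ds) \<sigma>"
  proof (intro set_eqI iffI)
    fix z assume "z \<in> inversions (Suc (length ds)) (lift_perm \<sigma>)"
    then obtain i j where z: "z = (i, j)" and ij: "1 \<le> i" "i < j" "j \<le> Suc (length ds)" "lift_perm \<sigma> j < lift_perm \<sigma> i"
      by (auto simp: inversions_def)
    then obtain j' where j: "j = Suc j'" "1 \<le> j'" by (cases j) auto
    have "i \<noteq> 1" using ij j pos[of j'] by (auto simp: lift_perm_Suc)
    then obtain i' where i: "i = Suc i'" "1 \<le> i'" using ij by (cases i) auto
    show "z \<in> map_prod Suc Suc ` inversions (length ds) \<sigma>"
      using ij i j by (auto simp: z inversions_def lift_perm_Suc intro!: image_eqI[of _ _ "(i', j')"])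
  qed (auto simp: inversions_def lift_perm_Suc)
  then show ?thesis
    unfolding inversion_sum_def length_Cons
  proof (simp only:, subst sum.reindex)
    show "(\<Sum>z\<in>inversions (length ds) \<sigma>. ((\<lambda>(i, j). (d # ds) ! (lift_perm \<sigma> i - 1) * (d # ds) ! (lift_perm \<sigma> j - 1)) \<circ> map_prod Suc Suc) z) =
      (\<Sum>(i, j)\<in>inversions (length ds) \<sigma>. ds ! (\<sigma> i - 1) * ds ! (\<sigma> j - 1))"
    proof (rule sum.cong[OF refl])
      fix z assume "z \<in> inversions (length ds) \<sigma>"
      then obtain i j where z: "z = (i, j)" "1 \<le> i" "1 \<le> j" "i \<le> length ds" "j \<le> length ds"
        by (auto simp: inversions_def)
      then show "((\<lambda>(i, j). (d # ds) ! (lift_perm \<sigma> i - 1) * (d # ds) ! (lift_perm \<sigma> j - 1)) \<circ> map_prod Suc Suc) z =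
          (case z of (i, j) \<Rightarrow> ds ! (\<sigma> i - 1) * ds ! (\<sigma> j - 1))"
        using pos[of i] pos[of j] by (simp add: lift_perm_Suc nth_Cons')
    qed
  qed (auto simp: inj_on_def)
qed

text \<open>The value 1 now stands at place \<open>Suc a\<close>, and each of the \<open>a\<close>
  places before it forms an inversion with it; these contribute the multiple of \<open>d\<close>.
  All other inversions are those of \<sigma>, renumbered.\<close>

lemma inversion_sum_lift_perm_front_cycle:
  assumes "\<sigma> permutes {1..length ds}" and a: "a \<le> length ds"
  shows "inversion_sum (d # ds) (lift_perm \<sigma> \<circ> front_cycle a) = d * (\<Sum>i\<in>{1..a}. ds ! (\<sigma> i - 1)) + inversion_sum ds \<sigma>"
proof -
  let ?n = "length ds" and ?t = "lift_perm \<sigma> \<circ> front_cycle a"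
  \<comment> \<open>The increasing enumeration of all places other than
    \<open>Suc a\<close>.\<close>
  define e where "e i = (if i \<le> a then i else Suc i)" for i
  have pos: "\<sigma> i \<ge> 1" if "1 \<le> i" "i \<le> length ds" for i
    using permutes_in_image[OF assms(1), of i] that by auto
  have te: "?t (e i) = Suc (\<sigma> i)" if "1 \<le> i" for i
    using that lift_perm_front_cycle_le[of i a \<sigma>] lift_perm_front_cycle_gt[of a i \<sigma>] by (auto simp: e_def)
  have e_ex: "\<exists>i'. i = e i' \<and> 1 \<le> i' \<and> i' \<le> ?n" if "1 \<le> i" "i \<le> Suc ?n" "i \<noteq> Suc a" for i
    using that a by (intro exI[of _ "if i \<le> a then i else i - 1"]) (auto simp: e_def)
  have e_less: "e i < e j \<longleftrightarrow> i < j" for i j by (auto simp: e_def)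
  have e_bd: "1 \<le> i \<Longrightarrow> 1 \<le> e i" "i \<le> ?n \<Longrightarrow> e i \<le> Suc ?n" "e i \<noteq> Suc a" for i by (auto simp: e_def)
  have "inversions (Suc ?n) ?t = (\<lambda>i. (i, Suc a)) ` {1..a} \<union> map_prod e e ` inversions ?n \<sigma>"
  proof (intro set_eqI iffI)
    fix z assume "z \<in> inversions (Suc ?n) ?t"
    then obtain i j where z: "z = (i, j)" and ij: "1 \<le> i" "i < j" "j \<le> Suc ?n" "?t j < ?t i"
      by (auto simp: inversions_def)
    have "i \<noteq> Suc a"
    proof
      assume i: "i = Suc a"
      then obtain j' where "j = e j'" "1 \<le> j'" "j' \<le> ?n" using e_ex[of j] ij by auto
      then show False using ij te[of j'] unfolding i lift_perm_front_cycle_mid by simp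
    qed
    then obtain i' where i: "i = e i'" "1 \<le> i'" "i' \<le> ?n" using e_ex[of i] ij by auto
    show "z \<in> (\<lambda>i. (i, Suc a)) ` {1..a} \<union> map_prod e e ` inversions ?n \<sigma>"
    proof (cases "j = Suc a")
      case True
      then show ?thesis using z ij by auto
    next
      case False
      then obtain j' where j: "j = e j'" "1 \<le> j'" "j' \<le> ?n" using e_ex[of j] ij by auto
      have "(i', j') \<in> inversions ?n \<sigma>"
        using ij i j te[of i'] te[of j'] e_less[of i' j'] by (simp add: inversions_def del: comp_apply)
      then show ?thesis using z i j by force
    qed
  next
    fix z assume "z \<in> (\<lambda>i. (i, Suc a)) ` {1..a} \<union> map_prod e e ` inversions ?n \<sigma>"
    then show "z \<in> inversions (Suc ?n) ?t"
    proof
      assume "z \<in> (\<lambda>i. (i, Suc a)) ` {1..a}"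
      then obtain i where i: "z = (i, Suc a)" "1 \<le> i" "i \<le> a" by auto
      then show ?thesis using a pos[of i] lift_perm_front_cycle_le[of i a \<sigma>] lift_perm_front_cycle_mid[of \<sigma> a]
        by (auto simp: inversions_def simp del: comp_apply)
    next
      assume "z \<in> map_prod e e ` inversions ?n \<sigma>"
      then obtain i j where "z = (e i, e j)" "1 \<le> i" "i < j" "j \<le> ?n" "\<sigma> j < \<sigma> i"
        by (auto simp: inversions_def)
      then show ?thesis using te[of i] te[of j] e_less[of i j] e_bd[of i] e_bd[of j]
        by (simp add: inversions_def del: comp_apply)
    qed
  qed
  moreover have "(\<lambda>i. (i, Suc a)) ` {1..a} \<inter> map_prod e e ` inversions ?n \<sigma> = {}"
    using e_bd(3) by fastforce
  moreover have inj: "inj_on (\<lambda>i. (i, Suc a)) {1..a}" "inj_on (map_prod e e) (inversions ?n \<sigma>)"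
    using e_less by (auto simp: inj_on_def) (metis nat_neq_iff)+
  ultimately have "inversion_sum (d # ds) ?t =
      (\<Sum>i\<in>{1..a}. (d # ds) ! (?t i - 1) * (d # ds) ! (?t (Suc a) - 1)) +
      (\<Sum>(i, j)\<in>inversions ?n \<sigma>. (d # ds) ! (?t (e i) - 1) * (d # ds) ! (?t (e j) - 1))"
    unfolding inversion_sum_def length_Cons
    by (simp add: sum.union_disjoint sum.reindex del: comp_apply) (simp add: case_prod_unfold)
  also have "(\<Sum>i\<in>{1..a}. (d # ds) ! (?t i - 1) * (d # ds) ! (?t (Suc a) - 1)) = (\<Sum>i\<in>{1..a}. d * ds ! (\<sigma> i - 1))"
  proof (rule sum.cong[OF refl])
    fix i assume i: "i \<in> {1..a}"
    then have "\<sigma> i \<ge> 1" using a by (intro pos) auto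
    then show "(d # ds) ! (?t i - 1) * (d # ds) ! (?t (Suc a) - 1) = d * ds ! (\<sigma> i - 1)"
      using i lift_perm_front_cycle_le[of i a \<sigma>] lift_perm_front_cycle_mid[of \<sigma> a] by (simp add: nth_Cons' del: comp_apply)
  qed
  also have "(\<Sum>(i, j)\<in>inversions ?n \<sigma>. (d # ds) ! (?t (e i) - 1) * (d # ds) ! (?t (e j) - 1)) = inversion_sum ds \<sigma>"
    unfolding inversion_sum_def
  proof (intro sum.cong refl)
    fix z assume "z \<in> inversions ?n \<sigma>"
    then obtain i j where z: "z = (i, j)" "1 \<le> i" "1 \<le> j" "i \<le> ?n" "j \<le> ?n" by (auto simp: inversions_def)
    then show "(case z of (i, j) \<Rightarrow> (d # ds) ! (?t (e i) - 1) * (d # ds) ! (?t (e j) - 1)) =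
        (case z of (i, j) \<Rightarrow> ds ! (\<sigma> i - 1) * ds ! (\<sigma> j - 1))"
      using te[of i] te[of j] pos[of i] pos[of j] by (simp add: nth_Cons' del: comp_apply)
  qed
  finally show ?thesis by (simp only: sum_distrib_left)
qed

section \<open>Sums over shuffles as sums over splittings\<close>

lemma upt_Suc_map: "[Suc m..<Suc n] = map Suc [m..<n]"
  by (simp add: map_Suc_upt)

lemma perm_sublist_lift_perm:
  assumes "\<sigma> permutes {1..length xs}" "a \<le> length xs"
  shows "perm_sublist (lift_perm \<sigma>) (x # xs) 1 (Suc a) = x # perm_sublist \<sigma> xs 1 a"
    and "1 \<le> m \<Longrightarrow> perm_sublist (lift_perm \<sigma>) (x # xs) (Suc m) (Suc a) = perm_sublist \<sigma> xs m a"
proof -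
  have *: "map (\<lambda>i. (x # xs) ! (lift_perm \<sigma> i - 1)) (map Suc [m..<Suc a]) = map (\<lambda>i. xs ! (\<sigma> i - 1)) [m..<Suc a]"
    if "1 \<le> m" for m
  proof -
    have "(x # xs) ! (lift_perm \<sigma> (Suc i) - 1) = xs ! (\<sigma> i - 1)" if "i \<in> set [m..<Suc a]" for i
      using permutes_in_image[OF assms(1), of i] that \<open>1 \<le> m\<close> assms(2)
      by (auto simp: lift_perm_Suc nth_Cons')
    then show ?thesis by simp
  qed
  show "1 \<le> m \<Longrightarrow> perm_sublist (lift_perm \<sigma>) (x # xs) (Suc m) (Suc a) = perm_sublist \<sigma> xs m a"
    using *[of m] by (simp only: perm_sublist_def upt_Suc_map)
  have "[1..<Suc (Suc a)] = 1 # [Suc 1..<Suc (Suc a)]" by (rule upt_conv_Cons) simp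
  then show "perm_sublist (lift_perm \<sigma>) (x # xs) 1 (Suc a) = x # perm_sublist \<sigma> xs 1 a"
    using *[of 1] by (simp add: perm_sublist_def map_Suc_upt del: upt_Suc)
qed

lemma perm_sublist_lift_perm_front_cycle:
  assumes "\<sigma> permutes {1..length xs}" "a \<le> length xs"
  shows "perm_sublist (lift_perm \<sigma> \<circ> front_cycle a) (x # xs) 1 a = perm_sublist \<sigma> xs 1 a"
    and "b \<le> length xs \<Longrightarrow> a \<le> b \<Longrightarrow> perm_sublist (lift_perm \<sigma> \<circ> front_cycle a) (x # xs) (Suc a) (Suc b) = x # perm_sublist \<sigma> xs (Suc a) b"
proof -
  have nth: "(x # xs) ! (Suc (\<sigma> i) - 1) = xs ! (\<sigma> i - 1)" if "1 \<le> i" "i \<le> length xs" for i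
    using permutes_in_image[OF assms(1), of i] that by (auto simp: nth_Cons')
  show "perm_sublist (lift_perm \<sigma> \<circ> front_cycle a) (x # xs) 1 a = perm_sublist \<sigma> xs 1 a"
    unfolding perm_sublist_def
  proof (rule map_cong[OF refl])
    fix i assume "i \<in> set [1..<Suc a]"
    then have "1 \<le> i" "i \<le> a" by auto
    then show "(x # xs) ! ((lift_perm \<sigma> \<circ> front_cycle a) i - 1) = xs ! (\<sigma> i - 1)"
      unfolding lift_perm_front_cycle_le[OF \<open>1 \<le> i\<close> \<open>i \<le> a\<close>] using assms(2) by (intro nth) auto
  qed
  show "perm_sublist (lift_perm \<sigma> \<circ> front_cycle a) (x # xs) (Suc a) (Suc b) = x # perm_sublist \<sigma> xs (Suc a) b"
    if b: "b \<le> length xs" "a \<le> b"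
  proof -
    have l: "[Suc a..<Suc (Suc b)] = Suc a # map Suc [Suc a..<Suc b]"
      using b by (simp add: upt_conv_Cons map_Suc_upt del: upt_Suc)
    have "map (\<lambda>i. (x # xs) ! ((lift_perm \<sigma> \<circ> front_cycle a) (Suc i) - 1)) [Suc a..<Suc b] = map (\<lambda>i. xs ! (\<sigma> i - 1)) [Suc a..<Suc b]"
    proof (rule map_cong[OF refl])
      fix i assume "i \<in> set [Suc a..<Suc b]"
      then have i: "a < i" "i \<le> b" by auto
      then show "(x # xs) ! ((lift_perm \<sigma> \<circ> front_cycle a) (Suc i) - 1) = xs ! (\<sigma> i - 1)"
        unfolding lift_perm_front_cycle_gt[OF i(1)] using b by (intro nth) auto
    qed
    then show ?thesis unfolding perm_sublist_def l list.map map_map lift_perm_front_cycle_mid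
      by (simp add: comp_def del: upt_Suc)
  qed
qed

lemma inversions_id [simp]: "inversions n id = {}"
  and inversions_ident [simp]: "inversions n (\<lambda>i. i) = {}"
  by (auto simp: inversions_def)

text \<open>Splitting off the first list element corresponds to splitting off the value 1 of the
  permutation. \<open>H\<close> absorbs the element and the sign it acquires, which is why the
  induction runs over all \<open>H\<close>.\<close>

lemma sum_shuffle_perms_koszul_sum:
  "length xs = a + b \<Longrightarrow>
   (\<Sum>\<sigma>\<in>shuffle_perms a b. psign (inversion_sum (map d xs) \<sigma>)
      (H (perm_sublist \<sigma> xs 1 a) (perm_sublist \<sigma> xs (a + 1) (a + b)))) =
   koszul_sum d (\<lambda>S T. if length S = a then H S T else 0) xs"
proof (induction xs arbitrary: a b H)
  case Nil
  then show ?case by (simp add: shuffle_perms_0_left inversion_sum_def perm_sublist_def)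
next
  case (Cons x xs)
  note IH = Cons.IH and len = Cons.prems
  have w: "perm_sublist id (x # xs) 1 (length (x # xs)) = x # xs"
    using perm_sublist_id[of "length (x # xs)" "x # xs"] by simp
  have e: "perm_sublist \<sigma> (x # xs) (m + 1) m = []" for \<sigma> m by (simp add: perm_sublist_def)
  \<comment> \<open>The decomposition of shuffles needs two non-empty blocks; with an empty one the
    splitting is forced.\<close>
  consider "a = 0" | "b = 0" | a' b' where "a = Suc a'" "b = Suc b'"
    by (metis not0_implies_Suc)
  then show ?case
  proof cases
    case 1
    then have "b = length (x # xs)" using len by simp
    then show ?thesis using w[unfolded id_def] e[of _ 0] koszul_sum_length_0[of d H "x # xs"]
      by (simp add: 1 shuffle_perms_0_left inversion_sum_def del: koszul_sum.simps upt_Suc)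
  next
    case 2
    then have "a = length (x # xs)" using len by simp
    then show ?thesis using w[unfolded id_def] e[of _ "length (x # xs)"] koszul_sum_length_all[of d "x # xs" H]
      by (simp add: 2 shuffle_perms_0_right inversion_sum_def del: koszul_sum.simps upt_Suc)
  next
    case (3 a' b')
    have l1: "length xs = a' + Suc b'" and l2: "length xs = Suc a' + b'" using len 3 by auto
    let ?f = "\<lambda>\<sigma>. psign (inversion_sum (map d (x # xs)) \<sigma>)
      (H (perm_sublist \<sigma> (x # xs) 1 a) (perm_sublist \<sigma> (x # xs) (a + 1) (a + b)))"
    have s1: "?f (lift_perm \<sigma>) = psign (inversion_sum (map d xs) \<sigma>)
        ((\<lambda>S T. H (x # S) T) (perm_sublist \<sigma> xs 1 a') (perm_sublist \<sigma> xs (a' + 1) (a' + Suc b')))"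
      if "\<sigma> \<in> shuffle_perms a' (Suc b')" for \<sigma>
    proof -
      have p: "\<sigma> permutes {1..length xs}" using shuffle_permsD(1)[OF that] l1 by simp
      have "perm_sublist (lift_perm \<sigma>) (x # xs) (Suc a' + 1) (Suc a' + Suc b') = perm_sublist \<sigma> xs (a' + 1) (a' + Suc b')"
        using perm_sublist_lift_perm(2)[OF p, of "a' + Suc b'" "a' + 1" x] l1 by simp
      moreover have "perm_sublist (lift_perm \<sigma>) (x # xs) 1 (Suc a') = x # perm_sublist \<sigma> xs 1 a'"
        using perm_sublist_lift_perm(1)[OF p, of a' x] l1 by simp
      ultimately show ?thesis using p by (simp only: 3 list.map) (simp add: inversion_sum_lift_perm)
    qed
    have s2: "?f (lift_perm \<sigma> \<circ> front_cycle (Suc a')) = psign (inversion_sum (map d xs) \<sigma>)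
        ((\<lambda>S T. psign (d x * sum_list (map d S)) (H S (x # T))) (perm_sublist \<sigma> xs 1 (Suc a'))
          (perm_sublist \<sigma> xs (Suc a' + 1) (Suc a' + b')))"
      if "\<sigma> \<in> shuffle_perms (Suc a') b'" for \<sigma>
    proof -
      have p: "\<sigma> permutes {1..length xs}" using shuffle_permsD(1)[OF that] l2 by simp
      have 1: "perm_sublist (lift_perm \<sigma> \<circ> front_cycle (Suc a')) (x # xs) 1 (Suc a') = perm_sublist \<sigma> xs 1 (Suc a')"
        using l2 by (intro perm_sublist_lift_perm_front_cycle(1)[OF p]) simp
      have 2: "perm_sublist (lift_perm \<sigma> \<circ> front_cycle (Suc a')) (x # xs) (Suc a' + 1) (Suc a' + Suc b') =
          x # perm_sublist \<sigma> xs (Suc a' + 1) (Suc a' + b')"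
        using perm_sublist_lift_perm_front_cycle(2)[OF p, of "Suc a'" "Suc a' + b'" x] l2 by simp
      have "(\<Sum>i\<in>{1..Suc a'}. map d xs ! (\<sigma> i - 1)) = sum_list (map d (perm_sublist \<sigma> xs 1 (Suc a')))"
      proof -
        have "map d (perm_sublist \<sigma> xs 1 (Suc a')) = map (\<lambda>i. map d xs ! (\<sigma> i - 1)) [1..<Suc (Suc a')]"
          unfolding perm_sublist_def map_map
        proof (rule map_cong[OF refl])
          fix i assume "i \<in> set [1..<Suc (Suc a')]"
          then have i: "1 \<le> i" "i \<le> length xs" using l2 by auto
          then have "\<sigma> i \<in> {1..length xs}" using permutes_in_image[OF p, of i] by simp
          then have "\<sigma> i - 1 < length xs" by auto
          then show "(d \<circ> (\<lambda>i. xs ! (\<sigma> i - 1))) i = map d xs ! (\<sigma> i - 1)"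
            by (simp only: comp_apply nth_map)
        qed
        then show ?thesis
          by (simp add: sum_list_distinct_conv_sum_set atLeastLessThanSuc_atLeastAtMost del: upt_Suc sum.cl_ivl_Suc)
      qed
      then have "inversion_sum (map d (x # xs)) (lift_perm \<sigma> \<circ> front_cycle (Suc a')) =
          d x * sum_list (map d (perm_sublist \<sigma> xs 1 (Suc a'))) + inversion_sum (map d xs) \<sigma>"
        using inversion_sum_lift_perm_front_cycle[of \<sigma> "map d xs" "Suc a'" "d x"] p l2 by (simp del: sum.cl_ivl_Suc)
      then show ?thesis using 1 2 by (simp only: 3) (simp add: psign_def)
    qed
    have "(\<Sum>\<sigma>\<in>shuffle_perms a b. ?f \<sigma>) = (\<Sum>\<sigma>\<in>shuffle_perms a' (Suc b'). ?f (lift_perm \<sigma>))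
        + (\<Sum>\<sigma>\<in>shuffle_perms (Suc a') b'. ?f (lift_perm \<sigma> \<circ> front_cycle (Suc a')))"
      by (simp only: 3 sum_shuffle_perms_Suc)
    also have "\<dots> = koszul_sum d (\<lambda>S T. if length S = a' then H (x # S) T else 0) xs
        + koszul_sum d (\<lambda>S T. if length S = Suc a' then psign (d x * sum_list (map d S)) (H S (x # T)) else 0) xs"
      using s1 s2
      by (simp only: IH[OF l1, symmetric] IH[OF l2, symmetric] cong: sum.cong)
    also have "\<dots> = koszul_sum d (\<lambda>S T. if length S = a then H S T else 0) (x # xs)"
      by (simp add: 3 if_distrib cong: if_cong)
    finally show ?thesis .
  qed
qed

text \<open>This is the Koszul sign for elements that all have degree 1. Both signs change in the
  same way along the recursive description of shuffles.\<close>

lemma sign_shuffle_perms: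
  "\<sigma> \<in> shuffle_perms a b \<Longrightarrow> sign \<sigma> = (if even (inversion_sum (replicate (a + b) 1) \<sigma>) then 1 else - 1)"
proof (induction "a + b" arbitrary: a b \<sigma>)
  case 0
  then show ?case by (auto simp: shuffle_perms_0_left inversion_sum_def)
next
  case (Suc n)
  consider "a = 0" | "b = 0" | a' b' where "a = Suc a'" "b = Suc b'"
    by (metis not0_implies_Suc)
  then show ?case
  proof cases
    case (3 a' b')
    then consider \<tau> where "\<tau> \<in> shuffle_perms a' (Suc b')" "\<sigma> = lift_perm \<tau>"
      | \<tau> where "\<tau> \<in> shuffle_perms (Suc a') b'" "\<sigma> = lift_perm \<tau> \<circ> front_cycle (Suc a')"
      using Suc.prems by (auto simp: shuffle_perms_Suc)
    then show ?thesis
    proof cases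
      case (1 \<tau>)
      have p: "\<tau> permutes {1..n}" using shuffle_permsD(1)[OF 1(1)] Suc.hyps(2) 3 by simp
      have "sign \<tau> = (if even (inversion_sum (replicate n 1) \<tau>) then 1 else - 1)"
        using Suc.hyps(1)[of a' "Suc b'"] 1 Suc.hyps(2) 3 by simp
      then show ?thesis using inversion_sum_lift_perm[of \<tau> "replicate n 1" 1] p
        by (simp add: 1 sign_lift_perm[OF p] flip: Suc.hyps(2))
    next
      case (2 \<tau>)
      have p: "\<tau> permutes {1..n}" using shuffle_permsD(1)[OF 2(1)] Suc.hyps(2) 3 by simp
      have c: "front_cycle (Suc a') permutes {1..Suc (Suc a')}" by (rule permutes_front_cycle) simp
      have "sign \<sigma> = sign \<tau> * (- 1) ^ Suc a'"
        unfolding 2 using c permutes_lift_perm[OF p]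
        by (subst sign_compose) (auto simp: permutation_permutes sign_lift_perm[OF p] sign_front_cycle)
      moreover have "sign \<tau> = (if even (inversion_sum (replicate n 1) \<tau>) then 1 else - 1)"
        using Suc.hyps(1)[of "Suc a'" b'] 2 Suc.hyps(2) 3 by simp
      moreover have "inversion_sum (1 # replicate n 1) (lift_perm \<tau> \<circ> front_cycle (Suc a')) = int (Suc a') + inversion_sum (replicate n 1) \<tau>"
      proof -
        have "(\<Sum>i\<in>{1..Suc a'}. replicate n (1::int) ! (\<tau> i - 1)) = (\<Sum>i\<in>{1..Suc a'}. 1)"
        proof (rule sum.cong[OF refl])
          fix i assume "i \<in> {1..Suc a'}"
          then have "i \<in> {1..n}" using Suc.hyps(2) 3 by simp
          then have "\<tau> i \<in> {1..n}" using permutes_in_image[OF p, of i] by blast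
          then have "\<tau> i - 1 < n" by auto
          then show "replicate n (1::int) ! (\<tau> i - 1) = 1" by (rule nth_replicate)
        qed
        then show ?thesis
          using inversion_sum_lift_perm_front_cycle[of \<tau> "replicate n 1" "Suc a'" 1] p Suc.hyps(2) 3 by (simp del: sum.cl_ivl_Suc)
      qed
      ultimately show ?thesis
        by (simp add: 2 flip: Suc.hyps(2))
    qed
  qed (use Suc.prems in \<open>auto simp: shuffle_perms_0_left shuffle_perms_0_right inversion_sum_def\<close>)
qed

text \<open>The recursion of \<open>shuffle_comp\<close>, detached from the two functions. It
  differs from the Koszul sum of degree 1 by (-1)^(|S||T|), which is the factor (-1)^(pq) of the
  product.\<close>

fun shuffle_sum :: "('a list \<Rightarrow> 'a list \<Rightarrow> 'c::ab_group_add) \<Rightarrow> 'a list \<Rightarrow> 'c" where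
  "shuffle_sum H [] = H [] []"
| "shuffle_sum H (x # xs) = shuffle_sum (\<lambda>S T. psign (int (length T)) (H (x # S) T)) xs
     + shuffle_sum (\<lambda>S T. H S (x # T)) xs"

lemma sum_list_one: "sum_list (map (\<lambda>_. 1 :: int) S) = int (length S)"
  by (induction S) simp_all

lemma shuffle_sum_koszul_sum:
  "shuffle_sum H xs = koszul_sum (\<lambda>_. 1) (\<lambda>S T. psign (int (length S) * int (length T)) (H S T)) xs"
proof (induction xs arbitrary: H)
  case (Cons x xs)
  have "(\<lambda>S T. psign (int (length S) * int (length T)) (psign (int (length T)) (H (x # S) T))) =
      (\<lambda>S T. psign (int (length (x # S)) * int (length T)) (H (x # S) T))"
    "(\<lambda>S T. psign (int (length S) * int (length T)) (H S (x # T))) =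
      (\<lambda>S T. psign (1 * int (length S)) (psign (int (length S) * int (length (x # T))) (H S (x # T))))"
    by (simp_all add: fun_eq_iff psign_def)
  then show ?case by (simp only: shuffle_sum.simps koszul_sum.simps Cons.IH sum_list_one)
qed simp

lemma shuffle_sum_cong:
  "(\<And>S T. length S + length T = length xs \<Longrightarrow> H S T = H' S T) \<Longrightarrow> shuffle_sum H xs = shuffle_sum H' xs"
  unfolding shuffle_sum_koszul_sum by (intro koszul_sum_cong) (simp add: length_shuffles)

lemma shuffle_sum_add:
  "shuffle_sum (\<lambda>S T. H S T + H' S T) xs = shuffle_sum H xs + shuffle_sum H' xs"
  by (simp add: shuffle_sum_koszul_sum psign_add koszul_sum_add)

text \<open>The inner \<open>psign\<close> is multiplication by \<open>sign \<sigma>\<close>,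
  written without scalars.\<close>

lemma sum_shuffle_perms_sign:
  assumes "length xs = a + b"
  shows "(\<Sum>\<sigma>\<in>shuffle_perms a b. psign (int (a * b)) (psign (if sign \<sigma> = 1 then 0 else 1)
      (H (perm_sublist \<sigma> xs 1 a) (perm_sublist \<sigma> xs (a + 1) (a + b))))) =
   shuffle_sum (\<lambda>S T. if length S = a then H S T else 0) xs"
proof -
  have "(\<Sum>\<sigma>\<in>shuffle_perms a b. psign (int (a * b)) (psign (if sign \<sigma> = 1 then 0 else 1)
      (H (perm_sublist \<sigma> xs 1 a) (perm_sublist \<sigma> xs (a + 1) (a + b))))) =
    psign (int (a * b)) (\<Sum>\<sigma>\<in>shuffle_perms a b. psign (inversion_sum (map (\<lambda>_. 1) xs) \<sigma>)
      (H (perm_sublist \<sigma> xs 1 a) (perm_sublist \<sigma> xs (a + 1) (a + b))))"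
    unfolding psign_sum map_replicate_const assms
    by (intro sum.cong refl) (auto simp: psign_def sign_shuffle_perms)
  also have "\<dots> = koszul_sum (\<lambda>_. 1) (\<lambda>S T. psign (int (a * b)) (if length S = a then H S T else 0)) xs"
    unfolding sum_shuffle_perms_koszul_sum[OF assms] koszul_sum_psign ..
  also have "\<dots> = shuffle_sum (\<lambda>S T. if length S = a then H S T else 0) xs"
    unfolding shuffle_sum_koszul_sum using assms
    by (intro koszul_sum_cong) (auto dest!: length_shuffles)
  finally show ?thesis .
qed

lemma shuffle_comp_shuffle_sum: "add_values P \<Longrightarrow> shuffle_comp P Q w x = shuffle_sum (\<lambda>S T. P S (Q T x)) w"
proof (induction w arbitrary: P Q)
  case (Cons X w)
  have "shuffle_comp (shift X P) (twist Q) w x = shuffle_sum (\<lambda>S T. psign (int (length T)) (P (X # S) (Q T x))) w"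
    using Cons.prems by (subst Cons.IH) (simp_all add: shift_def twist_def add_values_psign)
  moreover have "shuffle_comp P (shift X Q) w x = shuffle_sum (\<lambda>S T. P S (Q (X # T) x)) w"
    using Cons.prems by (subst Cons.IH) (simp_all add: shift_def)
  ultimately show ?case by simp
qed simp

text \<open>The reserved letter \<open>X\<close> belongs to the argument of \<open>Q\<close> but not
  to the splitting of \<open>w\<close>. Every letter of \<open>S\<close> stands before it and
  contributes one more sign.\<close>

lemma last_comp_shuffle_sum:
  "add_values P \<Longrightarrow> last_comp P Q (w @ [X]) = shuffle_sum (\<lambda>S T. psign (int (length S)) (P S (Q (T @ [X])))) w"
proof (induction w arbitrary: P Q)
  case (Cons Y w)
  have "last_comp (shift Y P) (twist Q) (w @ [X]) =
      shuffle_sum (\<lambda>S T. psign (int (length T)) (psign (int (length (Y # S))) (P (Y # S) (Q (T @ [X]))))) w"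
    using Cons.prems by (subst Cons.IH) (simp_all add: shift_def twist_def add_values_psign algebra_simps)
  moreover have "last_comp P (shift Y Q) (w @ [X]) =
      shuffle_sum (\<lambda>S T. psign (int (length S)) (P S (Q (Y # T @ [X])))) w"
    using Cons.prems by (subst Cons.IH) (simp_all add: shift_def)
  ultimately show ?case by (simp add: last_comp_Cons)
qed simp

text \<open>\<open>j\<close> is the place of the letter that takes up the output of
  \<open>Q\<close>. Only the letters before it are distributed between \<open>F\<close> and
  \<open>Q\<close>; the later ones go to \<open>F\<close> unchanged and without a sign.\<close>

lemma insertion_shuffle_sum:
  assumes "add_letters F"
  shows "insertion F Q w = (\<Sum>j<length w. shuffle_sum (\<lambda>S T.
     F (S @ (Q T (fst (w ! j)), snd (w ! j)) # drop (Suc j) w)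
     + F (S @ (fst (w ! j), Q T (snd (w ! j))) # drop (Suc j) w)) (take j w))"
  using assms
proof (induction w arbitrary: F Q)
  case (Cons X w)
  let ?G = "\<lambda>F Q w j S T. F (S @ (Q T (fst (w ! j)), snd (w ! j)) # drop (Suc j) w)
     + F (S @ (fst (w ! j), Q T (snd (w ! j))) # drop (Suc j) w)"
  \<comment> \<open>Additivity in the entries allows the sign made by \<open>twist\<close> to be
    pulled out of a letter.\<close>
  have bi: "F (u @ (psign n x, y) # v) = psign n (F (u @ (x, y) # v))"
    "F (u @ (y, psign n x) # v) = psign n (F (u @ (y, x) # v))" for u v x y n
  proof -
    have "F (u @ (0, y) # v) = 0" "F (u @ (y, 0) # v) = 0"
      using Cons.prems unfolding add_letters_def by (metis add_cancel_right_right)+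
    moreover have "F (u @ (x + - x, y) # v) = F (u @ (x, y) # v) + F (u @ (- x, y) # v)"
      "F (u @ (y, x + - x) # v) = F (u @ (y, x) # v) + F (u @ (y, - x) # v)"
      using Cons.prems unfolding add_letters_def by blast+
    ultimately have "F (u @ (- x, y) # v) = - F (u @ (x, y) # v)" "F (u @ (y, - x) # v) = - F (u @ (y, x) # v)"
      by (simp_all add: eq_neg_iff_add_eq_0 add.commute)
    then show "F (u @ (psign n x, y) # v) = psign n (F (u @ (x, y) # v))"
      "F (u @ (y, psign n x) # v) = psign n (F (u @ (y, x) # v))" by (simp_all add: psign_def)
  qed
  have 1: "shuffle_sum (?G F Q (X # w) (Suc j)) (take (Suc j) (X # w)) =
      shuffle_sum (?G (shift X F) (twist Q) w j) (take j w) + shuffle_sum (?G F (shift X Q) w j) (take j w)" for j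
  proof -
    have "(\<lambda>S T. psign (int (length T)) (?G F Q (X # w) (Suc j) (X # S) T)) = ?G (shift X F) (twist Q) w j"
      using bi[of "X # u" for u] by (simp add: fun_eq_iff shift_def twist_def psign_add)
    moreover have "(\<lambda>S T. ?G F Q (X # w) (Suc j) S (X # T)) = ?G F (shift X Q) w j"
      by (simp add: fun_eq_iff shift_def)
    ultimately show ?thesis by (simp only: take_Suc_Cons shuffle_sum.simps)
  qed
  have 2: "(\<Sum>j<length w. shuffle_sum (?G (shift X F) (twist Q) w j) (take j w)) = insertion (shift X F) (twist Q) w"
    using Cons.prems by (intro Cons.IH[symmetric]) simp
  have 3: "(\<Sum>j<length w. shuffle_sum (?G F (shift X Q) w j) (take j w)) = insertion F (shift X Q) w"
    using Cons.prems by (intro Cons.IH[symmetric])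
  have "(\<Sum>j<length (X # w). shuffle_sum (?G F Q (X # w) j) (take j (X # w))) =
      shuffle_sum (?G F Q (X # w) 0) (take 0 (X # w))
      + (\<Sum>j<length w. shuffle_sum (?G F Q (X # w) (Suc j)) (take (Suc j) (X # w)))"
    unfolding list.size(4) add_Suc_right add_0_right sum.lessThan_Suc_shift ..
  also have "\<dots> = (F ((Q [] (fst X), snd X) # w) + F ((fst X, Q [] (snd X)) # w))
     + (insertion (shift X F) (twist Q) w + insertion F (shift X Q) w)"
    unfolding 1 sum.distrib 2 3 by simp
  finally show ?case by (simp only: insertion.simps add_ac)
qed simp

section \<open>The graded Lie algebra of cochains\<close>

definition hom_letters :: "('k \<Rightarrow> 'w \<Rightarrow> 'w) \<Rightarrow> ('k \<Rightarrow> 'c \<Rightarrow> 'c) \<Rightarrow> (('w \<times> 'w) list \<Rightarrow> 'c) \<Rightarrow> bool" where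
  "hom_letters s t F \<longleftrightarrow> (\<forall>u v c x y. F (u @ (s c x, y) # v) = t c (F (u @ (x, y) # v)) \<and>
     F (u @ (y, s c x) # v) = t c (F (u @ (y, x) # v)))"

definition alternating :: "(('w \<times> 'w) list \<Rightarrow> 'c::zero) \<Rightarrow> bool" where
  "alternating F \<longleftrightarrow> (\<forall>u v x. F (u @ (x, x) # v) = 0)"

definition hom_values :: "('k \<Rightarrow> 'a \<Rightarrow> 'a) \<Rightarrow> ('k \<Rightarrow> 'b \<Rightarrow> 'b) \<Rightarrow> ('x list \<Rightarrow> 'a \<Rightarrow> 'b) \<Rightarrow> bool" where
  "hom_values s t P \<longleftrightarrow> (\<forall>w c x. P w (s c x) = t c (P w x))"

text \<open>A second component is treated as a function of words whose values are functions of the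
  last argument; this is the scalar multiplication on such values.\<close>

abbreviation (input) fscale :: "('k \<Rightarrow> 'b \<Rightarrow> 'b) \<Rightarrow> 'k \<Rightarrow> ('a \<Rightarrow> 'b) \<Rightarrow> 'a \<Rightarrow> 'b" where
  "fscale t c f x \<equiv> t c (f x)"

text \<open>All conditions on a cochain except a degree, so that inhomogeneous elements are
  included, even with infinitely many non-zero degrees. The space is closed under the product and
  the bracket, and both are bilinear on it.\<close>

definition ml_cochains :: "('k \<Rightarrow> 'w::ab_group_add \<Rightarrow> 'w) \<Rightarrow> ('k \<Rightarrow> 'v::ab_group_add \<Rightarrow> 'v)
    \<Rightarrow> ('w, 'v) cochain set" where
  "ml_cochains s t = {P. fst P [] = 0 \<and> add_letters (fst P) \<and> hom_letters s t (fst P) \<and> alternating (fst P) \<and>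
     add_letters (snd P) \<and> hom_letters s (fscale t) (snd P) \<and> alternating (snd P) \<and> add_values (snd P) \<and> hom_values s t (snd P)}"

definition supp_in :: "nat \<Rightarrow> ('w, 'v::ab_group_add) cochain \<Rightarrow> bool" where
  "supp_in p P \<longleftrightarrow> (\<forall>w. length w \<noteq> p \<longrightarrow> fst P w = 0 \<and> snd P w = 0)"

lemma ml_cochainsD:
  assumes "P \<in> ml_cochains s t"
  shows "fst P [] = 0" "add_letters (fst P)" "hom_letters s t (fst P)" "alternating (fst P)"
    "add_letters (snd P)" "hom_letters s (fscale t) (snd P)" "alternating (snd P)" "add_values (snd P)" "hom_values s t (snd P)"
  using assms by (simp_all add: ml_cochains_def)

lemma scale_0 [simp]: "vector_space t \<Longrightarrow> t c 0 = 0"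
  using module.scale_zero_right[of t c] by (simp add: module_iff_vector_space)

lemma scale_add: "vector_space t \<Longrightarrow> t c (x + y) = t c x + t c y"
  by (rule vector_space.vector_space_assms(1))

lemma scale_minus: "vector_space t \<Longrightarrow> t c (- x) = - t c x"
  using module.scale_minus_right[of t c] by (simp add: module_iff_vector_space)

lemma scale_psign: "vector_space t \<Longrightarrow> t c (psign n x) = psign n (t c x)"
  by (simp add: psign_def scale_minus)

text \<open>Replacing a letter becomes a factorization \<open>u @ X # v\<close>, which suits
  induction on words. The conditions extend to words of other lengths since all values there are
  zero.\<close>

lemma wedge_multilinear_iff:
  assumes s: "vector_space s" and t: "vector_space t"
  shows "wedge_multilinear s t p F \<longleftrightarrow>
     (\<forall>w. length w \<noteq> p \<longrightarrow> F w = 0) \<and> add_letters F \<and> hom_letters s t F \<and> alternating F"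
    (is "?L \<longleftrightarrow> ?S \<and> ?B")
proof
  assume L: ?L
  then have S: ?S by (simp add: wedge_multilinear_def)
  have *: "F (u @ (x + x', y) # v) = F (u @ (x, y) # v) + F (u @ (x', y) # v) \<and>
      F (u @ (y, x + x') # v) = F (u @ (y, x) # v) + F (u @ (y, x') # v) \<and>
      F (u @ (s c x, y) # v) = t c (F (u @ (x, y) # v)) \<and>
      F (u @ (y, s c x) # v) = t c (F (u @ (y, x) # v)) \<and> F (u @ (x, x) # v) = 0" for u v x x' y c
  proof (cases "length u + Suc (length v) = p")
    case True
    let ?X = "u @ (x, y) # v"
    have "\<forall>y. Vector_Spaces.linear s t (\<lambda>x. F (?X[length u := (x, y)]))"
      "\<forall>y. Vector_Spaces.linear s t (\<lambda>x. F (?X[length u := (y, x)]))" "\<forall>x. F (?X[length u := (x, x)]) = 0"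
      using L True unfolding wedge_multilinear_def by (auto dest!: spec[of _ ?X] spec[of _ "length u"])
    then show ?thesis by (simp add: Vector_Spaces.linear_iff)
  next
    case False
    then have "F (u @ z # v) = 0" for z using S by simp
    then show ?thesis using t by simp
  qed
  then show "?S \<and> ?B" using S by (simp add: add_letters_def hom_letters_def alternating_def)
next
  assume R: "?S \<and> ?B"
  have "Vector_Spaces.linear s t (\<lambda>x. F (Xs[i := (x, y)])) \<and> Vector_Spaces.linear s t (\<lambda>x. F (Xs[i := (y, x)]))
      \<and> F (Xs[i := (y, y)]) = 0" if "i < length Xs" for Xs i y
    using R s t that unfolding upd_conv_take_nth_drop[OF that] Vector_Spaces.linear_iff
    by (simp add: add_letters_def hom_letters_def alternating_def)
  then show ?L using R by (simp add: wedge_multilinear_def)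
qed

lemma cochains_iff:
  assumes s: "vector_space s" and t: "vector_space t"
  shows "P \<in> cochains s t p \<longleftrightarrow> P \<in> ml_cochains s t \<and> supp_in p P"
proof -
  have "(\<forall>x. wedge_multilinear s t p (\<lambda>Xs. snd P Xs x)) \<longleftrightarrow>
      (\<forall>w. length w \<noteq> p \<longrightarrow> snd P w = 0) \<and> add_letters (snd P) \<and> hom_letters s (fscale t) (snd P) \<and> alternating (snd P)"
    unfolding wedge_multilinear_iff[OF s t]
    by (auto simp: fun_eq_iff add_letters_def hom_letters_def alternating_def)
  moreover have "(\<forall>Xs. Vector_Spaces.linear s t (snd P Xs)) \<longleftrightarrow> add_values (snd P) \<and> hom_values s t (snd P)"
    using s t by (auto simp: Vector_Spaces.linear_iff add_values_def hom_values_def)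
  moreover have e: "(p = 0 \<longrightarrow> fst P = 0) \<longleftrightarrow> fst P [] = 0"
    if "\<forall>w. length w \<noteq> p \<longrightarrow> fst P w = 0"
  proof
    assume "fst P [] = 0"
    then have "fst P w = 0" if "p = 0" for w
      using that \<open>\<forall>w. length w \<noteq> p \<longrightarrow> fst P w = 0\<close> by (cases "w = []") auto
    then show "p = 0 \<longrightarrow> fst P = 0" by (simp add: fun_eq_iff)
  qed (use that in \<open>auto\<close>)
  ultimately show ?thesis
    unfolding cochains_def mem_Collect_eq wedge_multilinear_iff[OF s t, of p "fst P"]
    using e by (auto simp: ml_cochains_def supp_in_def fun_eq_iff)
qed

text \<open>The product without reference to degrees, which enter only through the supports of the
  arguments.\<close>

definition circ :: "('w::ab_group_add, 'w) cochain \<Rightarrow> ('w, 'w) cochain \<Rightarrow> ('w, 'w) cochain" where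
  "circ P Q = (last_comp (snd P) (fst Q) + insertion (fst P) (snd Q), circ_II (snd P) (snd Q))"

lemma perm_sublist_take:
  assumes "\<sigma> permutes {1..j}" "1 \<le> m" "n \<le> j" "j \<le> length xs"
  shows "perm_sublist \<sigma> (take j xs) m n = perm_sublist \<sigma> xs m n"
  unfolding perm_sublist_def
proof (rule map_cong[OF refl])
  fix i assume "i \<in> set [m..<Suc n]"
  then have "i \<in> {1..j}" using assms by auto
  then have "\<sigma> i \<in> {1..j}" using permutes_in_image[OF assms(1), of i] by blast
  then show "take j xs ! (\<sigma> i - 1) = xs ! (\<sigma> i - 1)" using assms by auto
qed

lemma scale_sign: "vector_space s \<Longrightarrow> s (of_int (sign \<sigma>)) x = psign (if sign \<sigma> = 1 then 0 else 1) x"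
proof -
  assume "vector_space s"
  then interpret vector_space s .
  show ?thesis by (cases \<sigma> rule: sign_cases) simp_all
qed

lemma scale_m1_power: "vector_space s \<Longrightarrow> s ((-1) ^ n) x = psign (int n) x"
proof -
  assume "vector_space s"
  then interpret vector_space s .
  show ?thesis by (cases "even n") simp_all
qed

lemma scale_m1_power_sign:
  "vector_space s \<Longrightarrow> s ((-1) ^ n * of_int (sign \<sigma>)) x = psign (int n) (psign (if sign \<sigma> = 1 then 0 else 1) x)"
proof -
  assume v: "vector_space s"
  then interpret vector_space s .
  show ?thesis by (simp only: scale_scale[symmetric] scale_m1_power[OF v] scale_sign[OF v])
qed

text \<open>In the \<open>k\<close>-th summand \<open>k - 1\<close> letters for \<open>F\<close> and
  \<open>q\<close> letters for \<open>G\<close> come first, so the modified letter stands at place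
  \<open>k - 1 + q\<close>, counted from zero. Every other splitting leaves \<open>F\<close> with a
  wrong number of letters.\<close>

lemma ly_insertions_insertion:
  assumes s: "vector_space s" and F: "add_letters F" "\<And>w. length w \<noteq> p \<Longrightarrow> F w = 0" and L: "length Xs = p + q"
  shows "ly_insertions s p q F G Xs = insertion F G Xs"
proof -
  let ?H = "\<lambda>j S T. F (S @ (G T (fst (Xs ! j)), snd (Xs ! j)) # drop (Suc j) Xs)
     + F (S @ (fst (Xs ! j), G T (snd (Xs ! j))) # drop (Suc j) Xs)"
  have len: "?H j S T = 0" if "j < p + q" "length S + length T = j" "length T \<noteq> q" for j S T
    using that L F(2) by simp
  \<comment> \<open>With fewer than \<open>q\<close> letters in front, more than \<open>p\<close>
    letters are left for \<open>F\<close>.\<close>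
  have 1: "shuffle_sum (?H j) (take j Xs) = 0" if "j < q" for j
  proof -
    have "shuffle_sum (?H j) (take j Xs) = shuffle_sum (\<lambda>S T. 0) (take j Xs)"
      using that L by (intro shuffle_sum_cong len) auto
    also have "\<dots> = 0" by (simp add: shuffle_sum_koszul_sum koszul_sum_zero)
    finally show ?thesis .
  qed
  have 2: "s ((-1) ^ ((k - 1) * q)) (\<Sum>\<sigma>\<in>shuffle_perms (k - 1) q. s (of_int (sign \<sigma>))
        (let (x, y) = Xs ! (k + q - 1) in
           F (perm_sublist \<sigma> Xs 1 (k - 1)
              @ [(G (perm_sublist \<sigma> Xs k (k + q - 1)) x, y)] @ drop (k + q) Xs)
         + F (perm_sublist \<sigma> Xs 1 (k - 1)
              @ [(x, G (perm_sublist \<sigma> Xs k (k + q - 1)) y)] @ drop (k + q) Xs))) =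
      shuffle_sum (?H (k - 1 + q)) (take (k - 1 + q) Xs)" if k: "k \<in> {1..p}" for k
  proof -
    obtain a where a: "k = Suc a" "a < p" using k by (cases k) auto
    have "shuffle_sum (?H (a + q)) (take (a + q) Xs) =
        shuffle_sum (\<lambda>S T. if length S = a then ?H (a + q) S T else 0) (take (a + q) Xs)"
      using a L by (intro shuffle_sum_cong) (auto intro!: len simp del: append_Cons)
    also have "\<dots> = (\<Sum>\<sigma>\<in>shuffle_perms a q. psign (int (a * q)) (psign (if sign \<sigma> = 1 then 0 else 1)
      (?H (a + q) (perm_sublist \<sigma> (take (a + q) Xs) 1 a) (perm_sublist \<sigma> (take (a + q) Xs) (a + 1) (a + q)))))"
      using a L by (intro sum_shuffle_perms_sign[symmetric]) simp
    also have "\<dots> = psign (int (a * q)) (\<Sum>\<sigma>\<in>shuffle_perms a q. psign (if sign \<sigma> = 1 then 0 else 1)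
      (?H (a + q) (perm_sublist \<sigma> Xs 1 a) (perm_sublist \<sigma> Xs (a + 1) (a + q))))"
      unfolding psign_sum
    proof (intro sum.cong refl)
      fix \<sigma> assume "\<sigma> \<in> shuffle_perms a q"
      note p = shuffle_permsD(1)[OF this]
      have "perm_sublist \<sigma> (take (a + q) Xs) 1 a = perm_sublist \<sigma> Xs 1 a"
        "perm_sublist \<sigma> (take (a + q) Xs) (a + 1) (a + q) = perm_sublist \<sigma> Xs (a + 1) (a + q)"
        using a L by (auto intro!: perm_sublist_take[OF p])
      then show "psign (int (a * q)) (psign (if sign \<sigma> = 1 then 0 else 1)
      (?H (a + q) (perm_sublist \<sigma> (take (a + q) Xs) 1 a) (perm_sublist \<sigma> (take (a + q) Xs) (a + 1) (a + q)))) =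
       psign (int (a * q)) (psign (if sign \<sigma> = 1 then 0 else 1)
      (?H (a + q) (perm_sublist \<sigma> Xs 1 a) (perm_sublist \<sigma> Xs (a + 1) (a + q))))" by (simp only:)
    qed
    finally show ?thesis
      by (simp add: a scale_m1_power[OF s] scale_sign[OF s] Let_def split_def del: of_nat_mult psign_psign)
  qed
  have "insertion F G Xs = (\<Sum>j<p + q. shuffle_sum (?H j) (take j Xs))"
    using insertion_shuffle_sum[OF F(1), of G Xs] L by simp
  also have "\<dots> = (\<Sum>j\<in>{q..<q + p}. shuffle_sum (?H j) (take j Xs))"
    by (intro sum.mono_neutral_right) (auto simp: 1)
  also have "\<dots> = (\<Sum>k\<in>{1..p}. shuffle_sum (?H (k - 1 + q)) (take (k - 1 + q) Xs))"
    by (intro sum.reindex_bij_witness[of _ "\<lambda>k. k - 1 + q" "\<lambda>j. j - q + 1"]) auto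
  finally show ?thesis unfolding ly_insertions_def using 2 by (simp only: cong: sum.cong)
qed

lemma shuffle_sum_zero: "shuffle_sum (\<lambda>S T. 0) xs = 0"
  by (simp add: shuffle_sum_koszul_sum koszul_sum_zero)

lemma shuffle_comp_supp_in:
  assumes "add_values P" "\<And>w. length w \<noteq> p \<Longrightarrow> P w = 0" "\<And>w. length w \<noteq> q \<Longrightarrow> Q w = 0" "length w \<noteq> p + q"
  shows "shuffle_comp P Q w x = 0"
proof -
  have "shuffle_sum (\<lambda>S T. P S (Q T x)) w = shuffle_sum (\<lambda>S T. 0) w"
  proof (rule shuffle_sum_cong)
    fix S T :: "'a list" assume "length S + length T = length w"
    then have "length S \<noteq> p \<or> length T \<noteq> q" using assms(4) by auto
    then show "P S (Q T x) = 0" using assms by (auto simp: add_values_0)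
  qed
  then show ?thesis using assms by (simp add: shuffle_comp_shuffle_sum shuffle_sum_zero)
qed

lemma last_comp_supp_in:
  assumes "add_values P" "\<And>w. length w \<noteq> p \<Longrightarrow> P w = 0" "\<And>w. length w \<noteq> q \<Longrightarrow> Q w = 0" "length w \<noteq> p + q"
  shows "last_comp P Q w = 0"
proof (cases w rule: rev_cases)
  case (snoc u X)
  have "shuffle_sum (\<lambda>S T. psign (int (length S)) (P S (Q (T @ [X])))) u = shuffle_sum (\<lambda>S T. 0) u"
  proof (rule shuffle_sum_cong)
    fix S T :: "'a list" assume "length S + length T = length u"
    then have "length S \<noteq> p \<or> length (T @ [X]) \<noteq> q" using assms(4) snoc by auto
    then show "psign (int (length S)) (P S (Q (T @ [X]))) = 0" using assms by (auto simp: add_values_0)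
  qed
  then show ?thesis using assms snoc by (simp add: last_comp_shuffle_sum shuffle_sum_zero)
qed simp

lemma add_letters_0_mid:
  assumes "add_letters F"
  shows "F (u @ (0, y) # v) = 0" "F (u @ (y, 0) # v) = 0"
  using assms unfolding add_letters_def by (metis add_cancel_right_right)+

lemma insertion_supp_in:
  assumes "add_letters F" "\<And>w. length w \<noteq> p \<Longrightarrow> F w = 0" "\<And>w. length w \<noteq> q \<Longrightarrow> Q w = 0" "length w \<noteq> p + q"
  shows "insertion F Q w = 0"
proof -
  have "shuffle_sum (\<lambda>S T. F (S @ (Q T (fst (w ! j)), snd (w ! j)) # drop (Suc j) w)
     + F (S @ (fst (w ! j), Q T (snd (w ! j))) # drop (Suc j) w)) (take j w) = shuffle_sum (\<lambda>S T. 0) (take j w)"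
    if "j < length w" for j
  proof (rule shuffle_sum_cong)
    fix S T :: "('a \<times> 'a) list" assume "length S + length T = length (take j w)"
    then have "length S + Suc (length w - Suc j) \<noteq> p \<or> length T \<noteq> q" using assms(4) that by auto
    then show "F (S @ (Q T (fst (w ! j)), snd (w ! j)) # drop (Suc j) w)
     + F (S @ (fst (w ! j), Q T (snd (w ! j))) # drop (Suc j) w) = 0"
    proof
      assume "length T \<noteq> q"
      then have "Q T = 0" by (rule assms(3))
      then show ?thesis by (simp add: add_letters_0_mid[OF assms(1)])
    qed (simp add: assms(2))
  qed
  then show ?thesis using insertion_shuffle_sum[OF assms(1), of Q w] by (simp add: shuffle_sum_zero)
qed

text \<open>The fixed last place drops out of the second block, which turns the constrained sum of
  the product into a free sum over shuffles of one letter less.\<close>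

lemma shuffle_perms_fix_last:
  "{\<sigma> \<in> shuffle_perms p (Suc q). \<sigma> (p + Suc q) = p + Suc q} = shuffle_perms p q"
proof (intro set_eqI iffI)
  fix \<sigma> assume a: "\<sigma> \<in> {\<sigma> \<in> shuffle_perms p (Suc q). \<sigma> (p + Suc q) = p + Suc q}"
  then have s: "\<sigma> permutes {1..p + Suc q}" "strict_mono_on {1..p} \<sigma>" "strict_mono_on {p+1..p + Suc q} \<sigma>"
    by (auto simp: shuffle_perms_def)
  have "\<sigma> permutes {1..p + Suc q} - {p + Suc q}" using permutes_superset[OF s(1), of "{1..p + Suc q} - {p + Suc q}"] a by auto
  moreover have "{1..p + Suc q} - {p + Suc q} = {1..p + q}" by auto
  moreover have "strict_mono_on {p+1..p + q} \<sigma>" by (rule monotone_on_subset[OF s(3)]) auto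
  ultimately show "\<sigma> \<in> shuffle_perms p q" using s by (simp add: shuffle_perms_def)
next
  fix \<sigma> assume "\<sigma> \<in> shuffle_perms p q"
  note s = shuffle_permsD[OF this]
  have f: "\<sigma> (p + Suc q) = p + Suc q" by (rule permutes_not_in[OF s(1)]) auto
  have "\<sigma> permutes {1..p + Suc q}" by (rule permutes_subset[OF s(1)]) auto
  moreover have "strict_mono_on {p+1..p + Suc q} \<sigma>"
  proof (rule strict_mono_onI)
    fix i j assume ij: "i \<in> {p+1..p + Suc q}" "j \<in> {p+1..p + Suc q}" "i < j"
    show "\<sigma> i < \<sigma> j"
    proof (cases "j = p + Suc q")
      case True
      have "i \<in> {1..p + q}" using ij True by auto
      then have "\<sigma> i \<in> {1..p + q}" using permutes_in_image[OF s(1), of i] by blast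
      then show ?thesis using True f by auto
    next
      case False
      then show ?thesis using ij by (intro strict_mono_onD[OF s(3)]) auto
    qed
  qed
  ultimately show "\<sigma> \<in> {\<sigma> \<in> shuffle_perms p (Suc q). \<sigma> (p + Suc q) = p + Suc q}"
    using s f by (simp add: shuffle_perms_def)
qed

text \<open>The closed forms of the three recursions are compared with the permutation sums; the
  supports of \<open>P\<close> and \<open>Q\<close> select the splittings into \<open>p\<close> and
  \<open>q\<close> letters.\<close>

lemma ly_diamond_circ:
  assumes s: "vector_space s" and P: "P \<in> cochains s s p" and Q: "Q \<in> cochains s s q"
  shows "ly_diamond s p q P Q = circ P Q"
proof -
  have PM: "P \<in> ml_cochains s s" "supp_in p P" and QM: "Q \<in> ml_cochains s s" "supp_in q Q"
    using P Q by (simp_all add: cochains_iff[OF s s])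
  note Pd = ml_cochainsD[OF PM(1)] and Qd = ml_cochainsD[OF QM(1)]
  have sP: "length w \<noteq> p \<Longrightarrow> fst P w = 0" "length w \<noteq> p \<Longrightarrow> snd P w = 0"
    and sQ: "length w \<noteq> q \<Longrightarrow> fst Q w = 0" "length w \<noteq> q \<Longrightarrow> snd Q w = 0" for w
    using PM QM by (simp_all add: supp_in_def)
  let ?t = "\<lambda>\<sigma>. if sign \<sigma> = 1 then 0 else 1 :: int"
  show ?thesis
  proof (intro prod_eqI ext)
    fix w
    show "fst (ly_diamond s p q P Q) w = fst (circ P Q) w"
    proof (cases "length w = p + q")
      case False
      have "fst (circ P Q) w = 0"
        using False by (simp add: circ_def last_comp_supp_in[OF Pd(8) sP(2) sQ(1)] insertion_supp_in[OF Pd(2) sP(1) sQ(2)])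
      then show ?thesis using False by (simp add: ly_diamond_def)
    next
      case True
      have "(\<Sum>\<sigma>\<in>{\<sigma>\<in>shuffle_perms p q. \<sigma> (p + q) = p + q}. s ((-1) ^ (p * q) * of_int (sign \<sigma>))
           (snd P (perm_sublist \<sigma> w 1 p) (fst Q (perm_sublist \<sigma> w (p + 1) (p + q))))) =
          last_comp (snd P) (fst Q) w"
      proof (cases q)
        case 0
        \<comment> \<open>In degree 0 there is no letter to reserve; as the first component vanishes
          by convention, both sides are zero.\<close>
        have "fst Q v = 0" for v using Qd(1) sQ(1)[of v] 0 by (cases "v = []") auto
        then have "fst Q = 0" by (simp add: fun_eq_iff)
        then show ?thesis using s by (simp add: add_values_0[OF Pd(8)] last_comp_zero_right[OF Pd(8)])
      next
        case (Suc q')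
        obtain u X where w: "w = u @ [X]" using True Suc by (cases w rule: rev_cases) auto
        then have L: "length u = p + q'" using True Suc by simp
        have pl: "perm_sublist \<sigma> w 1 p = perm_sublist \<sigma> u 1 p"
          "perm_sublist \<sigma> w (p + 1) (p + Suc q') = perm_sublist \<sigma> u (p + 1) (p + q') @ [X]"
          if "\<sigma> \<in> shuffle_perms p q'" for \<sigma>
        proof -
          note pm = shuffle_permsD(1)[OF that]
          have f: "\<sigma> (p + Suc q') = p + Suc q'" by (rule permutes_not_in[OF pm]) auto
          have tk: "take (p + q') w = u" using w L by simp
          show "perm_sublist \<sigma> w 1 p = perm_sublist \<sigma> u 1 p"
            using perm_sublist_take[OF pm, of 1 p w] w L tk by simp
          have "perm_sublist \<sigma> w (p + 1) (p + q') = perm_sublist \<sigma> u (p + 1) (p + q')"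
            using perm_sublist_take[OF pm, of "p + 1" "p + q'" w] w L tk by simp
          moreover have "[p + 1..<Suc (p + Suc q')] = [p + 1..<Suc (p + q')] @ [p + Suc q']" by simp
          moreover have "\<sigma> (p + Suc q') - 1 = length u" using f L by simp
          then have "w ! (\<sigma> (p + Suc q') - 1) = X" by (simp add: w)
          ultimately show "perm_sublist \<sigma> w (p + 1) (p + Suc q') = perm_sublist \<sigma> u (p + 1) (p + q') @ [X]"
            by (simp only: perm_sublist_def map_append list.map)
        qed
        have "last_comp (snd P) (fst Q) w =
            shuffle_sum (\<lambda>S T. if length S = p then psign (int p) (snd P S (fst Q (T @ [X]))) else 0) u"
          unfolding w last_comp_shuffle_sum[OF Pd(8)] by (intro shuffle_sum_cong) (simp add: sP)
        also have "\<dots> = (\<Sum>\<sigma>\<in>shuffle_perms p q'. psign (int (p * q')) (psign (?t \<sigma>)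
            (psign (int p) (snd P (perm_sublist \<sigma> u 1 p) (fst Q (perm_sublist \<sigma> u (p + 1) (p + q') @ [X]))))))"
          by (rule sum_shuffle_perms_sign[OF L, symmetric])
        \<comment> \<open>The exponent p q' of the shorter shuffles and the p signs for the reserved
          letter add up to p (q' + 1).\<close>
        also have "\<dots> = (\<Sum>\<sigma>\<in>shuffle_perms p q'. psign (int (p * Suc q')) (psign (?t \<sigma>)
            (snd P (perm_sublist \<sigma> w 1 p) (fst Q (perm_sublist \<sigma> w (p + 1) (p + Suc q'))))))"
          by (intro sum.cong refl) (simp only: pl, simp add: psign_def)
        finally show ?thesis
          unfolding Suc shuffle_perms_fix_last scale_m1_power_sign[OF s] ..
      qed
      then show ?thesis using True Pd sP
        by (simp add: ly_diamond_def circ_def ly_insertions_insertion[OF s])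
    qed
  next
    fix w x
    show "snd (ly_diamond s p q P Q) w x = snd (circ P Q) w x"
    proof (cases "length w = p + q")
      case False
      have "snd (circ P Q) w x = 0"
        using False by (simp add: circ_def circ_II_def shuffle_comp_supp_in[OF Pd(8) sP(2) sQ(2)] insertion_supp_in[OF Pd(5) sP(2) sQ(2)])
      then show ?thesis using False by (simp add: ly_diamond_def)
    next
      case True
      have "shuffle_comp (snd P) (snd Q) w x =
            shuffle_sum (\<lambda>S T. if length S = p then snd P S (snd Q T x) else 0) w"
        unfolding shuffle_comp_shuffle_sum[OF Pd(8)] by (intro shuffle_sum_cong) (simp add: sP)
      also have "\<dots> = (\<Sum>\<sigma>\<in>shuffle_perms p q. psign (int (p * q)) (psign (?t \<sigma>)
            (snd P (perm_sublist \<sigma> w 1 p) (snd Q (perm_sublist \<sigma> w (p + 1) (p + q)) x))))"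
        by (rule sum_shuffle_perms_sign[OF True, symmetric])
      finally have c: "shuffle_comp (snd P) (snd Q) w x = \<dots>" .
      have "ly_insertions s p q (\<lambda>Ys. snd P Ys x) (snd Q) w = insertion (\<lambda>Ys. snd P Ys x) (snd Q) w"
        using True by (intro ly_insertions_insertion[OF s]) (auto simp: sP add_letters_apply[OF Pd(5)])
      then show ?thesis using True
        by (simp only: ly_diamond_def circ_def circ_II_def snd_conv if_True plus_fun_apply c
            scale_m1_power_sign[OF s] insertion_apply[of "snd P"] refl)
    qed
  qed
qed

lemma shuffle_sum_map:
  assumes "\<And>x y. \<phi> (x + y) = \<phi> x + \<phi> y"
  shows "shuffle_sum (\<lambda>S T. \<phi> (H S T)) xs = \<phi> (shuffle_sum H xs)"
proof -
  have z: "\<phi> 0 = 0" using assms[of 0 0] by simp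
  have m: "\<phi> (- x) = - \<phi> x" for x
    using assms[of x "- x"] z by (simp add: eq_neg_iff_add_eq_0 add.commute)
  have "\<phi> (psign n x) = psign n (\<phi> x)" for n x by (simp add: psign_def m)
  then show ?thesis
    unfolding shuffle_sum_koszul_sum koszul_sum_map[of \<phi>, OF assms] by simp
qed

section \<open>Homogeneity and alternation of the three operations\<close>

lemma shuffle_comp_scale_left:
  assumes t: "vector_space t" and P: "add_values P"
  shows "shuffle_comp (\<lambda>v z. t c (P v z)) Q w x = t c (shuffle_comp P Q w x)"
proof -
  have "add_values (\<lambda>v z. t c (P v z))" using P t by (simp add: add_values_def scale_add)
  then show ?thesis using P t
    by (simp add: shuffle_comp_shuffle_sum shuffle_sum_map[of "t c"] scale_add)
qed

lemma shuffle_comp_scale_right: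
  assumes t: "vector_space t" and P: "add_values P" "hom_values s t P"
  shows "shuffle_comp P (\<lambda>v z. s c (Q v z)) w x = t c (shuffle_comp P Q w x)"
  using P t by (simp add: shuffle_comp_shuffle_sum hom_values_def shuffle_sum_map[of "t c"] scale_add)

lemma last_comp_scale_left:
  assumes t: "vector_space t" and P: "add_values P"
  shows "last_comp (\<lambda>v z. t c (P v z)) Q w = t c (last_comp P Q w)"
proof -
  have "add_values (\<lambda>v z. t c (P v z))" using P t by (simp add: add_values_def scale_add)
  then show ?thesis using P t
    by (cases w rule: rev_cases)
      (simp_all add: last_comp_shuffle_sum scale_psign[symmetric] shuffle_sum_map[of "t c"] scale_add)
qed

lemma last_comp_scale_right:
  assumes t: "vector_space t" and P: "add_values P" "hom_values s t P"
  shows "last_comp P (\<lambda>v. s c (Q v)) w = t c (last_comp P Q w)"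
  using P t
  by (cases w rule: rev_cases)
    (simp_all add: last_comp_shuffle_sum hom_values_def scale_psign[symmetric] shuffle_sum_map[of "t c"] scale_add)

lemma insertion_scale_left:
  assumes t: "vector_space t" and F: "add_letters F"
  shows "insertion (\<lambda>v. t c (F v)) Q w = t c (insertion F Q w)"
proof -
  interpret vector_space t by (rule t)
  have "add_letters (\<lambda>v. t c (F v))" using F t by (simp add: add_letters_def scale_add)
  then show ?thesis using F t
    by (simp add: insertion_shuffle_sum scale_add[symmetric] shuffle_sum_map[of "t c"] scale_sum_right
        del: scale_add)
qed

lemma insertion_scale_right:
  assumes t: "vector_space t" and F: "add_letters F" "hom_letters s t F"
  shows "insertion F (\<lambda>v z. s c (Q v z)) w = t c (insertion F Q w)"
proof -
  interpret vector_space t by (rule t)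
  have "F (u @ (s c x, y) # v) = t c (F (u @ (x, y) # v))" "F (u @ (y, s c x) # v) = t c (F (u @ (y, x) # v))"
    for u v c x y using F by (simp_all add: hom_letters_def)
  then show ?thesis using F t
    by (simp add: insertion_shuffle_sum scale_right_distrib[symmetric] shuffle_sum_map[of "t c"] scale_sum_right
        del: scale_right_distrib)
qed

lemma vector_space_fscale: "vector_space t \<Longrightarrow> vector_space (fscale t)"
  by (simp add: vector_space_def fun_eq_iff)

lemma hom_letters_shift [simp]: "hom_letters s t F \<Longrightarrow> hom_letters s t (shift X F)"
  unfolding hom_letters_def shift_def by (metis append_Cons)

lemma hom_letters_twist [simp]: "vector_space t \<Longrightarrow> hom_letters s t F \<Longrightarrow> hom_letters s t (twist F)"
  by (simp add: hom_letters_def twist_def scale_psign)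

lemma alternating_shift [simp]: "alternating F \<Longrightarrow> alternating (shift X F)"
  unfolding alternating_def shift_def by (metis append_Cons)

lemma alternating_twist [simp]: "alternating F \<Longrightarrow> alternating (twist F)"
  by (simp add: alternating_def twist_def)

lemma hom_values_shift [simp]: "hom_values s t P \<Longrightarrow> hom_values s t (shift X P)"
  by (simp add: hom_values_def shift_def)

lemma hom_values_twist [simp]: "vector_space t \<Longrightarrow> hom_values s t P \<Longrightarrow> hom_values s t (twist P)"
  by (simp add: hom_values_def twist_def scale_psign)

lemma shift_pair_scale:
  assumes "hom_letters s t F"
  shows "shift (s c x, y) F = (\<lambda>v. t c (shift (x, y) F v))" "shift (y, s c x) F = (\<lambda>v. t c (shift (y, x) F v))"
proof -
  have "F ([] @ (s c x, y) # v) = t c (F ([] @ (x, y) # v))" "F ([] @ (y, s c x) # v) = t c (F ([] @ (y, x) # v))" for v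
    using assms unfolding hom_letters_def by blast+
  then show "shift (s c x, y) F = (\<lambda>v. t c (shift (x, y) F v))" "shift (y, s c x) F = (\<lambda>v. t c (shift (y, x) F v))"
    by (simp_all add: fun_eq_iff shift_def)
qed

lemma shift_pair_alternating:
  assumes "alternating F"
  shows "shift (x, x) F = 0"
proof -
  have "F ([] @ (x, x) # v) = 0" for v using assms unfolding alternating_def by blast
  then show ?thesis by (simp add: fun_eq_iff shift_def)
qed

text \<open>Polarization at \<open>x + y\<close>.\<close>

lemma alternating_skew:
  assumes "add_letters F" "alternating F"
  shows "F ((x, y) # v) + F ((y, x) # v) = 0"
proof -
  have z: "F ((x, x) # v) = 0" for x using assms(2) unfolding alternating_def by (metis append_Nil)
  have "F ((x + y, x + y) # v) = F ((x, y) # v) + F ((y, x) # v)"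
    unfolding add_lettersD1[OF assms(1)] add_lettersD2[OF assms(1)] by (simp add: z)
  then show ?thesis unfolding z[of "x + y"] by simp
qed

text \<open>A letter \<open>(x, x)\<close> read by \<open>F\<close> or \<open>Q\<close> gives zero.
  If it takes up the output of \<open>Q\<close>, the two resulting letters are mirror images and
  cancel by skew symmetry of \<open>F\<close>.\<close>

lemma alternating_insertion:
  assumes "add_letters F" "alternating F" "alternating Q"
  shows "alternating (insertion F Q)"
proof -
  have "insertion F Q (u @ (x, x) # v) = 0" if "add_letters F" "alternating F" "alternating Q"
    for F Q and u v :: "('a \<times> 'a) list" and x
    using that
  proof (induction u arbitrary: F Q)
    case Nil
    then show ?case
      by (simp add: shift_pair_alternating insertion_zero_left insertion_zero_right alternating_skew)
  next
    case (Cons Z u)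
    have "F (Y # u @ (x, x) # v) = 0" for Y
      using Cons.prems(2) unfolding alternating_def by (metis append_Cons)
    then show ?case using Cons by simp
  qed
  then show ?thesis using assms unfolding alternating_def[of "insertion F Q"] by blast
qed

lemma alternating_shuffle_comp:
  fixes P :: "('a \<times> 'a) list \<Rightarrow> 'b::ab_group_add \<Rightarrow> 'c::ab_group_add" and Q :: "('a \<times> 'a) list \<Rightarrow> 'd \<Rightarrow> 'b"
  assumes "add_values P" "alternating P" "alternating Q"
  shows "alternating (shuffle_comp P Q)"
proof -
  have "shuffle_comp P Q (u @ (x, x) # v) z = 0" if "add_values P" "alternating P" "alternating Q"
    for P :: "('a \<times> 'a) list \<Rightarrow> 'b \<Rightarrow> 'c" and Q :: "('a \<times> 'a) list \<Rightarrow> 'd \<Rightarrow> 'b" and u v x z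
    using that
    by (induction u arbitrary: P Q)
      (simp_all add: shift_pair_alternating shuffle_comp_zero_left shuffle_comp_zero_right)
  then show ?thesis using assms by (simp add: alternating_def[of "shuffle_comp P Q"] fun_eq_iff)
qed

lemma alternating_last_comp:
  assumes "add_values P" "alternating P" "alternating Q"
  shows "alternating (last_comp P Q)"
proof -
  have "last_comp P Q (u @ (x, x) # v) = 0" if "add_values P" "alternating P" "alternating Q"
    for P Q and u v :: "('a \<times> 'a) list" and x
    using that
  proof (induction u arbitrary: P Q)
    case Nil
    have "Q [(x, x)] = 0" using Nil(3) unfolding alternating_def by (metis append_Nil)
    then show ?case using Nil
      by (cases "v = []") (simp_all add: last_comp_Cons add_values_0 shift_pair_alternating last_comp_zero_left last_comp_zero_right)
  qed (simp add: last_comp_Cons)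
  then show ?thesis using assms unfolding alternating_def[of "last_comp P Q"] by blast
qed

lemma hom_letters_insertion:
  assumes "vector_space t" "vector_space s" "add_letters F" "hom_letters s t F" "hom_letters s (fscale s) Q" "hom_values s s Q"
  shows "hom_letters s t (insertion F Q)"
proof -
  have "insertion F Q (u @ (s c x, y) # v) = t c (insertion F Q (u @ (x, y) # v)) \<and>
      insertion F Q (u @ (y, s c x) # v) = t c (insertion F Q (u @ (y, x) # v))"
    if "add_letters F" "hom_letters s t F" "hom_letters s (fscale s) Q" "hom_values s s Q" for F Q and u v and x y c
    using that
  proof (induction u arbitrary: F Q)
    case Nil
    have h: "F ((s c x, y) # v) = t c (F ((x, y) # v))" "F ((y, s c x) # v) = t c (F ((y, x) # v))" for x y
      using Nil(2) unfolding hom_letters_def by (metis append_Nil)+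
    show ?case using Nil assms
      by (simp add: shift_pair_scale[of s t F] shift_pair_scale[of s "fscale s" Q] insertion_scale_left
          insertion_scale_right[of t _ s] h hom_values_def scale_add)
  next
    case (Cons Z u)
    have "F (Y # u @ (s c x, y) # v) = t c (F (Y # u @ (x, y) # v))" "F (Y # u @ (y, s c x) # v) = t c (F (Y # u @ (y, x) # v))" for Y
      using Cons.prems(2) unfolding hom_letters_def by (metis append_Cons)+
    then show ?case using Cons assms by (simp add: vector_space_fscale scale_add)
  qed
  then show ?thesis using assms unfolding hom_letters_def[of s t "insertion F Q"] by blast
qed

lemma hom_letters_shuffle_comp:
  fixes P :: "('a::ab_group_add \<times> 'a) list \<Rightarrow> 'a \<Rightarrow> 'c::ab_group_add" and Q :: "('a \<times> 'a) list \<Rightarrow> 'd \<Rightarrow> 'a"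
  assumes "vector_space t" "vector_space s" "add_values P" "hom_values s t P" "hom_letters s (fscale t) P" "hom_letters s (fscale s) Q"
  shows "hom_letters s (fscale t) (shuffle_comp P Q)"
proof -
  have "shuffle_comp P Q (u @ (s c x, y) # v) z = t c (shuffle_comp P Q (u @ (x, y) # v) z) \<and>
      shuffle_comp P Q (u @ (y, s c x) # v) z = t c (shuffle_comp P Q (u @ (y, x) # v) z)"
    if "add_values P" "hom_values s t P" "hom_letters s (fscale t) P" "hom_letters s (fscale s) Q"
    for P :: "('a \<times> 'a) list \<Rightarrow> 'a \<Rightarrow> 'c" and Q :: "('a \<times> 'a) list \<Rightarrow> 'd \<Rightarrow> 'a" and u v x y c z
    using that
  proof (induction u arbitrary: P Q)
    case Nil
    show ?case using Nil assms
      by (simp add: shift_pair_scale[of s "fscale t" P] shift_pair_scale[of s "fscale s" Q] shuffle_comp_scale_left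
          shuffle_comp_scale_right[of t _ s] scale_add)
  next
    case (Cons Z u)
    then show ?case using assms by (simp add: vector_space_fscale scale_add)
  qed
  then show ?thesis using assms by (simp add: hom_letters_def[of s "fscale t" "shuffle_comp P Q"] fun_eq_iff)
qed

lemma hom_letters_last_comp:
  assumes "vector_space t" "vector_space s" "add_values P" "hom_values s t P" "hom_letters s (fscale t) P" "hom_letters s s Q"
  shows "hom_letters s t (last_comp P Q)"
proof -
  have "last_comp P Q (u @ (s c x, y) # v) = t c (last_comp P Q (u @ (x, y) # v)) \<and>
      last_comp P Q (u @ (y, s c x) # v) = t c (last_comp P Q (u @ (y, x) # v))"
    if "add_values P" "hom_values s t P" "hom_letters s (fscale t) P" "hom_letters s s Q" for P Q and u v and x y c
    using that
  proof (induction u arbitrary: P Q)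
    case Nil
    have h: "Q [(s c x, y)] = s c (Q [(x, y)])" "Q [(y, s c x)] = s c (Q [(y, x)])" for x y
      using Nil(4) unfolding hom_letters_def by (metis append_Nil)+
    show ?case
    proof (cases "v = []")
      case True
      then show ?thesis using Nil by (simp add: h hom_values_def)
    next
      case False
      then show ?thesis using Nil assms
        by (simp add: last_comp_Cons shift_pair_scale[of s "fscale t" P] shift_pair_scale[of s s Q] last_comp_scale_left
          last_comp_scale_right[of t _ s] scale_add)
    qed
  next
    case (Cons Z u)
    then show ?case using assms by (simp add: last_comp_Cons vector_space_fscale scale_add)
  qed
  then show ?thesis using assms unfolding hom_letters_def[of s t "last_comp P Q"] by blast
qed

section \<open>The space of multilinear cochains and bilinearity of the product\<close>

lemma ml_sum_closed:
  "add_letters F \<Longrightarrow> add_letters G \<Longrightarrow> add_letters (F + G)"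
  "vector_space t \<Longrightarrow> hom_letters s t F \<Longrightarrow> hom_letters s t G \<Longrightarrow> hom_letters s t (F + G)"
  "alternating F' \<Longrightarrow> alternating G' \<Longrightarrow> alternating (F' + G' :: _ \<Rightarrow> 'v::ab_group_add)"
  "add_values P \<Longrightarrow> add_values Q \<Longrightarrow> add_values (P + Q)"
  "vector_space t' \<Longrightarrow> hom_values s' t' P' \<Longrightarrow> hom_values s' t' Q' \<Longrightarrow> hom_values s' t' (P' + Q')"
  by (simp_all add: add_letters_def hom_letters_def alternating_def add_values_def hom_values_def scale_add algebra_simps)

lemma ml_cochains_0: "vector_space t \<Longrightarrow> 0 \<in> ml_cochains s t"
  by (simp add: ml_cochains_def add_letters_def hom_letters_def alternating_def add_values_def hom_values_def fun_eq_iff)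

lemma ml_cochains_add: "vector_space t \<Longrightarrow> P \<in> ml_cochains s t \<Longrightarrow> Q \<in> ml_cochains s t \<Longrightarrow> P + Q \<in> ml_cochains s t"
  unfolding ml_cochains_def by (simp add: ml_sum_closed vector_space_fscale)

lemma ml_cochains_scale:
  assumes t: "vector_space t" and P: "P \<in> ml_cochains s t"
  shows "cochain_scale t c P \<in> ml_cochains s t"
proof -
  interpret vector_space t by (rule t)
  show ?thesis using ml_cochainsD[OF P] 
    by (simp add: ml_cochains_def cochain_scale_def add_letters_def hom_letters_def alternating_def add_values_def hom_values_def
      scale_right_distrib fun_eq_iff mult.commute)
qed

lemma cochain_scale_m1: "vector_space t \<Longrightarrow> cochain_scale t (- 1) P = - P"
proof -
  assume "vector_space t"
  then interpret vector_space t .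
  show ?thesis by (simp add: cochain_scale_def prod_eq_iff fun_eq_iff)
qed

lemma ml_cochains_minus: "vector_space t \<Longrightarrow> P \<in> ml_cochains s t \<Longrightarrow> - P \<in> ml_cochains s t"
  by (metis cochain_scale_m1 ml_cochains_scale)

lemma ml_cochains_psign: "vector_space t \<Longrightarrow> P \<in> ml_cochains s t \<Longrightarrow> psign n P \<in> ml_cochains s t"
  by (simp add: psign_def ml_cochains_minus)

lemma ml_cochains_diff: "vector_space t \<Longrightarrow> P \<in> ml_cochains s t \<Longrightarrow> Q \<in> ml_cochains s t \<Longrightarrow> P - Q \<in> ml_cochains s t"
  by (metis diff_conv_add_uminus ml_cochains_add ml_cochains_minus)

lemma ml_cochains_sum: "vector_space t \<Longrightarrow> (\<And>i. i \<in> A \<Longrightarrow> f i \<in> ml_cochains s t) \<Longrightarrow> (\<Sum>i\<in>A. f i) \<in> ml_cochains s t"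
  by (induction A rule: infinite_finite_induct) (auto intro: ml_cochains_0 ml_cochains_add)

text \<open>Every condition compares values at words of one length, so the pieces may be chosen
  separately for each length.\<close>

lemma ml_cochains_glue:
  assumes "\<And>n. B n \<in> ml_cochains s t"
  shows "(\<lambda>w. fst (B (length w)) w, \<lambda>w. snd (B (length w)) w) \<in> ml_cochains s t"
  using ml_cochainsD[OF assms]
  by (simp add: ml_cochains_def add_letters_def hom_letters_def alternating_def add_values_def hom_values_def fun_eq_iff)

lemma circ_II_hom_values:
  assumes s: "vector_space s" and "add_values P" "hom_values s s P" "add_letters P" "hom_values s s Q"
  shows "hom_values s s (circ_II P Q)"
proof -
  have "shuffle_comp P Q w (s c x) = s c (shuffle_comp P Q w x)" for w c x
    using assms by (simp add: shuffle_comp_shuffle_sum hom_values_def shuffle_sum_map[of "s c"] scale_add)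
  moreover have "insertion P Q w (s c x) = s c (insertion P Q w x)" for w c x
    using assms insertion_scale_left[OF s add_letters_apply[OF assms(4), of x], of c Q w]
    by (simp add: insertion_apply[of P] hom_values_def)
  ultimately show ?thesis using s by (simp add: hom_values_def circ_II_def scale_add)
qed

lemma ml_cochains_circ:
  assumes s: "vector_space s" and P: "P \<in> ml_cochains s s" and Q: "Q \<in> ml_cochains s s"
  shows "circ P Q \<in> ml_cochains s s"
proof -
  note P = ml_cochainsD[OF P] and Q = ml_cochainsD[OF Q]
  note f = vector_space_fscale[OF s]
  show ?thesis unfolding ml_cochains_def mem_Collect_eq circ_def fst_conv snd_conv circ_II_def
    using P Q s f
    by (intro conjI ml_sum_closed add_letters_last_comp add_letters_insertion hom_letters_last_comp hom_letters_insertion alternating_last_comp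
      alternating_insertion add_letters_shuffle_comp hom_letters_shuffle_comp alternating_shuffle_comp add_values_shuffle_comp add_values_insertion
      circ_II_hom_values[unfolded circ_II_def]) simp_all
qed

lemma circ_add_left: "circ (P + P') Q = circ P Q + circ P' Q"
  by (simp add: circ_def circ_II_def fun_eq_iff shuffle_comp_add_left last_comp_add_left insertion_add_left)

lemma circ_add_right: "P \<in> ml_cochains s t \<Longrightarrow> circ P (Q + Q') = circ P Q + circ P Q'"
  using ml_cochainsD(2,5,8)[of P s t]
  by (simp add: circ_def circ_II_def fun_eq_iff shuffle_comp_add_right last_comp_add_right insertion_add_right)

lemma circ_0_left [simp]: "circ 0 Q = 0"
  using circ_add_left[of 0 0 Q] by simp

lemma circ_0_right: "P \<in> ml_cochains s t \<Longrightarrow> circ P 0 = 0"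
  using circ_add_right[of P s t 0 0] by simp

lemma circ_minus_left: "circ (- P) Q = - circ P Q"
  by (intro minus_unique[symmetric]) (simp flip: circ_add_left)

lemma circ_minus_right: "P \<in> ml_cochains s t \<Longrightarrow> circ P (- Q) = - circ P Q"
  by (intro minus_unique[symmetric]) (simp add: circ_0_right flip: circ_add_right)

lemma circ_diff_left: "circ (P - P') Q = circ P Q - circ P' Q"
  unfolding diff_conv_add_uminus circ_add_left circ_minus_left ..

lemma circ_diff_right: "P \<in> ml_cochains s t \<Longrightarrow> circ P (Q - Q') = circ P Q - circ P Q'"
  unfolding diff_conv_add_uminus by (simp only: circ_add_right circ_minus_right)

lemma circ_psign_left: "circ (psign n P) Q = psign n (circ P Q)"
  by (simp add: psign_def circ_minus_left)

lemma circ_psign_right: "P \<in> ml_cochains s t \<Longrightarrow> circ P (psign n Q) = psign n (circ P Q)"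
  by (simp add: psign_def circ_minus_right)

lemma circ_scale_left:
  assumes s: "vector_space s" and P: "P \<in> ml_cochains s s"
  shows "circ (cochain_scale s c P) Q = cochain_scale s c (circ P Q)"
  using ml_cochainsD[OF P] s insertion_scale_left[OF s add_letters_apply[OF ml_cochainsD(5)[OF P]]]
  by (simp add: circ_def circ_II_def cochain_scale_def fun_eq_iff shuffle_comp_scale_left last_comp_scale_left insertion_scale_left
      scale_add insertion_apply[of "snd P"] insertion_apply[of "\<lambda>v x. s c (snd P v x)"])

lemma circ_scale_right:
  assumes s: "vector_space s" and P: "P \<in> ml_cochains s s"
  shows "circ P (cochain_scale s c Q) = cochain_scale s c (circ P Q)"
  using ml_cochainsD[OF P] s
  by (simp add: circ_def circ_II_def cochain_scale_def fun_eq_iff shuffle_comp_scale_right last_comp_scale_right[of s "snd P" s] insertion_scale_right[of s _ s]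
      scale_add insertion_scale_right[of "fscale s" _ s] vector_space_fscale)

lemma supp_in_parity:
  assumes "supp_in p P"
  shows "parity (int p) (fst P)" "parity (int p) (snd P)"
  using assms by (auto simp: supp_in_def parity_def)

text \<open>The right pre-Lie identity, assembled from its two components. \<open>P\<close> and
  \<open>Q\<close> have degrees because they are the elements that change places.\<close>

lemma circ_assoc_sym:
  assumes "F \<in> ml_cochains s s" "P \<in> ml_cochains s s" "Q \<in> ml_cochains s s" "supp_in p P" "supp_in q Q"
  shows "circ (circ F P) Q - circ F (circ P Q) = psign (int p * int q) (circ (circ F Q) P - circ F (circ Q P))"
proof -
  note F = ml_cochainsD[OF assms(1)] and P = ml_cochainsD[OF assms(2)] and Q = ml_cochainsD[OF assms(3)]
  note p = supp_in_parity[OF assms(4)] and q = supp_in_parity[OF assms(5)]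
  have ps: "psign n (a, b) = (psign n a, psign n b)" for n and a :: "'c::ab_group_add" and b :: "'d::ab_group_add"
    by (simp add: psign_def)
  have "circ_II (circ_II (snd F) (snd P)) (snd Q) - circ_II (snd F) (circ_II (snd P) (snd Q)) =
    psign (int p * int q) (circ_II (circ_II (snd F) (snd Q)) (snd P) - circ_II (snd F) (circ_II (snd Q) (snd P)))"
    using F P Q p q by (intro shuffle_comp_circ_II)
  then show ?thesis
    unfolding circ_def fst_conv snd_conv diff_Pair ps prod.inject
    using last_comp_circ_II[OF F(2) P(2) Q(2) p(1) q(1) F(5) P(5) Q(5) F(8) P(8) Q(8) p(2) q(2)] by blast
qed

section \<open>The bracket of inhomogeneous cochains\<close>

definition restrict_degree :: "nat \<Rightarrow> ('w, 'v::ab_group_add) cochain \<Rightarrow> ('w, 'v) cochain" where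
  "restrict_degree n P = (\<lambda>w. if length w = n then fst P w else 0, \<lambda>w. if length w = n then snd P w else 0)"

lemma restrict_degree_ml_cochains: "vector_space t \<Longrightarrow> P \<in> ml_cochains s t \<Longrightarrow> restrict_degree n P \<in> ml_cochains s t"
  unfolding ml_cochains_def mem_Collect_eq
  by (simp add: restrict_degree_def add_letters_def hom_letters_def alternating_def add_values_def hom_values_def)
    (simp add: fun_eq_iff)

lemma supp_in_restrict_degree: "supp_in n (restrict_degree n P)"
  by (simp add: supp_in_def restrict_degree_def)

lemma restrict_degree_supp_in: "supp_in n P \<Longrightarrow> restrict_degree n P = P"
  by (auto simp: supp_in_def restrict_degree_def prod_eq_iff fun_eq_iff)

lemma restrict_degree_add: "restrict_degree n (P + Q) = restrict_degree n P + restrict_degree n Q"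
  by (simp add: restrict_degree_def prod_eq_iff fun_eq_iff)

lemma restrict_degree_scale: "vector_space t \<Longrightarrow> restrict_degree n (cochain_scale t c P) = cochain_scale t c (restrict_degree n P)"
  by (simp add: restrict_degree_def cochain_scale_def prod_eq_iff fun_eq_iff)

lemma restrict_degree_cochains:
  "vector_space s \<Longrightarrow> vector_space t \<Longrightarrow> P \<in> ml_cochains s t \<Longrightarrow> restrict_degree n P \<in> cochains s t n"
  by (simp add: cochains_iff restrict_degree_ml_cochains supp_in_restrict_degree)

lemma ly_insertions_cong:
  assumes "\<And>w. length w = p \<Longrightarrow> F w = F' w" "\<And>w. length w = q \<Longrightarrow> G w = G' w" "length Xs = p + q"
  shows "ly_insertions s p q F G Xs = ly_insertions s p q F' G' Xs"
proof -
  have *: "F (perm_sublist \<sigma> Xs 1 (k - 1) @ [Z] @ drop (k + q) Xs) = F' (perm_sublist \<sigma> Xs 1 (k - 1) @ [Z] @ drop (k + q) Xs)"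
    "G (perm_sublist \<sigma> Xs k (k + q - 1)) = G' (perm_sublist \<sigma> Xs k (k + q - 1))"
    if "k \<in> {1..p}" for k \<sigma> Z
    using that assms(3) by (auto intro!: assms(1,2))
  show ?thesis unfolding ly_insertions_def using * by (simp only: cong: sum.cong)
qed

text \<open>For declared degrees \<open>p\<close> and \<open>q\<close> the formula evaluates its
  arguments only at words of these lengths.\<close>

lemma ly_diamond_restrict_degree: "ly_diamond s p q P Q = ly_diamond s p q (restrict_degree p P) (restrict_degree q Q)"
proof -
  have 1: "ly_insertions s p q (fst P) (snd Q) Xs = ly_insertions s p q (fst (restrict_degree p P)) (snd (restrict_degree q Q)) Xs"
    "ly_insertions s p q (\<lambda>Ys. snd P Ys x) (snd Q) Xs = ly_insertions s p q (\<lambda>Ys. snd (restrict_degree p P) Ys x) (snd (restrict_degree q Q)) Xs"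
    if "length Xs = p + q" for Xs x
    using that by (intro ly_insertions_cong; simp add: restrict_degree_def)+
  show ?thesis
    unfolding ly_diamond_def
    by (intro prod_eqI ext; simp add: 1; simp add: restrict_degree_def)
qed

text \<open>A finite sum of products of homogeneous pieces, which \<open>ly_bracket\<close> reads
  off at words of length \<open>n\<close>. Bilinearity and closure are shown for it and then glued
  over all lengths.\<close>

definition bracket_part :: "nat \<Rightarrow> ('w::ab_group_add, 'w) cochain \<Rightarrow> ('w, 'w) cochain \<Rightarrow> ('w, 'w) cochain" where
  "bracket_part n P Q = (\<Sum>p\<le>n. circ (restrict_degree p P) (restrict_degree (n - p) Q) - psign (int p * int (n - p)) (circ (restrict_degree (n - p) Q) (restrict_degree p P)))"

lemma cochain_scale_m1_power: "vector_space t \<Longrightarrow> cochain_scale t ((- 1) ^ n) P = psign (int n) P"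
proof -
  assume "vector_space t"
  then interpret vector_space t .
  show ?thesis by (cases "even n") (simp_all add: cochain_scale_def prod_eq_iff fun_eq_iff)
qed

lemma ly_bracket_hom_circ:
  assumes s: "vector_space s" and "P \<in> ml_cochains s s" "Q \<in> ml_cochains s s"
  shows "ly_bracket_hom s p q P Q = circ (restrict_degree p P) (restrict_degree q Q) - psign (int p * int q) (circ (restrict_degree q Q) (restrict_degree p P))"
  using assms
  by (simp add: ly_bracket_hom_def ly_diamond_restrict_degree[of s p q P] ly_diamond_restrict_degree[of s q p Q] ly_diamond_circ restrict_degree_cochains
      cochain_scale_m1_power)

lemma fun_sum_apply: "(\<Sum>i\<in>A. f i) x = (\<Sum>i\<in>A. f i x :: 'b::ab_group_add)"
  by (induction A rule: infinite_finite_induct) simp_all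

lemma ly_bracket_bracket_part:
  assumes s: "vector_space s" and P: "P \<in> ml_cochains s s" and Q: "Q \<in> ml_cochains s s"
  shows "ly_bracket s P Q = (\<lambda>w. fst (bracket_part (length w) P Q) w, \<lambda>w. snd (bracket_part (length w) P Q) w)"
  by (simp add: ly_bracket_def ly_bracket_hom_circ[OF s P Q] bracket_part_def fst_sum snd_sum fun_sum_apply fun_eq_iff)

lemma bracket_part_ml_cochains:
  assumes s: "vector_space s" and P: "P \<in> ml_cochains s s" and Q: "Q \<in> ml_cochains s s"
  shows "bracket_part n P Q \<in> ml_cochains s s"
  unfolding bracket_part_def
  by (intro ml_cochains_sum ml_cochains_diff ml_cochains_psign ml_cochains_circ restrict_degree_ml_cochains s P Q)

lemma ly_bracket_ml_cochains:
  assumes s: "vector_space s" and P: "P \<in> ml_cochains s s" and Q: "Q \<in> ml_cochains s s"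
  shows "ly_bracket s P Q \<in> ml_cochains s s"
  unfolding ly_bracket_bracket_part[OF assms] by (intro ml_cochains_glue bracket_part_ml_cochains assms)

lemma bracket_part_add:
  assumes s: "vector_space s" and "P \<in> ml_cochains s s" "Q \<in> ml_cochains s s" "R \<in> ml_cochains s s"
  shows "bracket_part n (P + Q) R = bracket_part n P R + bracket_part n Q R"
    and "bracket_part n R (P + Q) = bracket_part n R P + bracket_part n R Q"
proof -
  note m = restrict_degree_ml_cochains[OF s assms(2)] restrict_degree_ml_cochains[OF s assms(3)] restrict_degree_ml_cochains[OF s assms(4)]
  show "bracket_part n (P + Q) R = bracket_part n P R + bracket_part n Q R"
    unfolding bracket_part_def sum.distrib[symmetric]
    by (intro sum.cong refl) (simp only: restrict_degree_add circ_add_left circ_add_right[OF m(3)] psign_add, simp)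
  show "bracket_part n R (P + Q) = bracket_part n R P + bracket_part n R Q"
    unfolding bracket_part_def sum.distrib[symmetric]
    by (intro sum.cong refl) (simp only: restrict_degree_add circ_add_left circ_add_right[OF m(3)] psign_add, simp)
qed

lemma cochain_scale_linear:
  assumes "vector_space t"
  shows "cochain_scale t c (P + Q) = cochain_scale t c P + cochain_scale t c Q"
    "cochain_scale t c (P - Q) = cochain_scale t c P - cochain_scale t c Q"
    "cochain_scale t c (psign n P) = psign n (cochain_scale t c P)"
    "cochain_scale t c (\<Sum>i\<in>A. f i) = (\<Sum>i\<in>A. cochain_scale t c (f i))"
    "cochain_scale t c 0 = 0"
proof -
  interpret vector_space t by (rule assms)
  have 1: "cochain_scale t c (P + Q) = cochain_scale t c P + cochain_scale t c Q" for P Q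
    by (simp add: cochain_scale_def prod_eq_iff fun_eq_iff scale_right_distrib)
  show "cochain_scale t c (P + Q) = cochain_scale t c P + cochain_scale t c Q" by (rule 1)
  show "cochain_scale t c (P - Q) = cochain_scale t c P - cochain_scale t c Q"
    "cochain_scale t c (psign n P) = psign n (cochain_scale t c P)"
    and 2: "cochain_scale t c 0 = 0"
    by (simp_all add: cochain_scale_def prod_eq_iff fun_eq_iff scale_right_distrib scale_right_diff_distrib psign_def)
  show "cochain_scale t c (\<Sum>i\<in>A. f i) = (\<Sum>i\<in>A. cochain_scale t c (f i))"
    by (induction A rule: infinite_finite_induct) (simp_all add: 1 2)
qed

lemma bracket_part_scale:
  assumes s: "vector_space s" and "P \<in> ml_cochains s s" "R \<in> ml_cochains s s"
  shows "bracket_part n (cochain_scale s c P) R = cochain_scale s c (bracket_part n P R)"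
    and "bracket_part n R (cochain_scale s c P) = cochain_scale s c (bracket_part n R P)"
proof -
  note m = restrict_degree_ml_cochains[OF s assms(2)] restrict_degree_ml_cochains[OF s assms(3)]
  show "bracket_part n (cochain_scale s c P) R = cochain_scale s c (bracket_part n P R)"
    "bracket_part n R (cochain_scale s c P) = cochain_scale s c (bracket_part n R P)"
    unfolding bracket_part_def cochain_scale_linear[OF s]
    by (simp_all only: restrict_degree_scale[OF s] circ_scale_left[OF s m(1)] circ_scale_left[OF s m(2)]
       circ_scale_right[OF s m(1)] circ_scale_right[OF s m(2)])
qed

lemma ly_bracket_add:
  assumes s: "vector_space s" and "P \<in> ml_cochains s s" "Q \<in> ml_cochains s s" "R \<in> ml_cochains s s"
  shows "ly_bracket s (P + Q) R = ly_bracket s P R + ly_bracket s Q R"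
    and "ly_bracket s R (P + Q) = ly_bracket s R P + ly_bracket s R Q"
  using assms
  by (simp_all add: ly_bracket_bracket_part ml_cochains_add bracket_part_add prod_eq_iff fun_eq_iff)

lemma ly_bracket_scale:
  assumes s: "vector_space s" and "P \<in> ml_cochains s s" "R \<in> ml_cochains s s"
  shows "ly_bracket s (cochain_scale s c P) R = cochain_scale s c (ly_bracket s P R)"
    and "ly_bracket s R (cochain_scale s c P) = cochain_scale s c (ly_bracket s R P)"
  using assms
  by (simp_all add: ly_bracket_bracket_part ml_cochains_scale bracket_part_scale prod_eq_iff fun_eq_iff)
    (simp_all add: cochain_scale_def)

lemma ly_bracket_0:
  assumes s: "vector_space s" and "P \<in> ml_cochains s s"
  shows "ly_bracket s 0 P = 0" "ly_bracket s P 0 = 0"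
  using ly_bracket_add[OF s ml_cochains_0[OF s] ml_cochains_0[OF s] assms(2)] by simp_all

section \<open>Graded antisymmetry and the graded Jacobi identity\<close>

lemma cochain_grading_cases:
  assumes "P \<in> cochain_grading s t n"
  obtains "P = 0" | m where "n = int m" "P \<in> cochains s t m"
  using assms that(1) that(2)[of "nat n"] unfolding cochain_grading_def by (cases "n < 0") auto

lemma cochains_0: "vector_space s \<Longrightarrow> vector_space t \<Longrightarrow> 0 \<in> cochains s t n"
  by (simp add: cochains_iff ml_cochains_0 supp_in_def)

lemma cochain_grading_0: "vector_space s \<Longrightarrow> vector_space t \<Longrightarrow> 0 \<in> cochain_grading s t n"
  by (simp add: cochain_grading_def cochains_0)

lemma cochain_grading_ml_cochains:
  "vector_space s \<Longrightarrow> vector_space t \<Longrightarrow> P \<in> cochain_grading s t n \<Longrightarrow> P \<in> ml_cochains s t"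
  by (erule cochain_grading_cases) (auto simp: cochains_iff ml_cochains_0)

lemma ly_bracket_circ:
  assumes s: "vector_space s" and "P \<in> cochains s s p" "Q \<in> cochains s s q"
  shows "ly_bracket s P Q = circ P Q - psign (int p * int q) (circ Q P)"
  unfolding ly_bracket_homogeneous[OF assms(2,3)]
  using assms(2,3) by (simp add: ly_bracket_hom_circ[OF s] cochains_iff[OF s s] restrict_degree_supp_in)

lemma ly_bracket_cochains:
  assumes s: "vector_space s" and P: "P \<in> cochains s s p" and Q: "Q \<in> cochains s s q"
  shows "ly_bracket s P Q \<in> cochains s s (p + q)"
proof -
  have "supp_in (p + q) (ly_bracket s P Q)"
    using s unfolding ly_bracket_homogeneous[OF P Q]
    by (simp add: ly_bracket_hom_def ly_diamond_def cochain_scale_def supp_in_def fun_eq_iff)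
  then show ?thesis using assms by (simp add: cochains_iff ly_bracket_ml_cochains)
qed

lemma ly_bracket_grading:
  assumes s: "vector_space s" and P: "P \<in> cochain_grading s s p" and Q: "Q \<in> cochain_grading s s q"
  shows "ly_bracket s P Q \<in> cochain_grading s s (p + q)"
proof (cases "P = 0 \<or> Q = 0")
  case True
  then show ?thesis
    using ly_bracket_0[OF s cochain_grading_ml_cochains[OF s s P]] ly_bracket_0[OF s cochain_grading_ml_cochains[OF s s Q]]
      cochain_grading_0[OF s s] by fastforce
next
  case False
  then obtain m n where "p = int m" "P \<in> cochains s s m" "q = int n" "Q \<in> cochains s s n"
    using P Q by (metis cochain_grading_cases)
  then show ?thesis using ly_bracket_cochains[OF s, of P m Q n]
    by (simp add: cochain_grading_def flip: of_nat_add)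
qed

lemma ly_bracket_antisym:
  assumes s: "vector_space s" and P: "P \<in> cochain_grading s s p" and Q: "Q \<in> cochain_grading s s q"
  shows "ly_bracket s P Q = - psign (p * q) (ly_bracket s Q P)"
proof (cases "P = 0 \<or> Q = 0")
  case True
  then show ?thesis
    using ly_bracket_0[OF s cochain_grading_ml_cochains[OF s s P]] ly_bracket_0[OF s cochain_grading_ml_cochains[OF s s Q]]
    by auto
next
  case False
  then obtain m n where "p = int m" "P \<in> cochains s s m" "q = int n" "Q \<in> cochains s s n"
    using P Q by (metis cochain_grading_cases)
  then show ?thesis using ly_bracket_circ[OF s, of P m Q n] ly_bracket_circ[OF s, of Q n P m]
    by (simp add: psign_diff mult.commute)
qed

text \<open>The graded commutator of a pre-Lie product is a Lie bracket. Zero elements are split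
  off, so that the remaining degrees are natural numbers.\<close>

lemma ly_bracket_jacobi:
  assumes s: "vector_space s" and P: "P \<in> cochain_grading s s p" and Q: "Q \<in> cochain_grading s s q"
    and R: "R \<in> cochain_grading s s r"
  shows "ly_bracket s (ly_bracket s P Q) R =
    ly_bracket s P (ly_bracket s Q R) + psign (q * r) (ly_bracket s (ly_bracket s P R) Q)"
proof (cases "P = 0 \<or> Q = 0 \<or> R = 0")
  case True
  have m: "P \<in> ml_cochains s s" "Q \<in> ml_cochains s s" "R \<in> ml_cochains s s"
    using assms cochain_grading_ml_cochains[OF s s] by blast+
  show ?thesis
    using True ly_bracket_0[OF s m(1)] ly_bracket_0[OF s m(2)] ly_bracket_0[OF s m(3)]
      ly_bracket_0[OF s ly_bracket_ml_cochains[OF s m(2,3)]] ly_bracket_0[OF s ly_bracket_ml_cochains[OF s m(1,3)]]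
      ly_bracket_0[OF s ly_bracket_ml_cochains[OF s m(1,2)]] by auto
next
  case False
  then obtain k m n where d: "p = int k" "P \<in> cochains s s k" "q = int m" "Q \<in> cochains s s m"
      "r = int n" "R \<in> cochains s s n"
    using P Q R by (metis cochain_grading_cases)
  have M: "P \<in> ml_cochains s s" "Q \<in> ml_cochains s s" "R \<in> ml_cochains s s"
    and S: "supp_in k P" "supp_in m Q" "supp_in n R"
    using d by (simp_all add: cochains_iff s)
  have b: "ly_bracket s P Q \<in> cochains s s (k + m)" "ly_bracket s Q R \<in> cochains s s (m + n)"
      "ly_bracket s P R \<in> cochains s s (k + n)"
    using d by (auto intro: ly_bracket_cochains s)
  \<comment> \<open>The pre-Lie identity is used three times, with each of the elements once in the
    leftmost position.\<close>
  have 1: "circ (circ P Q) R = circ P (circ Q R) + psign (int m * int n) (circ (circ P R) Q - circ P (circ R Q))"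
    using circ_assoc_sym[OF M(1) M(2) M(3) S(2) S(3)] by (simp add: algebra_simps)
  have 2: "circ (circ Q P) R = circ Q (circ P R) + psign (int k * int n) (circ (circ Q R) P - circ Q (circ R P))"
    using circ_assoc_sym[OF M(2) M(1) M(3) S(1) S(3)] by (simp add: algebra_simps)
  have 3: "circ (circ R P) Q = circ R (circ P Q) + psign (int k * int m) (circ (circ R Q) P - circ R (circ Q P))"
    using circ_assoc_sym[OF M(3) M(1) M(2) S(1) S(2)] by (simp add: algebra_simps)
  show ?thesis
    unfolding d ly_bracket_circ[OF s b(1) d(6)] ly_bracket_circ[OF s d(2) b(2)] ly_bracket_circ[OF s b(3) d(4)]
    unfolding ly_bracket_circ[OF s d(2) d(4)] ly_bracket_circ[OF s d(4) d(6)] ly_bracket_circ[OF s d(2) d(6)]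
      circ_diff_left circ_diff_right[OF M(1)] circ_diff_right[OF M(2)] circ_diff_right[OF M(3)]
      circ_psign_left circ_psign_right[OF M(1)] circ_psign_right[OF M(2)] circ_psign_right[OF M(3)] 1 2 3
    by (cases "even k"; cases "even m"; cases "even n") (simp_all add: algebra_simps)
qed

section \<open>Higher derived brackets\<close>

text \<open>Voronov's data, detached from cochains. That the kernel of the projection is a
  subalgebra is encoded in \<open>prj_br\<close>: it results from expanding the vanishing projection
  of the bracket of \<open>X - emb (prj X)\<close> and \<open>Y - emb (prj Y)\<close> and dropping
  the bracket of the two embedded parts, which is zero. \<open>M\<close> is an ambient space on
  which the bracket is bilinear; it contains the sums of homogeneous elements.\<close>

locale derived_setting =
  L: vector_space sL + A: graded_vector_space sA GA
  for sL :: "'k::field_char_0 \<Rightarrow> 'l::ab_group_add \<Rightarrow> 'l"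
    and sA :: "'k \<Rightarrow> 'a::ab_group_add \<Rightarrow> 'a" and GA :: "int \<Rightarrow> 'a set" +
  fixes GL :: "int \<Rightarrow> 'l set" and M :: "'l set" and br :: "'l \<Rightarrow> 'l \<Rightarrow> 'l"
    and emb :: "'a \<Rightarrow> 'l" and prj :: "'l \<Rightarrow> 'a"
  assumes M_subspace: "L.subspace M"
    and GL_subspace: "L.subspace (GL n)"
    and GL_M: "GL n \<subseteq> M"
    and br_M: "X \<in> M \<Longrightarrow> Y \<in> M \<Longrightarrow> br X Y \<in> M"
    and br_add_left: "X \<in> M \<Longrightarrow> Y \<in> M \<Longrightarrow> Z \<in> M \<Longrightarrow> br (X + Y) Z = br X Z + br Y Z"
    and br_add_right: "X \<in> M \<Longrightarrow> Y \<in> M \<Longrightarrow> Z \<in> M \<Longrightarrow> br Z (X + Y) = br Z X + br Z Y"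
    and br_scale_left: "X \<in> M \<Longrightarrow> Z \<in> M \<Longrightarrow> br (sL c X) Z = sL c (br X Z)"
    and br_scale_right: "X \<in> M \<Longrightarrow> Z \<in> M \<Longrightarrow> br Z (sL c X) = sL c (br Z X)"
    and br_GL: "X \<in> GL m \<Longrightarrow> Y \<in> GL n \<Longrightarrow> br X Y \<in> GL (m + n)"
    and br_antisym: "X \<in> GL m \<Longrightarrow> Y \<in> GL n \<Longrightarrow> br X Y = - psign (m * n) (br Y X)"
    and br_jacobi: "X \<in> GL m \<Longrightarrow> Y \<in> GL n \<Longrightarrow> Z \<in> GL k \<Longrightarrow>
      br (br X Y) Z = br X (br Y Z) + psign (n * k) (br (br X Z) Y)"
    and emb_linear: "Vector_Spaces.linear sA sL emb"
    and prj_linear: "Vector_Spaces.linear sL sA prj"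
    and emb_GL: "u \<in> GA n \<Longrightarrow> emb u \<in> GL n"
    and prj_GA: "X \<in> GL n \<Longrightarrow> prj X \<in> GA n"
    and emb_abelian: "u \<in> GA m \<Longrightarrow> v \<in> GA n \<Longrightarrow> br (emb u) (emb v) = 0"
    and prj_br: "X \<in> GL m \<Longrightarrow> Y \<in> GL n \<Longrightarrow>
      prj (br X Y) = prj (br (emb (prj X)) Y) + prj (br X (emb (prj Y)))"
begin

sublocale emb: Vector_Spaces.linear sA sL emb by (rule emb_linear)
sublocale prj: Vector_Spaces.linear sL sA prj by (rule prj_linear)

lemma GL_in_M: "X \<in> GL n \<Longrightarrow> X \<in> M"
  using GL_M by blast

lemma emb_M: "u \<in> GA n \<Longrightarrow> emb u \<in> M"
  by (rule GL_in_M[OF emb_GL])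

lemma M_closed: "0 \<in> M" "X \<in> M \<Longrightarrow> Y \<in> M \<Longrightarrow> X + Y \<in> M" "X \<in> M \<Longrightarrow> sL c X \<in> M" "X \<in> M \<Longrightarrow> psign n X \<in> M"
  using M_subspace by (auto simp: L.subspace_0 L.subspace_add L.subspace_scale L.subspace_neg psign_def)

lemma GL_closed: "0 \<in> GL n" "X \<in> GL n \<Longrightarrow> Y \<in> GL n \<Longrightarrow> X + Y \<in> GL n" "X \<in> GL n \<Longrightarrow> sL c X \<in> GL n"
  "X \<in> GL n \<Longrightarrow> psign k X \<in> GL n"
  using GL_subspace by (auto simp: L.subspace_0 L.subspace_add L.subspace_scale L.subspace_neg psign_def)

lemma br_0: "Z \<in> M \<Longrightarrow> br 0 Z = 0" "Z \<in> M \<Longrightarrow> br Z 0 = 0"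
  using br_add_left[OF M_closed(1) M_closed(1)] br_add_right[OF M_closed(1) M_closed(1)] by auto

lemma br_minus_left: "X \<in> M \<Longrightarrow> Z \<in> M \<Longrightarrow> br (- X) Z = - br X Z"
  using br_scale_left[of X Z "- 1"] by simp

lemma br_psign_left: "X \<in> M \<Longrightarrow> Z \<in> M \<Longrightarrow> br (psign n X) Z = psign n (br X Z)"
  by (simp add: psign_def br_minus_left)

definition iterate :: "'l \<Rightarrow> 'a list \<Rightarrow> 'l" where
  "iterate X vs = foldl (\<lambda>X v. br X (emb v)) X vs"

lemma iterate_simps [simp]: "iterate X [] = X" "iterate X (v # vs) = iterate (br X (emb v)) vs"
  by (simp_all add: iterate_def)

abbreviation homogeneous_list :: "('a \<times> int) list \<Rightarrow> bool" where
  "homogeneous_list xs \<equiv> (\<forall>(v, d)\<in>set xs. v \<in> GA d)"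

abbreviation total_degree :: "('a \<times> int) list \<Rightarrow> int" where
  "total_degree xs \<equiv> sum_list (map snd xs)"

lemma iterate_add: "X \<in> M \<Longrightarrow> Y \<in> M \<Longrightarrow> emb ` set vs \<subseteq> M \<Longrightarrow> iterate (X + Y) vs = iterate X vs + iterate Y vs"
  by (induction vs arbitrary: X Y) (auto simp: br_add_left br_M)

lemma iterate_scale: "X \<in> M \<Longrightarrow> emb ` set vs \<subseteq> M \<Longrightarrow> iterate (sL c X) vs = sL c (iterate X vs)"
  by (induction vs arbitrary: X) (auto simp: br_scale_left br_M)

lemma iterate_psign: "X \<in> M \<Longrightarrow> emb ` set vs \<subseteq> M \<Longrightarrow> iterate (psign n X) vs = psign n (iterate X vs)"
  by (induction vs arbitrary: X) (auto simp: br_psign_left br_M)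

lemma iterate_0: "emb ` set vs \<subseteq> M \<Longrightarrow> iterate 0 vs = 0"
  by (induction vs) (auto simp: br_0)

lemma homogeneous_list_M: "homogeneous_list xs \<Longrightarrow> emb ` set (map fst xs) \<subseteq> M"
  using emb_M by fastforce

lemma iterate_GL: "X \<in> GL p \<Longrightarrow> homogeneous_list xs \<Longrightarrow> iterate X (map fst xs) \<in> GL (p + total_degree xs)"
proof (induction xs arbitrary: X p)
  case (Cons x xs)
  obtain v d where x: "x = (v, d)" by (cases x)
  have "br X (emb v) \<in> GL (p + d)" using Cons.prems by (auto simp: x intro: br_GL emb_GL)
  from Cons.IH[OF this] show ?case using Cons.prems by (simp add: x add.assoc)
qed simp

text \<open>The Jacobi identity, in which the bracket of the two elements of the abelian subalgebra
  is zero.\<close>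

lemma br_emb_swap:
  assumes "X \<in> GL p" "u \<in> GA m" "v \<in> GA n"
  shows "br (br X (emb u)) (emb v) = psign (m * n) (br (br X (emb v)) (emb u))"
  using br_jacobi[OF assms(1) emb_GL[OF assms(2)] emb_GL[OF assms(3)]] emb_abelian[OF assms(2,3)]
  by (simp add: br_0 GL_in_M[OF assms(1)])

text \<open>By repeated exchange of neighbours the first argument travels to the end.\<close>

lemma iterate_br_emb:
  "X \<in> GL p \<Longrightarrow> u \<in> GA m \<Longrightarrow> homogeneous_list xs \<Longrightarrow>
    iterate (br X (emb u)) (map fst xs) = psign (m * total_degree xs) (br (iterate X (map fst xs)) (emb u))"
proof (induction xs arbitrary: X p)
  case (Cons x xs)
  obtain v d where x: "x = (v, d)" by (cases x)
  have v: "v \<in> GA d" and h: "homogeneous_list xs" using Cons.prems by (auto simp: x)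
  have X: "br X (emb v) \<in> GL (p + d)" using Cons.prems v by (auto intro: br_GL emb_GL)
  have "iterate (br X (emb u)) (map fst (x # xs)) = iterate (psign (m * d) (br (br X (emb v)) (emb u))) (map fst xs)"
    using br_emb_swap[OF Cons.prems(1,2) v] by (simp add: x)
  also have "\<dots> = psign (m * d) (iterate (br (br X (emb v)) (emb u)) (map fst xs))"
    by (intro iterate_psign homogeneous_list_M h br_M GL_in_M[OF X] emb_M[OF Cons.prems(2)])
  finally show ?case using Cons.IH[OF X Cons.prems(2) h] by (simp add: x algebra_simps)
qed simp

text \<open>Bracketing with \<open>emb v\<close> is a graded derivation. The elements that act on
  \<open>X\<close> have to pass \<open>Y\<close>, of degree \<open>q\<close>; reordering among the
  elements themselves is the business of the Koszul sum.\<close>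

lemma iterate_br:
  "X \<in> GL p \<Longrightarrow> Y \<in> GL q \<Longrightarrow> homogeneous_list xs \<Longrightarrow>
    iterate (br X Y) (map fst xs) =
    koszul_sum snd (\<lambda>S T. psign (q * total_degree S) (br (iterate X (map fst S)) (iterate Y (map fst T)))) xs"
proof (induction xs arbitrary: X Y p q)
  case (Cons x xs)
  obtain v d where x: "x = (v, d)" by (cases x)
  have v: "v \<in> GA d" and h: "homogeneous_list xs" using Cons.prems by (auto simp: x)
  have X: "br X (emb v) \<in> GL (p + d)" and Y: "br Y (emb v) \<in> GL (q + d)"
    using Cons.prems v by (auto intro: br_GL emb_GL)
  have M: "X \<in> M" "Y \<in> M" "emb v \<in> M"
    using Cons.prems v by (auto intro: GL_in_M emb_M)
  have "iterate (br X Y) (map fst (x # xs)) = iterate (br X (br Y (emb v)) + psign (q * d) (br (br X (emb v)) Y)) (map fst xs)"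
    using br_jacobi[OF Cons.prems(1,2) emb_GL[OF v]] by (simp add: x)
  also have "\<dots> = iterate (br X (br Y (emb v))) (map fst xs) + psign (q * d) (iterate (br (br X (emb v)) Y) (map fst xs))"
    by (subst iterate_add; (subst iterate_psign)?; intro homogeneous_list_M h br_M M M_closed refl)
  also have "\<dots> = koszul_sum snd (\<lambda>S T. psign ((q + d) * total_degree S) (br (iterate X (map fst S)) (iterate (br Y (emb v)) (map fst T)))) xs
     + koszul_sum snd (\<lambda>S T. psign (q * d) (psign (q * total_degree S) (br (iterate (br X (emb v)) (map fst S)) (iterate Y (map fst T))))) xs"
    unfolding Cons.IH[OF Cons.prems(1) Y h] Cons.IH[OF X Cons.prems(2) h] koszul_sum_psign ..
  finally show ?case by (simp add: x algebra_simps)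
qed simp

text \<open>
  Expand \<open>0 = prj [\<dots>[[\<Theta>,\<Theta>],v\<^sub>1],\<dots>,v\<^sub>N]\<close> by the derivation property and split each term
  \<open>prj [\<Theta>\<^sub>S,\<Theta>\<^sub>T]\<close> by \<open>prj_br\<close>: both halves are equal to the sum in question.
\<close>

theorem derived_bracket_jacobi:
  assumes T: "\<Theta> \<in> GL 1" "br \<Theta> \<Theta> = 0" "prj \<Theta> = 0" and h: "homogeneous_list xs"
  shows "koszul_sum snd (\<lambda>S T. if S = [] then 0 else
     prj (iterate \<Theta> (prj (iterate \<Theta> (map fst S)) # map fst T))) xs = 0"
proof -
  let ?B = "\<lambda>S :: ('a \<times> int) list. iterate \<Theta> (map fst S)"
  \<comment> \<open>One of the two halves produced by \<open>prj_br\<close>; antisymmetry expresses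
    the other one through it.\<close>
  define a where "a S T = prj (br (emb (prj (?B S))) (?B T))" for S T :: "('a \<times> int) list"
  let ?J = "koszul_sum snd (\<lambda>S T. psign (total_degree S) (a S T)) xs"
  have sub: "homogeneous_list S" "homogeneous_list T" if "xs \<in> shuffles S T" for S T
    using h set_shuffles[OF that] by auto
  have G: "?B S \<in> GL (1 + total_degree S)" if "homogeneous_list S" for S using iterate_GL[OF T(1) that] .
  have b: "prj (br (?B S) (emb (prj (?B T)))) = - psign ((1 + total_degree S) * (1 + total_degree T)) (a T S)"
    if "homogeneous_list S" "homogeneous_list T" for S T
    unfolding a_def br_antisym[OF G[OF that(1)] emb_GL[OF prj_GA[OF G[OF that(2)]]]]
    by (simp add: psign_def prj.neg)
  have J: "koszul_sum snd (\<lambda>S T. if S = [] then 0 else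
     prj (iterate \<Theta> (prj (?B S) # map fst T))) xs = ?J"
  proof (rule koszul_sum_cong)
    fix S T assume "xs \<in> shuffles S T"
    note s = sub[OF this]
    have "iterate \<Theta> (prj (?B S) # map fst T) = psign ((1 + total_degree S) * total_degree T) (br (?B T) (emb (prj (?B S))))"
      using iterate_br_emb[OF T(1) prj_GA[OF G[OF s(1)]] s(2)] by simp
    then have "prj (iterate \<Theta> (prj (?B S) # map fst T)) =
        psign ((1 + total_degree S) * total_degree T) (prj (br (?B T) (emb (prj (?B S)))))"
      by (simp only: psign_def prj.neg split: if_split) simp
    also have "\<dots> = psign ((1 + total_degree S) * total_degree T) (- psign ((1 + total_degree T) * (1 + total_degree S)) (a S T))"
      unfolding b[OF s(2,1)] ..
    also have "\<dots> = psign (total_degree S) (a S T)"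
      by (simp add: psign_def)
    finally have 1: "prj (iterate \<Theta> (prj (?B S) # map fst T)) = psign (total_degree S) (a S T)" .
    \<comment> \<open>The higher Jacobi identity has no term with empty \<open>S\<close>; adding it
      changes nothing, since it contains \<open>prj \<Theta>\<close>.\<close>
    have "a [] T = 0"
      using T(3) G[OF s(2)] by (simp add: a_def br_0 GL_in_M)
    then show "(if S = [] then 0 else prj (iterate \<Theta> (prj (?B S) # map fst T))) = psign (total_degree S) (a S T)"
      using 1 by auto
  qed
  have "0 = prj (iterate (br \<Theta> \<Theta>) (map fst xs))"
    using homogeneous_list_M[OF h] by (simp add: T(2) iterate_0)
  also have "\<dots> = koszul_sum snd (\<lambda>S T. prj (psign (1 * total_degree S) (br (?B S) (?B T)))) xs"
    unfolding iterate_br[OF T(1) T(1) h] by (rule koszul_sum_map) (rule prj.add)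
  also have "\<dots> = koszul_sum snd (\<lambda>S T. psign (total_degree S) (a S T)
      + psign (total_degree S) (- psign ((1 + total_degree S) * (1 + total_degree T)) (a T S))) xs"
  proof (rule koszul_sum_cong)
    fix S T assume "xs \<in> shuffles S T"
    note s = sub[OF this]
    have "prj (br (?B S) (?B T)) = a S T + - psign ((1 + total_degree S) * (1 + total_degree T)) (a T S)"
      using prj_br[OF G[OF s(1)] G[OF s(2)]] b[OF s] by (simp add: a_def)
    then show "prj (psign (1 * total_degree S) (br (?B S) (?B T))) = psign (total_degree S) (a S T)
      + psign (total_degree S) (- psign ((1 + total_degree S) * (1 + total_degree T)) (a T S))"
      by (simp add: psign_def prj.neg)
  qed
  also have "\<dots> = ?J + koszul_sum snd (\<lambda>S T. psign (total_degree S) (- psign ((1 + total_degree S) * (1 + total_degree T)) (a T S))) xs"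
    by (rule koszul_sum_add)
  \<comment> \<open>After \<open>S\<close> and \<open>T\<close> change places, all additional signs
    cancel and the second half agrees with the first.\<close>
  also have "koszul_sum snd (\<lambda>S T. psign (total_degree S) (- psign ((1 + total_degree S) * (1 + total_degree T)) (a T S))) xs = ?J"
    unfolding koszul_sum_swap[of snd "\<lambda>S T. psign (total_degree S) (- psign ((1 + total_degree S) * (1 + total_degree T)) (a T S))" xs]
    by (intro koszul_sum_cong) (simp add: psign_def)
  \<comment> \<open>The sum has been found twice, and 2 is invertible.\<close>
  finally have "sA 2 ?J = 0"
    using A.scale_left_distrib[of 1 1 ?J] by simp
  then have "?J = 0" by simp
  then show ?thesis using J by simp
qed

lemma direct_sum_M: "v \<in> A.direct_sum \<Longrightarrow> emb v \<in> M"
  unfolding A.direct_sum_def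
proof (induction rule: A.span_induct_alt)
  case (step c x y)
  then show ?case by (auto simp: emb.add emb.scale intro: M_closed emb_M)
qed (simp add: M_closed emb.zero)

lemma GA_direct_sum: "v \<in> GA d \<Longrightarrow> v \<in> A.direct_sum"
  unfolding A.direct_sum_def by (rule A.span_base) blast

lemma iterate_update_add:
  assumes "X \<in> M" "set vs \<subseteq> A.direct_sum" "i < length vs" "u \<in> A.direct_sum" "w \<in> A.direct_sum"
  shows "iterate X (vs[i := u + w]) = iterate X (vs[i := u]) + iterate X (vs[i := w])"
  using assms
proof (induction vs arbitrary: X i)
  case (Cons v vs)
  show ?case
  proof (cases i)
    case 0
    have m: "br X (emb u) \<in> M" "br X (emb w) \<in> M" "emb ` set vs \<subseteq> M"
      using Cons.prems direct_sum_M by (auto intro: br_M)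
    have "br X (emb (u + w)) = br X (emb u) + br X (emb w)"
      using Cons.prems direct_sum_M by (simp only: emb.add br_add_right)
    then show ?thesis using iterate_add[OF m] 0 by simp
  next
    case (Suc j)
    have "br X (emb v) \<in> M" using Cons.prems direct_sum_M by (intro br_M) auto
    from Cons.IH[OF this] show ?thesis using Cons.prems Suc by simp
  qed
qed simp

lemma iterate_update_scale:
  assumes "X \<in> M" "set vs \<subseteq> A.direct_sum" "i < length vs" "u \<in> A.direct_sum"
  shows "iterate X (vs[i := sA c u]) = sL c (iterate X (vs[i := u]))"
  using assms
proof (induction vs arbitrary: X i)
  case (Cons v vs)
  show ?case
  proof (cases i)
    case 0
    have m: "br X (emb u) \<in> M" "emb ` set vs \<subseteq> M"
      using Cons.prems direct_sum_M by (auto intro: br_M)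
    have "br X (emb (sA c u)) = sL c (br X (emb u))"
      using Cons.prems direct_sum_M by (simp only: emb.scale br_scale_right)
    then show ?thesis using iterate_scale[OF m] 0 by simp
  next
    case (Suc j)
    have "br X (emb v) \<in> M" using Cons.prems direct_sum_M by (intro br_M) auto
    from Cons.IH[OF this] show ?thesis using Cons.prems Suc by simp
  qed
qed simp

text \<open>The exponential series of \<open>[_, r]\<close> at \<open>\<Theta>\<close>; its later terms vanish in \<open>twisted_setting\<close>.\<close>

definition exp_twist :: "'l \<Rightarrow> 'a \<Rightarrow> 'l" where
  "exp_twist \<Theta> r = \<Theta> + iterate \<Theta> [r] + sL (1 / 2) (iterate \<Theta> [r, r]) + sL (1 / 6) (iterate \<Theta> [r, r, r])"

end

section \<open>Graded symmetry for at most three arguments\<close>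

lemma permutes_2:
  assumes "\<sigma> permutes {1..2::nat}"
  shows "\<sigma> 1 = 1 \<and> \<sigma> 2 = 2 \<or> \<sigma> 1 = 2 \<and> \<sigma> 2 = 1"
proof -
  have e: "i \<in> {1..2} \<longleftrightarrow> i = 1 \<or> i = 2" for i :: nat by auto
  have "\<sigma> 1 = 1 \<or> \<sigma> 1 = 2" "\<sigma> 2 = 1 \<or> \<sigma> 2 = 2"
    using permutes_in_image[OF assms, of 1] permutes_in_image[OF assms, of 2] unfolding e by auto
  moreover have "\<sigma> 1 \<noteq> \<sigma> 2" using permutes_inj[OF assms] by (simp add: inj_eq)
  ultimately show ?thesis by auto
qed

lemma permutes_3:
  assumes "\<sigma> permutes {1..3::nat}"
  shows "(\<sigma> 1, \<sigma> 2, \<sigma> 3) \<in> {(1, 2, 3), (1, 3, 2), (2, 1, 3), (2, 3, 1), (3, 1, 2), (3, 2, 1)}"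
proof -
  have e: "i \<in> {1..3} \<longleftrightarrow> i = 1 \<or> i = 2 \<or> i = 3" for i :: nat by auto
  have "\<sigma> 1 = 1 \<or> \<sigma> 1 = 2 \<or> \<sigma> 1 = 3" "\<sigma> 2 = 1 \<or> \<sigma> 2 = 2 \<or> \<sigma> 2 = 3" "\<sigma> 3 = 1 \<or> \<sigma> 3 = 2 \<or> \<sigma> 3 = 3"
    using permutes_in_image[OF assms, of 1] permutes_in_image[OF assms, of 2] permutes_in_image[OF assms, of 3]
    unfolding e by auto
  moreover have "\<sigma> 1 \<noteq> \<sigma> 2" "\<sigma> 1 \<noteq> \<sigma> 3" "\<sigma> 2 \<noteq> \<sigma> 3" using permutes_inj[OF assms] by (simp_all add: inj_eq)
  ultimately show ?thesis by (elim disjE) simp_all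
qed

lemma inversion_sum_2: "inversion_sum [d1, d2] \<sigma> = (if \<sigma> 2 < \<sigma> 1 then [d1, d2] ! (\<sigma> 1 - 1) * [d1, d2] ! (\<sigma> 2 - 1) else 0)"
proof -
  have "inversions 2 \<sigma> = (if \<sigma> 2 < \<sigma> 1 then {(1, 2)} else {})"
    unfolding inversions_def by (auto simp: less_Suc_eq_le numeral_2_eq_2 le_Suc_eq)
  then show ?thesis by (simp add: inversion_sum_def numeral_2_eq_2)
qed

lemma inversion_sum_3:
  fixes d1 d2 d3 :: int
  defines "e \<equiv> \<lambda>\<sigma> i j. if \<sigma> j < \<sigma> i then [d1, d2, d3] ! (\<sigma> i - 1) * [d1, d2, d3] ! (\<sigma> j - 1) else 0"
  shows "inversion_sum [d1, d2, d3] \<sigma> = e \<sigma> 1 2 + e \<sigma> 1 3 + e \<sigma> 2 3"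
proof -
  have "{(i, j). 1 \<le> i \<and> i < j \<and> j \<le> (3::nat)} = {(1, 2), (1, 3), (2, 3)}"
    by (auto simp: numeral_2_eq_2 numeral_3_eq_3 le_Suc_eq)
  moreover have "inversions 3 \<sigma> = {x \<in> {(i, j). 1 \<le> i \<and> i < j \<and> j \<le> (3::nat)}. case x of (i, j) \<Rightarrow> \<sigma> j < \<sigma> i}"
    by (auto simp: inversions_def)
  ultimately have I: "inversions 3 \<sigma> = {x \<in> {(1, 2), (1, 3), (2, 3)}. case x of (i, j) \<Rightarrow> \<sigma> j < \<sigma> i}"
    by simp
  have L: "length [d1, d2, d3] = 3" by simp
  have "inversion_sum [d1, d2, d3] \<sigma> =
     (\<Sum>x\<in>{(1, 2), (1, 3), (2, 3)}. if case x of (i, j) \<Rightarrow> \<sigma> j < \<sigma> i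
       then case x of (i, j) \<Rightarrow> [d1, d2, d3] ! (\<sigma> i - 1) * [d1, d2, d3] ! (\<sigma> j - 1) else 0)"
    unfolding inversion_sum_def L I by (rule sum.inter_filter) simp
  then show ?thesis by (simp add: e_def)
qed

lemma perm_sublist_2: "perm_sublist \<sigma> vs 1 2 = [vs ! (\<sigma> 1 - 1), vs ! (\<sigma> 2 - 1)]"
  and perm_sublist_3: "perm_sublist \<sigma> vs 1 3 = [vs ! (\<sigma> 1 - 1), vs ! (\<sigma> 2 - 1), vs ! (\<sigma> 3 - 1)]"
proof -
  have "[1..<Suc 2] = [1, 2]" "[1..<Suc 3] = [1, 2, 3]" by (simp_all add: numeral_2_eq_2 numeral_3_eq_3)
  then show "perm_sublist \<sigma> vs 1 2 = [vs ! (\<sigma> 1 - 1), vs ! (\<sigma> 2 - 1)]"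
    "perm_sublist \<sigma> vs 1 3 = [vs ! (\<sigma> 1 - 1), vs ! (\<sigma> 2 - 1), vs ! (\<sigma> 3 - 1)]"
    by (simp_all only: perm_sublist_def list.map)
qed

lemma map_perm_sublist:
  assumes "\<sigma> permutes {1..length xs}" "1 \<le> m" "n \<le> length xs"
  shows "map f (perm_sublist \<sigma> xs m n) = perm_sublist \<sigma> (map f xs) m n"
  unfolding perm_sublist_def map_map
proof (rule map_cong[OF refl])
  fix i assume "i \<in> set [m..<Suc n]"
  then have "i \<in> {1..length xs}" using assms by auto
  then have "\<sigma> i \<in> {1..length xs}" using permutes_in_image[OF assms(1), of i] by blast
  then have "\<sigma> i - 1 < length xs" by auto
  then show "(f \<circ> (\<lambda>i. xs ! (\<sigma> i - 1))) i = map f xs ! (\<sigma> i - 1)" by (simp only: comp_apply nth_map)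
qed

lemma koszul_sum_sum: "koszul_sum d (\<lambda>S T. \<Sum>i\<in>A. H i S T) xs = (\<Sum>i\<in>A. koszul_sum d (H i) xs)"
  by (induction A rule: infinite_finite_induct) (simp_all add: koszul_sum_zero koszul_sum_add)

context derived_setting
begin

text \<open>Twisted brackets of more than three arguments are zero by definition, so three lengths
  suffice; there every permutation is reached by exchanges of neighbours.\<close>

lemma iterate_symmetric:
  assumes X: "X \<in> GL p" and vs: "list_all2 (\<lambda>v d. v \<in> GA d) vs ds"
    and s: "\<sigma> permutes {1..length vs}" and len: "length vs \<in> {1, 2, 3}"
  shows "iterate X vs = psign (inversion_sum ds \<sigma>) (iterate X (perm_sublist \<sigma> vs 1 (length vs)))"
proof -
  consider "length vs = 1" | "length vs = 2" | "length vs = 3" using len by auto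
  then show ?thesis
  proof cases
    case 1
    have "\<sigma> permutes {1..1}" using s 1 by simp
    then have "\<sigma> = id" by simp
    then show ?thesis using perm_sublist_id[of "length vs" vs] by (simp add: inversion_sum_def)
  next
    case 2
    then obtain a b where ab: "vs = [a, b]" by (auto simp: numeral_2_eq_2 length_Suc_conv)
    with vs obtain m n where d: "ds = [m, n]" "a \<in> GA m" "b \<in> GA n"
      by (auto simp: list_all2_Cons1)
    have "iterate X [a, b] = psign (m * n) (iterate X [b, a])"
      unfolding iterate_simps by (rule br_emb_swap[OF X d(2,3)])
    moreover have "\<sigma> 1 = 1 \<and> \<sigma> 2 = 2 \<or> \<sigma> 1 = 2 \<and> \<sigma> 2 = 1" using s 2 by (intro permutes_2) simp
    moreover have "perm_sublist \<sigma> vs 1 (length vs) = [vs ! (\<sigma> 1 - 1), vs ! (\<sigma> 2 - 1)]"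
      unfolding 2 by (rule perm_sublist_2)
    ultimately show ?thesis unfolding d(1) inversion_sum_2 ab by (auto simp: mult.commute simp del: iterate_simps)
  next
    case 3
    then obtain a b c where abc: "vs = [a, b, c]" by (auto simp: numeral_3_eq_3 length_Suc_conv)
    with vs obtain m n k where d: "ds = [m, n, k]" "a \<in> GA m" "b \<in> GA n" "c \<in> GA k"
      by (auto simp: list_all2_Cons1)
    have s1: "iterate X [u, v, w] = psign (i * j) (iterate X [v, u, w])"
      if "u \<in> GA i" "v \<in> GA j" "w \<in> GA l" for u v w i j l
    proof -
      have "br (br X (emb v)) (emb u) \<in> M"
        using that X by (intro br_M emb_M GL_in_M)
      then show ?thesis
        unfolding iterate_simps br_emb_swap[OF X that(1,2)] using that by (simp add: br_psign_left emb_M)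
    qed
    have s2: "iterate X [u, v, w] = psign (j * l) (iterate X [u, w, v])"
      if "u \<in> GA i" "v \<in> GA j" "w \<in> GA l" for u v w i j l
      unfolding iterate_simps by (rule br_emb_swap[OF br_GL[OF X emb_GL[OF that(1)]] that(2,3)])
    note abc' = d(2,3,4)
    \<comment> \<open>These five exchanges connect all six orders of three elements.\<close>
    have e: "iterate X [a, b, c] = psign (n * k) (iterate X [a, c, b])"
      "iterate X [a, b, c] = psign (m * n) (iterate X [b, a, c])"
      "iterate X [b, a, c] = psign (m * k) (iterate X [b, c, a])"
      "iterate X [a, c, b] = psign (m * k) (iterate X [c, a, b])"
      "iterate X [c, a, b] = psign (m * n) (iterate X [c, b, a])"
      by (rule s1 s2, rule abc', rule abc', rule abc')+
    have p: "(\<sigma> 1, \<sigma> 2, \<sigma> 3) \<in> {(1, 2, 3), (1, 3, 2), (2, 1, 3), (2, 3, 1), (3, 1, 2), (3, 2, 1)}"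
      using s 3 by (intro permutes_3) simp
    have ps: "perm_sublist \<sigma> vs 1 (length vs) = [vs ! (\<sigma> 1 - 1), vs ! (\<sigma> 2 - 1), vs ! (\<sigma> 3 - 1)]"
      unfolding 3 by (rule perm_sublist_3)
    have f: "iterate X [a, b, c] = psign (m * n + m * k) (iterate X [b, c, a])"
      "iterate X [a, b, c] = psign (n * k + m * k) (iterate X [c, a, b])"
      "iterate X [a, b, c] = psign (n * k + m * k + m * n) (iterate X [c, b, a])"
      using e by (simp_all only: psign_psign add.assoc)
    show ?thesis using p unfolding ps unfolding d(1) inversion_sum_3 abc
      apply (simp del: iterate_simps)
      apply (elim disjE conjE)
           apply (simp_all del: iterate_simps)
      using e f by (simp_all add: mult.commute add.commute add.left_commute del: iterate_simps)
  qed
qed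

end

text \<open>The abstract counterpart of the structure: a Maurer-Cartan element of degree 1 that four
  brackets annihilate. \<open>l\<close> is tied to it on one, two and three arguments, the cases
  that occur in \<open>twisted_brackets\<close>.\<close>

locale exp_twist_setting = derived_setting sL sA GA GL M br emb prj
  for sL :: "'k::field_char_0 \<Rightarrow> 'l::ab_group_add \<Rightarrow> 'l"
    and sA :: "'k \<Rightarrow> 'a::ab_group_add \<Rightarrow> 'a" and GA :: "int \<Rightarrow> 'a set"
    and GL :: "int \<Rightarrow> 'l set" and M :: "'l set" and br :: "'l \<Rightarrow> 'l \<Rightarrow> 'l"
    and emb :: "'a \<Rightarrow> 'l" and prj :: "'l \<Rightarrow> 'a" +
  fixes \<Theta> :: 'l and l :: "'a list \<Rightarrow> 'a"
  assumes \<Theta>_GL: "\<Theta> \<in> GL 1" and \<Theta>_MC: "br \<Theta> \<Theta> = 0"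
    and iterate_4: "length vs = 4 \<Longrightarrow> (\<And>v. v \<in> set vs \<Longrightarrow> \<exists>d. v \<in> GA d) \<Longrightarrow> iterate \<Theta> vs = 0"
    and l_1: "l [u] = prj (iterate \<Theta> [u])"
    and l_2: "l [u, v] = prj (iterate \<Theta> [u, v])"
    and l_3: "l [u, v, w] = prj (iterate \<Theta> [u, v, w])"
begin

lemma iterate_GL_1: "u \<in> GA m \<Longrightarrow> X \<in> GL p \<Longrightarrow> br X (emb u) \<in> GL (p + m)"
  by (intro br_GL emb_GL)

context
  fixes r assumes r: "r \<in> GA 0"
begin

lemma iterates_GL: "iterate \<Theta> [r] \<in> GL 1" "iterate \<Theta> [r, r] \<in> GL 1" "iterate \<Theta> [r, r, r] \<in> GL 1"
  using iterate_GL_1[OF r, of _ 1] \<Theta>_GL by simp_all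

lemma exp_twist_GL: "exp_twist \<Theta> r \<in> GL 1"
  unfolding exp_twist_def by (intro GL_closed \<Theta>_GL iterates_GL)

lemma iterate_exp_twist:
  assumes "homogeneous_list xs"
  shows "iterate (exp_twist \<Theta> r) (map fst xs) = iterate \<Theta> (map fst xs) + iterate \<Theta> (r # map fst xs)
    + sL (1 / 2) (iterate \<Theta> (r # r # map fst xs)) + sL (1 / 6) (iterate \<Theta> (r # r # r # map fst xs))"
proof -
  note m = GL_in_M[OF \<Theta>_GL] iterates_GL[THEN GL_in_M]
  note h = homogeneous_list_M[OF assms]
  have "iterate (exp_twist \<Theta> r) (map fst xs) = iterate \<Theta> (map fst xs) + iterate (iterate \<Theta> [r]) (map fst xs)
    + sL (1 / 2) (iterate (iterate \<Theta> [r, r]) (map fst xs)) + sL (1 / 6) (iterate (iterate \<Theta> [r, r, r]) (map fst xs))"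
    unfolding exp_twist_def using m h
    by (simp only: iterate_add iterate_scale M_closed)
  then show ?thesis by simp
qed

lemma iterate_ge_4:
  assumes "4 \<le> length vs" "\<And>v. v \<in> set vs \<Longrightarrow> \<exists>d. v \<in> GA d"
  shows "iterate \<Theta> vs = 0"
proof -
  have "iterate \<Theta> vs = iterate (iterate \<Theta> (take 4 vs)) (drop 4 vs)"
    unfolding iterate_def by (metis append_take_drop_id foldl_append)
  also have "iterate \<Theta> (take 4 vs) = 0"
    using assms by (intro iterate_4) (auto dest: in_set_takeD)
  also have "iterate 0 (drop 4 vs) = 0"
    using assms by (intro iterate_0) (auto dest!: in_set_dropD intro: emb_M)
  finally show ?thesis .
qed

text \<open>Formally the exponential of a derivation is an automorphism, which carries the equation
  for \<Theta> to the claim. For the truncated series this is made explicit: applying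
  \<open>ad\<close> again and again to \<open>br \<Theta> \<Theta> = 0\<close> yields one relation
  for each order 0 to 6 among the brackets of \<Theta>, \<open>T1\<close>, \<open>T2\<close>,
  \<open>T3\<close>, and these cancel the square order by order.\<close>

lemma exp_twist_MC: "br (exp_twist \<Theta> r) (exp_twist \<Theta> r) = 0"
proof -
  define ad where "ad X = br X (emb r)" for X
  define T1 T2 T3 where "T1 = ad \<Theta>" and "T2 = ad T1" and "T3 = ad T2"
  have G: "\<Theta> \<in> GL 1" "T1 \<in> GL 1" "T2 \<in> GL 1" "T3 \<in> GL 1"
    using iterates_GL \<Theta>_GL by (simp_all add: T1_def T2_def T3_def ad_def)
  have ad3: "ad T3 = 0"
    using iterate_4[of "[r, r, r, r]"] r by (auto simp: T1_def T2_def T3_def ad_def)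
  have sym: "br X Y = br Y X" if "X \<in> GL 1" "Y \<in> GL 1" for X Y
    using br_antisym[OF that] by simp
  have ad_br: "ad (br X Y) = br X (ad Y) + br (ad X) Y" if "X \<in> GL 1" "Y \<in> GL 1" for X Y
    using br_jacobi[OF that emb_GL[OF r]] by (simp add: ad_def)
  have ad_add: "ad (br X Y + br Z W) = ad (br X Y) + ad (br Z W)"
    if "X \<in> GL 1" "Y \<in> GL 1" "Z \<in> GL 1" "W \<in> GL 1" for X Y Z W
    unfolding ad_def using that by (intro br_add_left br_M GL_in_M emb_M[OF r]) auto
  have ad_scale: "ad (sL c (br X Y)) = sL c (ad (br X Y))" if "X \<in> GL 1" "Y \<in> GL 1" for X Y c
    unfolding ad_def using that by (intro br_scale_left br_M GL_in_M emb_M[OF r]) auto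
  have ad0: "ad 0 = 0" unfolding ad_def by (intro br_0 emb_M[OF r])
  have GM: "X \<in> M" if "X \<in> GL 1" for X using that by (rule GL_in_M)
  have two: "X = 0" if "X + X = 0" for X :: 'l
    using that L.scale_left_distrib[of 1 1 X] L.scale_eq_0_iff[of 2 X] by simp
  have e0: "br \<Theta> \<Theta> = 0" by (rule \<Theta>_MC)
  have e1: "br \<Theta> T1 = 0"
    using arg_cong[OF e0, of ad] unfolding ad_br[OF G(1,1)] ad0 T1_def[symmetric] sym[OF G(2,1)] by (rule two)
  have e2: "br \<Theta> T2 + br T1 T1 = 0"
    using arg_cong[OF e1, of ad] unfolding ad_br[OF G(1,2)] ad0 T1_def[symmetric] T2_def[symmetric] .
  \<comment> \<open>The constants here and in \<open>e4\<close> are the binomial coefficients of the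
    Leibniz rule, halved by symmetry: the third power of \<open>ad\<close> gives twice the first
    bracket and six times the second.\<close>
  have e3: "br \<Theta> T3 + sL 3 (br T1 T2) = 0"
  proof -
    have "br \<Theta> T3 + br T1 T2 + (br T1 T2 + br T2 T1) = 0"
      using arg_cong[OF e2, of ad]
      unfolding ad_add[OF G(1,3,2,2)] ad_br[OF G(1,3)] ad_br[OF G(2,2)] ad0 T1_def[symmetric] T2_def[symmetric] T3_def[symmetric] .
    moreover have "sL 3 (br T1 T2) = br T1 T2 + br T1 T2 + br T1 T2"
      using L.scale_left_distrib[of 2 1 "br T1 T2"] L.scale_left_distrib[of 1 1 "br T1 T2"] by simp
    ultimately show ?thesis by (simp add: sym[OF G(3,2)] add_ac)
  qed
  have e4: "sL 4 (br T1 T3) + sL 3 (br T2 T2) = 0"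
  proof -
    have "ad (br \<Theta> T3 + sL 3 (br T1 T2)) = ad (br \<Theta> T3) + ad (sL 3 (br T1 T2))"
      unfolding ad_def by (intro br_add_left M_closed br_M GM G emb_M[OF r])
    then have "0 + br T1 T3 + sL 3 (br T1 T3 + br T2 T2) = 0"
      using arg_cong[OF e3, of ad]
      unfolding ad_scale[OF G(2,3)] ad_br[OF G(1,4)] ad_br[OF G(2,3)] ad0 ad3 br_0(2)[OF GM[OF G(1)]]
        T1_def[symmetric] T2_def[symmetric] T3_def[symmetric] by simp
    then show ?thesis
      using L.scale_left_distrib[of 1 3 "br T1 T3"] by (simp add: L.scale_right_distrib add.assoc)
  qed
  have e5: "br T2 T3 = 0"
  proof -
    have "ad (sL 4 (br T1 T3) + sL 3 (br T2 T2)) = ad (sL 4 (br T1 T3)) + ad (sL 3 (br T2 T2))"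
      unfolding ad_def by (intro br_add_left M_closed br_M GM G emb_M[OF r])
    then have "sL 4 (0 + br T2 T3) + sL 3 (br T2 T3 + br T2 T3) = 0"
      using arg_cong[OF e4, of ad]
      unfolding ad_scale[OF G(2,4)] ad_scale[OF G(3,3)] ad_br[OF G(2,4)] ad_br[OF G(3,3)] ad0 ad3 br_0(2)[OF GM[OF G(2)]]
        T1_def[symmetric] T2_def[symmetric] T3_def[symmetric] sym[OF G(4,3)] by simp
    then have "sL (4 + 3 + 3) (br T2 T3) = 0" unfolding L.scale_left_distrib by (simp add: L.scale_right_distrib add.assoc)
    then show ?thesis by simp
  qed
  have e6: "br T3 T3 = 0"
    using arg_cong[OF e5, of ad]
    unfolding ad_br[OF G(3,4)] ad0 ad3 br_0(2)[OF GM[OF G(3)]] T3_def[symmetric] by simp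
  have E: "exp_twist \<Theta> r = \<Theta> + T1 + sL (1 / 2) T2 + sL (1 / 6) T3"
    by (simp add: exp_twist_def T1_def T2_def T3_def ad_def)
  have e2': "br T1 T1 = - br \<Theta> T2" using e2 by (simp add: eq_neg_iff_add_eq_0 add.commute)
  have e3': "br \<Theta> T3 = - sL 3 (br T1 T2)" using e3 by (simp add: eq_neg_iff_add_eq_0 add.commute)
  have e4': "br T2 T2 = - sL (4 / 3) (br T1 T3)"
  proof -
    have "sL 3 (br T2 T2) = - sL 4 (br T1 T3)"
      using e4 by (simp add: eq_neg_iff_add_eq_0 add.commute)
    then have "sL (1 / 3) (sL 3 (br T2 T2)) = sL (1 / 3) (- sL 4 (br T1 T3))" by (rule arg_cong)
    then show ?thesis by simp
  qed
  have s: "br T1 \<Theta> = br \<Theta> T1" "br T2 \<Theta> = br \<Theta> T2" "br T3 \<Theta> = br \<Theta> T3" "br T2 T1 = br T1 T2"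
     "br T3 T1 = br T1 T3" "br T3 T2 = br T2 T3"
    using sym G by blast+
  have half: "sL (1 / 2) X + sL (1 / 2) X = X" for X
    using L.scale_left_distrib[of "1 / 2" "1 / 2" X] by simp
  \<comment> \<open>Only the orders 2, 3 and 4 are left; they vanish by \<open>e2'\<close>,
    \<open>e3'\<close> and \<open>e4'\<close>.\<close>
  have "br (exp_twist \<Theta> r) (exp_twist \<Theta> r) = sL (1 / 2) (br \<Theta> T2) + sL (1 / 2) (br \<Theta> T2) + br T1 T1
      + (sL (1 / 6) (br \<Theta> T3) + sL (1 / 6) (br \<Theta> T3) + sL (1 / 2) (br T1 T2) + sL (1 / 2) (br T1 T2))
      + (sL (1 / 6) (br T1 T3) + sL (1 / 6) (br T1 T3) + sL (1 / 4) (br T2 T2))"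
    unfolding E using GM G
    by (simp add: br_add_left br_add_right br_scale_left br_scale_right M_closed s e0 e1 e5 e6
        L.scale_right_distrib add_ac)
  also have "\<dots> = 0"
  proof -
    have "sL (1 / 6) (br T1 T3) + sL (1 / 6) (br T1 T3) = sL (1 / 3) (br T1 T3)"
      using L.scale_left_distrib[of "1 / 6" "1 / 6" "br T1 T3"] by simp
    then show ?thesis unfolding half e2' e3' e4' by (simp add: half)
  qed
  finally show ?thesis .
qed

abbreviation "l_r \<equiv> twisted_brackets sA l r"

text \<open>The exponential series cut off where \<open>n\<close> further arguments would make more
  than three brackets. It represents the twisted brackets on all sums of homogeneous elements,
  whereas the vanishing of four brackets is given for homogeneous entries.\<close>

definition partial_twist :: "nat \<Rightarrow> 'l" where
  "partial_twist n = (if n = 1 then \<Theta> + iterate \<Theta> [r] + sL (1 / 2) (iterate \<Theta> [r, r])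
     else if n = 2 then \<Theta> + iterate \<Theta> [r] else if n = 3 then \<Theta> else 0)"

lemma partial_twist_GL: "partial_twist n \<in> GL 1"
  unfolding partial_twist_def by (auto intro!: GL_closed \<Theta>_GL iterates_GL simp del: iterate_simps)

lemma l_r_partial_twist:
  assumes "set vs \<subseteq> A.direct_sum"
  shows "l_r vs = prj (iterate (partial_twist (length vs)) vs)"
proof -
  note m = GL_in_M[OF \<Theta>_GL] iterates_GL[THEN GL_in_M]
  have h: "emb ` set vs \<subseteq> M" using assms direct_sum_M by blast
  have 1: "iterate (iterate \<Theta> [r]) vs = iterate \<Theta> (r # vs)" "iterate (iterate \<Theta> [r, r]) vs = iterate \<Theta> (r # r # vs)" for vs by simp_all
  have 2: "iterate (\<Theta> + iterate \<Theta> [r] + sL (1 / 2) (iterate \<Theta> [r, r])) vs =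
      iterate \<Theta> vs + iterate \<Theta> (r # vs) + sL (1 / 2) (iterate \<Theta> (r # r # vs))"
    "iterate (\<Theta> + iterate \<Theta> [r]) vs = iterate \<Theta> vs + iterate \<Theta> (r # vs)"
    using m h by (simp_all only: iterate_add iterate_scale M_closed 1)
  consider "vs = []" | P where "vs = [P]" | P Q where "vs = [P, Q]" | P Q R where "vs = [P, Q, R]"
    | P Q R S ws where "vs = P # Q # R # S # ws"
    by (metis neq_Nil_conv)
  then show ?thesis
  proof cases
    case (2 P)
    then show ?thesis using \<open>iterate (\<Theta> + iterate \<Theta> [r] + sL (1 / 2) (iterate \<Theta> [r, r])) vs = _\<close>
      by (simp add: partial_twist_def l_1 l_2 l_3 prj.add prj.scale del: iterate_simps)
  next
    case (3 P Q)
    then show ?thesis using \<open>iterate (\<Theta> + iterate \<Theta> [r]) vs = _\<close>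
      by (simp add: partial_twist_def l_1 l_2 l_3 prj.add prj.scale del: iterate_simps)
  qed (use h in \<open>auto simp: partial_twist_def l_1 l_2 l_3 prj.add prj.zero iterate_0 simp del: iterate_simps(2)\<close>)
qed

lemma homogeneous_list_direct_sum: "homogeneous_list xs \<Longrightarrow> set (map fst xs) \<subseteq> A.direct_sum"
  using GA_direct_sum by fastforce

text \<open>On homogeneous entries the terms cut off contain at least four brackets and vanish.
  Hence a single element generates all twisted brackets.\<close>

lemma l_r_exp_twist:
  assumes h: "homogeneous_list xs" and ne: "xs \<noteq> []"
  shows "l_r (map fst xs) = prj (iterate (exp_twist \<Theta> r) (map fst xs))"
proof -
  let ?vs = "map fst xs"
  note m = GL_in_M[OF \<Theta>_GL] iterates_GL[THEN GL_in_M]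
  note hM = homogeneous_list_M[OF h]
  have hd: "\<exists>d. v \<in> GA d" if "v \<in> insert r (set ?vs)" for v
    using that r h by force
  have z: "iterate \<Theta> ws = 0" if "4 \<le> length ws" "set ws \<subseteq> insert r (set ?vs)" for ws
    using that hd by (intro iterate_ge_4) (auto 0 0 dest!: subsetD simp del: set_map)
  have 1: "iterate (iterate \<Theta> [r]) vs = iterate \<Theta> (r # vs)" "iterate (iterate \<Theta> [r, r]) vs = iterate \<Theta> (r # r # vs)" for vs by simp_all
  have 2: "iterate (\<Theta> + iterate \<Theta> [r] + sL (1 / 2) (iterate \<Theta> [r, r])) ?vs =
      iterate \<Theta> ?vs + iterate \<Theta> (r # ?vs) + sL (1 / 2) (iterate \<Theta> (r # r # ?vs))"
    "iterate (\<Theta> + iterate \<Theta> [r]) ?vs = iterate \<Theta> ?vs + iterate \<Theta> (r # ?vs)"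
    using m hM by (simp_all only: iterate_add iterate_scale M_closed 1)
  have "iterate (partial_twist (length ?vs)) ?vs = iterate (exp_twist \<Theta> r) ?vs"
  proof -
    consider "length ?vs = 1" | "length ?vs = 2" | "length ?vs = 3" | "length ?vs \<ge> 4"
      using ne by (cases "length xs") (auto, linarith)
    then show ?thesis
    proof cases
      case 1
      then have "iterate \<Theta> (r # r # r # ?vs) = 0" by (intro z) auto
      then show ?thesis using 1 2 by (simp add: iterate_exp_twist[OF h] partial_twist_def del: iterate_simps)
    next
      case 2
      have "iterate \<Theta> (r # r # r # ?vs) = 0" by (rule z) (use 2 in auto)
      moreover have "iterate \<Theta> (r # r # ?vs) = 0" by (rule z) (use 2 in auto)
      ultimately show ?thesis using 2 \<open>iterate (\<Theta> + iterate \<Theta> [r]) ?vs = iterate \<Theta> ?vs + iterate \<Theta> (r # ?vs)\<close>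
        by (simp add: iterate_exp_twist[OF h] partial_twist_def del: iterate_simps)
    next
      case 3
      have "iterate \<Theta> (r # r # r # ?vs) = 0" by (rule z) (use 3 in auto)
      moreover have "iterate \<Theta> (r # r # ?vs) = 0" by (rule z) (use 3 in auto)
      moreover have "iterate \<Theta> (r # ?vs) = 0" by (rule z) (use 3 in auto)
      ultimately show ?thesis using 3 by (simp add: iterate_exp_twist[OF h] partial_twist_def del: iterate_simps)
    next
      case 4
      have "iterate \<Theta> (r # r # r # ?vs) = 0" by (rule z) (use 4 in auto)
      moreover have "iterate \<Theta> (r # r # ?vs) = 0" by (rule z) (use 4 in auto)
      moreover have "iterate \<Theta> (r # ?vs) = 0" by (rule z) (use 4 in auto)
      moreover have "iterate \<Theta> ?vs = 0" by (rule z) (use 4 in auto)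
      ultimately show ?thesis using 4 hM by (simp add: iterate_exp_twist[OF h] partial_twist_def iterate_0 del: iterate_simps)
    qed
  qed
  then show ?thesis using l_r_partial_twist[OF homogeneous_list_direct_sum[OF h]] by simp
qed

lemma homogeneous_list_zip: "list_all2 (\<lambda>v d. v \<in> GA d) vs ds \<Longrightarrow> homogeneous_list (zip vs ds)"
  by (auto simp: list_all2_conv_all_nth in_set_zip)

text \<open>Multilinearity and symmetry are checked with \<open>partial_twist\<close>, degrees and
  Jacobi identities with \<open>exp_twist\<close>, whose derived brackets are the twisted ones. The
  assumption says that the exponential has no bracket without arguments.\<close>

theorem L_infinity_twisted:
  assumes MC: "prj (exp_twist \<Theta> r) = 0"
  shows "L_infinity_algebra sA GA l_r"
proof
  have upd: "set (vs[i := u]) \<subseteq> A.direct_sum" if "set vs \<subseteq> A.direct_sum" "u \<in> A.direct_sum" for vs i u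
    using that set_update_subset_insert[of vs i u] by blast
  have ds: "u + w \<in> A.direct_sum" "sA c u \<in> A.direct_sum" if "u \<in> A.direct_sum" "w \<in> A.direct_sum" for u w c
    using that by (auto simp: A.direct_sum_def A.span_add A.span_scale)
  show "l_r (vs[i := u + w]) = l_r (vs[i := u]) + l_r (vs[i := w])"
    if "set vs \<subseteq> A.direct_sum" "i < length vs" "u \<in> A.direct_sum" "w \<in> A.direct_sum" for vs i u w
    using iterate_update_add[OF GL_in_M[OF partial_twist_GL] that] that by (simp add: l_r_partial_twist upd ds prj.add)
  show "l_r (vs[i := sA c u]) = sA c (l_r (vs[i := u]))"
    if "set vs \<subseteq> A.direct_sum" "i < length vs" "u \<in> A.direct_sum" for vs i u c
    using iterate_update_scale[OF GL_in_M[OF partial_twist_GL] that] that ds(2)[OF that(3) that(3)] by (simp add: l_r_partial_twist upd prj.scale)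
  have zp: "map fst (zip vs ds) = vs" "map snd (zip vs ds) = ds" if "list_all2 (\<lambda>v d. v \<in> GA d) vs ds" for vs ds
    using that by (simp_all add: list_all2_lengthD)
  show "l_r vs \<in> GA (sum_list ds + 1)" if "vs \<noteq> []" "list_all2 (\<lambda>v d. v \<in> GA d) vs ds" for vs ds
  proof -
    have "zip vs ds \<noteq> []" using that by (auto simp: list_all2_lengthD)
    then have "l_r vs = prj (iterate (exp_twist \<Theta> r) vs)"
      using l_r_exp_twist[OF homogeneous_list_zip[OF that(2)]] zp[OF that(2)] by simp
    then show ?thesis
      using prj_GA[OF iterate_GL[OF exp_twist_GL homogeneous_list_zip[OF that(2)]]] zp[OF that(2)] by (simp add: add.commute)
  qed
  show "l_r vs = sA (of_int (koszul_sign ds \<sigma>)) (l_r (perm_sublist \<sigma> vs 1 (length vs)))"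
    if "vs \<noteq> []" and vs: "list_all2 (\<lambda>v d. v \<in> GA d) vs ds" and s: "\<sigma> permutes {1..length vs}" for vs ds \<sigma>
  proof -
    have D: "set vs \<subseteq> A.direct_sum" using homogeneous_list_direct_sum[OF homogeneous_list_zip[OF vs]] zp[OF vs] by simp
    have "set (perm_sublist \<sigma> vs 1 (length vs)) \<subseteq> set vs"
    proof
      fix v assume "v \<in> set (perm_sublist \<sigma> vs 1 (length vs))"
      then obtain i where i: "i \<in> set [1..<Suc (length vs)]" "v = vs ! (\<sigma> i - 1)"
        unfolding perm_sublist_def set_map by blast
      then have "i \<in> {1..length vs}" by auto
      then have "\<sigma> i \<in> {1..length vs}" using permutes_in_image[OF s, of i] by blast
      then have "\<sigma> i - 1 < length vs" by auto
      then show "v \<in> set vs" unfolding i(2) by (rule nth_mem)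
    qed
    with D have D': "set (perm_sublist \<sigma> vs 1 (length vs)) \<subseteq> A.direct_sum" by blast
    have "iterate (partial_twist (length vs)) vs = psign (inversion_sum ds \<sigma>) (iterate (partial_twist (length vs)) (perm_sublist \<sigma> vs 1 (length vs)))"
    proof (cases "length vs \<in> {1, 2, 3}")
      case True
      then show ?thesis by (intro iterate_symmetric[OF partial_twist_GL vs s])
    next
      case False
      then have "partial_twist (length vs) = 0" by (simp add: partial_twist_def)
      moreover have "emb ` set vs \<subseteq> M" "emb ` set (perm_sublist \<sigma> vs 1 (length vs)) \<subseteq> M"
        using D D' direct_sum_M by blast+
      ultimately show ?thesis using iterate_0 by simp
    qed
    then show ?thesis using l_r_partial_twist[OF D] l_r_partial_twist[OF D'] by (simp add: A.scale_koszul_sign psign_def prj.neg)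
  qed
  show "(\<Sum>i = 1..N. \<Sum>\<sigma>\<in>shuffle_perms i (N - i). sA (of_int (koszul_sign ds \<sigma>))
           (l_r (l_r (perm_sublist \<sigma> vs 1 i) # perm_sublist \<sigma> vs (i + 1) N))) = 0"
    if N: "1 \<le> N" "length vs = N" and vs: "list_all2 (\<lambda>v d. v \<in> GA d) vs ds" for N vs ds
  proof -
    define xs where "xs = zip vs ds"
    have x: "map fst xs = vs" "map snd xs = ds" "homogeneous_list xs" "length xs = N"
      using zp[OF vs] homogeneous_list_zip[OF vs] N list_all2_lengthD[OF vs] by (simp_all add: xs_def)
    define H where "H S T = l_r (l_r (map fst S) # map fst T)" for S T :: "('a \<times> int) list"
    have "(\<Sum>\<sigma>\<in>shuffle_perms i (N - i). sA (of_int (koszul_sign ds \<sigma>))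
           (l_r (l_r (perm_sublist \<sigma> vs 1 i) # perm_sublist \<sigma> vs (i + 1) N))) =
        koszul_sum snd (\<lambda>S T. if length S = i then H S T else 0) xs" if i: "i \<in> {1..N}" for i
    proof -
      have "(\<Sum>\<sigma>\<in>shuffle_perms i (N - i). sA (of_int (koszul_sign ds \<sigma>))
           (l_r (l_r (perm_sublist \<sigma> vs 1 i) # perm_sublist \<sigma> vs (i + 1) N))) =
         (\<Sum>\<sigma>\<in>shuffle_perms i (N - i). psign (inversion_sum (map snd xs) \<sigma>)
           (H (perm_sublist \<sigma> xs 1 i) (perm_sublist \<sigma> xs (i + 1) (i + (N - i)))))"
      proof (rule sum.cong[OF refl])
        fix \<sigma> assume "\<sigma> \<in> shuffle_perms i (N - i)"
        then have p: "\<sigma> permutes {1..length xs}" using shuffle_permsD(1)[of \<sigma> i "N - i"] x i by simp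
        have "map fst (perm_sublist \<sigma> xs 1 i) = perm_sublist \<sigma> vs 1 i"
          "map fst (perm_sublist \<sigma> xs (i + 1) (i + (N - i))) = perm_sublist \<sigma> vs (i + 1) N"
          using map_perm_sublist[OF p, of _ _ fst] x i by simp_all
        then show "sA (of_int (koszul_sign ds \<sigma>))
           (l_r (l_r (perm_sublist \<sigma> vs 1 i) # perm_sublist \<sigma> vs (i + 1) N)) =
          psign (inversion_sum (map snd xs) \<sigma>) (H (perm_sublist \<sigma> xs 1 i) (perm_sublist \<sigma> xs (i + 1) (i + (N - i))))"
          by (simp only: A.scale_koszul_sign x H_def)
      qed
      also have "\<dots> = koszul_sum snd (\<lambda>S T. if length S = i then H S T else 0) xs"
        using x i by (intro sum_shuffle_perms_koszul_sum) simp
      finally show ?thesis .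
    qed
    then have "(\<Sum>i = 1..N. \<Sum>\<sigma>\<in>shuffle_perms i (N - i). sA (of_int (koszul_sign ds \<sigma>))
           (l_r (l_r (perm_sublist \<sigma> vs 1 i) # perm_sublist \<sigma> vs (i + 1) N))) =
       koszul_sum snd (\<lambda>S T. \<Sum>i = 1..N. if length S = i then H S T else 0) xs"
      by (simp only: koszul_sum_sum cong: sum.cong)
    \<comment> \<open>Summation over \<open>i\<close> removes the restriction on the length of
      \<open>S\<close>, except that \<open>S\<close> stays non-empty because \<open>i\<close> starts
      at 1.\<close>
    also have "\<dots> = koszul_sum snd (\<lambda>S T. if S = [] then 0 else
       prj (iterate (exp_twist \<Theta> r) (prj (iterate (exp_twist \<Theta> r) (map fst S)) # map fst T))) xs"
    proof (rule koszul_sum_cong)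
      fix S T assume sh: "xs \<in> shuffles S T"
      have h: "homogeneous_list S" "homogeneous_list T" using x(3) set_shuffles[OF sh] by auto
      have len: "length S \<le> N" using length_shuffles[OF sh] x(4) by simp
      show "(\<Sum>i = 1..N. if length S = i then H S T else 0) = (if S = [] then 0 else
       prj (iterate (exp_twist \<Theta> r) (prj (iterate (exp_twist \<Theta> r) (map fst S)) # map fst T)))"
      proof (cases "S = []")
        case False
        let ?u = "prj (iterate (exp_twist \<Theta> r) (map fst S))"
        have "?u \<in> GA (1 + total_degree S)" by (rule prj_GA[OF iterate_GL[OF exp_twist_GL h(1)]])
        then have "H S T = prj (iterate (exp_twist \<Theta> r) (?u # map fst T))"
          using l_r_exp_twist[OF h(1) False] l_r_exp_twist[of "(?u, 1 + total_degree S) # T"] h(2)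
          by (simp add: H_def)
        moreover have "(\<Sum>i = 1..N. if length S = i then H S T else 0) = H S T"
          using False len by (simp add: Suc_leI)
        ultimately show ?thesis using False by (simp del: iterate_simps)
      qed simp
    qed
    also have "\<dots> = 0"
      by (rule derived_bracket_jacobi[OF exp_twist_GL exp_twist_MC MC x(3)])
    finally show ?thesis .
  qed
qed

text \<open>Brackets with \<open>r\<close> and with \<open>r'\<close> commute, so the exponential at
  \<open>r + r'\<close> is a Taylor expansion around the one at \<open>r\<close>. After projection
  its constant term vanishes by assumption and the rest is the Maurer-Cartan series of
  \<open>r'\<close>.\<close>

theorem maurer_cartan_twisted:
  assumes MC: "prj (exp_twist \<Theta> r) = 0" and r': "r' \<in> GA 0"
  shows "maurer_cartan sA GA l_r r' \<longleftrightarrow> prj (exp_twist \<Theta> (r + r')) = 0"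
proof -
  have l0: "l_r (replicate k r') = 0" if "k = 0 \<or> k \<ge> 4" for k
  proof -
    have D: "set (replicate k r') \<subseteq> A.direct_sum" using GA_direct_sum[OF r'] by auto
    have "partial_twist k = 0" using that by (auto simp: partial_twist_def)
    moreover have "emb ` set (replicate k r') \<subseteq> M" using emb_M[OF r'] by auto
    ultimately show ?thesis using l_r_partial_twist[OF D] iterate_0[of "replicate k r'"] by (simp add: prj.zero)
  qed
  \<comment> \<open>\<open>maurer_cartan\<close> sums over the non-zero terms; this allows the sum
    to be extended to the three orders that can occur.\<close>
  have K: "{k. 1 \<le> k \<and> l_r (replicate k r') \<noteq> 0} \<subseteq> {1, 2, 3}"
  proof
    fix k assume "k \<in> {k. 1 \<le> k \<and> l_r (replicate k r') \<noteq> 0}"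
    then have "1 \<le> k" "\<not> (k = 0 \<or> k \<ge> 4)" using l0 by blast+
    then show "k \<in> {1, 2, 3}" by auto
  qed
  have "(\<Sum>k | 1 \<le> k \<and> l_r (replicate k r') \<noteq> 0. sA (1 / fact k) (l_r (replicate k r'))) =
      (\<Sum>k\<in>{1, 2, 3}. sA (1 / fact k) (l_r (replicate k r')))"
    by (rule sum.mono_neutral_left) (use K in auto)
  also have "\<dots> = l_r [r'] + sA (1 / 2) (l_r [r', r']) + sA (1 / 6) (l_r [r', r', r'])"
    by (simp add: numeral_2_eq_2 numeral_3_eq_3 fact_numeral) 
  also have "\<dots> = prj (exp_twist \<Theta> (r + r'))"
  proof -
    define a where "a vs = iterate \<Theta> vs" for vs
    have GM: "X \<in> M" if "X \<in> GL 1" for X using that by (rule GL_in_M)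
    have eM: "emb r \<in> M" "emb r' \<in> M" "emb r + emb r' \<in> M"
      using r r' by (auto intro: emb_M M_closed)
    have G: "\<Theta> \<in> GL 1" "br X (emb r) \<in> GL 1" "br X (emb r') \<in> GL 1" if "X \<in> GL 1" for X
      using iterate_GL_1[OF r that] iterate_GL_1[OF r' that] \<Theta>_GL by simp_all
    note G' = G(1)[OF \<Theta>_GL] G(2)[OF \<Theta>_GL] G(3)[OF \<Theta>_GL]
    note G'' = G'(2)[THEN G(2)] G'(2)[THEN G(3)] G'(3)[THEN G(2)] G'(3)[THEN G(3)]
    \<comment> \<open>Both elements have degree 0, so the exchange costs no sign.\<close>
    have sw: "br (br X (emb r')) (emb r) = br (br X (emb r)) (emb r')" if "X \<in> GL 1" for X
      using br_emb_swap[OF that r' r] by simp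
    have b2: "br (X + Z) (emb r + emb r') = br X (emb r) + br X (emb r') + (br Z (emb r) + br Z (emb r'))"
      if "X \<in> M" "Z \<in> M" for X Z
      using that eM by (simp add: br_add_left br_add_right M_closed)
    have t1: "iterate \<Theta> [r + r'] = a [r] + a [r']"
      using G' eM by (simp add: a_def emb.add br_add_right GM)
    have t2: "iterate \<Theta> [r + r', r + r'] = a [r, r] + a [r, r'] + (a [r, r'] + a [r', r'])"
      using b2[OF GM[OF G'(2)] GM[OF G'(3)]] t1 by (simp add: a_def emb.add sw[OF G'(1)])
    have t3: "iterate \<Theta> [r + r', r + r', r + r'] = a [r, r, r] + a [r, r, r'] + (a [r, r, r'] + a [r, r', r'])
        + (a [r, r, r'] + a [r, r', r'] + (a [r, r', r'] + a [r', r', r']))"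
    proof -
      have "iterate \<Theta> [r + r', r + r', r + r'] = br (a [r, r] + a [r, r'] + (a [r, r'] + a [r', r'])) (emb r + emb r')"
        using t2 by (simp add: emb.add)
      also have "\<dots> = br (a [r, r] + a [r, r']) (emb r) + br (a [r, r] + a [r, r']) (emb r')
          + (br (a [r, r'] + a [r', r']) (emb r) + br (a [r, r'] + a [r', r']) (emb r'))"
        using G'' GM by (intro b2 M_closed) (simp_all add: a_def)
      also have "\<dots> = a [r, r, r] + a [r, r, r'] + (a [r, r, r'] + a [r, r', r'])
        + (a [r, r, r'] + a [r, r', r'] + (a [r, r', r'] + a [r', r', r']))"
        using G'' GM eM by (simp add: a_def br_add_left M_closed sw G' sw[OF G'(2)] sw[OF G'(3)])
      finally show ?thesis .
    qed
    have half: "sL (1 / 2) (X + X) = X" for X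
      using L.scale_left_distrib[of "1 / 2" "1 / 2" X] by (simp add: L.scale_right_distrib)
    \<comment> \<open>Three equal mixed terms of third order turn the coefficient 1/6 into 1/2, the
      one in the twisted unary bracket and in front of the binary one.\<close>
    have six: "sL (1 / 6) X + sL (1 / 6) X + sL (1 / 6) X = sL (1 / 2) X" for X
      using L.scale_left_distrib[of "1 / 6" "1 / 6" X] L.scale_left_distrib[of "1 / 3" "1 / 6" X] by simp
    have "exp_twist \<Theta> (r + r') = exp_twist \<Theta> r
      + (a [r'] + a [r, r'] + (sL (1 / 6) (a [r, r, r']) + sL (1 / 6) (a [r, r, r']) + sL (1 / 6) (a [r, r, r'])))
      + (sL (1 / 2) (a [r', r']) + (sL (1 / 6) (a [r, r', r']) + sL (1 / 6) (a [r, r', r']) + sL (1 / 6) (a [r, r', r'])))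
      + sL (1 / 6) (a [r', r', r'])"
    proof -
      have "sL (1 / 2) (a [r, r] + a [r, r'] + (a [r, r'] + a [r', r'])) =
          sL (1 / 2) (a [r, r]) + sL (1 / 2) (a [r, r'] + a [r, r']) + sL (1 / 2) (a [r', r'])"
        by (simp only: L.scale_right_distrib add_ac)
      then show ?thesis
        unfolding exp_twist_def t1 t2 t3 half a_def[of "[r]", symmetric] a_def[of "[r, r]", symmetric]
          a_def[of "[r, r, r]", symmetric]
        by (simp only: L.scale_right_distrib add_ac)
    qed
    then have "prj (exp_twist \<Theta> (r + r')) =
      (prj (a [r']) + prj (a [r, r']) + sA (1 / 2) (prj (a [r, r, r'])))
      + sA (1 / 2) (prj (a [r', r']) + prj (a [r, r', r']))
      + sA (1 / 6) (prj (a [r', r', r']))"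
      unfolding six by (simp add: prj.add prj.scale MC A.scale_right_distrib)
    then show ?thesis by (simp add: l_1 l_2 l_3 a_def[symmetric] del: iterate_simps)
  qed
  finally show ?thesis
    using finite_subset[OF K] r' by (simp add: maurer_cartan_def)
qed

end

end

section \<open>Cochains on a direct sum\<close>

lemma structure_cochain_cochains:
  assumes "lie_yamaguti_algebra s br tri"
  shows "structure_cochain br tri \<in> cochains s s 1"
proof -
  interpret lie_yamaguti_algebra s br tri by fact
  have s: "vector_space s" by unfold_locales
  have lin: "br (x + x') y = br x y + br x' y" "br y (x + x') = br y x + br y x'"
    "br (s c x) y = s c (br x y)" "br y (s c x) = s c (br y x)"
    "tri (x + x') y z = tri x y z + tri x' y z" "tri y (x + x') z = tri y x z + tri y x' z"
    "tri y z (x + x') = tri y z x + tri y z x'"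
    "tri (s c x) y z = s c (tri x y z)" "tri y (s c x) z = s c (tri y x z)" "tri y z (s c x) = s c (tri y z x)"
    for x x' y z c
    by (simp_all add: br_linear1[unfolded Vector_Spaces.linear_iff] br_linear2[unfolded Vector_Spaces.linear_iff]
      tri_linear1[unfolded Vector_Spaces.linear_iff] tri_linear2[unfolded Vector_Spaces.linear_iff]
      tri_linear3[unfolded Vector_Spaces.linear_iff])
  let ?P = "structure_cochain br tri"
  have e: "fst ?P (u @ Z # v) = (if u = [] \<and> v = [] then br (fst Z) (snd Z) else 0)"
    "snd ?P (u @ Z # v) x = (if u = [] \<and> v = [] then tri (fst Z) (snd Z) x else 0)" for u v Z x
    by (cases u; cases v; cases Z; auto simp: structure_cochain_def split: list.splits)+
  have w: "snd ?P w x = (case w of [Z] \<Rightarrow> tri (fst Z) (snd Z) x | _ \<Rightarrow> 0)" for w x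
    by (auto simp: structure_cochain_def split: list.splits)
  have "?P \<in> ml_cochains s s"
    unfolding ml_cochains_def mem_Collect_eq add_letters_def hom_letters_def alternating_def add_values_def hom_values_def fun_eq_iff
    by (simp add: e lin br_alt tri_alt) (auto simp: w lin structure_cochain_def split: list.splits)
  moreover have "supp_in 1 ?P"
    by (auto simp: supp_in_def structure_cochain_def fun_eq_iff split: list.splits)
  ultimately show ?thesis by (simp add: cochains_iff[OF s s])
qed

text \<open>At words of length two the components of the product of the structure with itself vanish
  by \<open>LY3\<close> and \<open>LY4\<close>; at other lengths the product vanishes by
  degree.\<close>

lemma ly_bracket_structure_cochain:
  assumes "lie_yamaguti_algebra s br tri"
  shows "ly_bracket s (structure_cochain br tri) (structure_cochain br tri) = 0"
proof -
  interpret lie_yamaguti_algebra s br tri by fact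
  have s: "vector_space s" by unfold_locales
  let ?P = "structure_cochain br tri"
  have P: "?P \<in> cochains s s 1" by (rule structure_cochain_cochains) fact
  have d: "circ ?P ?P = ly_diamond s 1 1 ?P ?P"
    by (rule ly_diamond_circ[OF s P P, symmetric])
  have tri0: "tri x y 0 = 0" "br 0 x = 0" "br x 0 = 0" for x y
    using br_linear1[of x] br_linear2[of x] tri_linear3[of x y] by (auto dest: vs_linear_0)
  have f: "fst ?P [] = 0" "fst ?P [X] = br (fst X) (snd X)" "fst ?P (X # Y # w) = 0"
    "snd ?P [] x = 0" "snd ?P [X] x = tri (fst X) (snd X) x" "snd ?P (X # Y # w) x = 0" for X Y w x
    by (auto simp: structure_cochain_def split: prod.splits)
  have "circ ?P ?P = 0"
  proof (intro prod_eqI ext)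
    fix w
    show "fst (circ ?P ?P) w = fst 0 w"
    proof (cases "length w = 2")
      case True
      then obtain X Y where w: "w = [X, Y]" by (auto simp: numeral_2_eq_2 length_Suc_conv)
      have "tri (fst X) (snd X) (- br (fst Y) (snd Y)) = - tri (fst X) (snd X) (br (fst Y) (snd Y))"
        using tri_linear3[of "fst X" "snd X"] by (rule module_hom.neg[OF Vector_Spaces.linear.axioms(3)])
      then show ?thesis
        by (simp add: w circ_def f shift_def twist_def tri0 LY3)
    next
      case False
      then show ?thesis unfolding d by (simp add: ly_diamond_def)
    qed
  next
    fix w x
    show "snd (circ ?P ?P) w x = snd 0 w x"
    proof (cases "length w = 2")
      case True
      then obtain X Y where w: "w = [X, Y]" by (auto simp: numeral_2_eq_2 length_Suc_conv)
      have "tri (fst X) (snd X) (- tri (fst Y) (snd Y) x) = - tri (fst X) (snd X) (tri (fst Y) (snd Y) x)"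
        using tri_linear3[of "fst X" "snd X"] by (rule module_hom.neg[OF Vector_Spaces.linear.axioms(3)])
      then show ?thesis
        using LY4[of "fst X" "snd X" "fst Y" "snd Y" x]
        by (simp add: w circ_def circ_II_def insertion_apply f shift_def twist_def tri0)
    next
      case False
      then show ?thesis unfolding d by (simp add: ly_diamond_def)
    qed
  qed
  then show ?thesis by (simp add: ly_bracket_circ[OF s P P])
qed

lemma linear_cochain_cochains:
  assumes "Vector_Spaces.linear s t f"
  shows "linear_cochain f \<in> cochains s t 0"
proof -
  have s: "vector_space s" and t: "vector_space t" and f: "f (x + y) = f x + f y" "f (s c x) = t c (f x)" for x y c
    using assms by (auto simp: Vector_Spaces.linear_iff)
  show ?thesis
    using f t by (auto simp: cochains_iff[OF s t] ml_cochains_def supp_in_def linear_cochain_def add_letters_def hom_letters_def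
      alternating_def add_values_def hom_values_def fun_eq_iff)
qed

lemma cochains_0_shift:
  assumes "supp_in 0 E"
  shows "shift X (fst E) = 0" "shift X (snd E) = 0" "twist (snd E) = snd E" "twist (fst E) = fst E"
  using assms by (auto simp: supp_in_def shift_def twist_def fun_eq_iff psign_def dest!: odd_pos)

text \<open>An element of degree 0 reads no letters, so the recursions collapse to composition with
  the linear map \<open>snd E []\<close>.\<close>

lemma circ_degree_0_left:
  assumes "E \<in> ml_cochains s s" "supp_in 0 E" "F \<in> ml_cochains s s"
  shows "circ E F = (\<lambda>w. snd E [] (fst F w), \<lambda>w x. snd E [] (snd F w x))"
proof -
  have f: "fst E = 0" using assms(1,2) ml_cochainsD(1)[OF assms(1)]
    by (auto simp: supp_in_def fun_eq_iff) (metis length_0_conv)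
  note sh = cochains_0_shift[OF assms(2)]
  have z: "snd E (X # w) = 0" for X w using assms(2) by (simp add: supp_in_def)
  have c: "shuffle_comp (snd E) P w x = snd E [] (P w x)" for P w x
    by (induction w arbitrary: P) (simp_all add: sh shuffle_comp_zero_left, simp add: shift_def)
  have i: "insertion (snd E) P w = 0" for P w
    by (induction w arbitrary: P) (simp_all add: sh insertion_zero_left z)
  have h: "last_comp (snd E) P w = snd E [] (P w)" if "w \<noteq> []" for P w
    using that
  proof (induction w arbitrary: P)
    case (Cons X w)
    then show ?case by (cases "w = []") (simp_all add: last_comp_Cons sh last_comp_zero_left, simp add: shift_def)
  qed simp
  have h0: "last_comp (snd E) (fst F) w = snd E [] (fst F w)" for w
    using h[of w "fst F"] ml_cochainsD(1)[OF assms(3)] add_values_0[OF ml_cochainsD(8)[OF assms(1)]] by (cases "w = []") auto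
  show ?thesis
    by (simp add: circ_def circ_II_def fun_eq_iff f insertion_zero_left c i h0)
qed

lemma circ_degree_0_right:
  assumes "E \<in> ml_cochains s s" "supp_in 0 E" "F \<in> ml_cochains s s"
  shows "circ F E = (insertion (fst F) (snd E), \<lambda>w x. snd F w (snd E [] x) + insertion (\<lambda>v. snd F v x) (snd E) w)"
proof -
  have f: "fst E = 0" using assms(1,2) ml_cochainsD(1)[OF assms(1)]
    by (auto simp: supp_in_def fun_eq_iff) (metis length_0_conv)
  note sh = cochains_0_shift[OF assms(2)]
  have c: "add_values P \<Longrightarrow> shuffle_comp P (snd E) w x = P w (snd E [] x)" for P :: "_ \<Rightarrow> _ \<Rightarrow> 'c::ab_group_add" and w x
    by (induction w arbitrary: P) (simp_all add: sh shuffle_comp_zero_right, simp add: shift_def)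
  show ?thesis
    using ml_cochainsD(8)[OF assms(3)]
    by (simp add: circ_def circ_II_def fun_eq_iff f last_comp_zero_right c insertion_apply[of "snd F"])
qed

lemma insertion_degree_0_Cons:
  assumes "add_letters F" "supp_in 0 E"
  shows "insertion F (snd E) (X # w) = insertion (shift X F) (snd E) w
    + (F ((snd E [] (fst X), snd X) # w) + F ((fst X, snd E [] (snd X)) # w))"
  using assms by (simp add: cochains_0_shift insertion_zero_right)

lemma shuffle_sum_maps: "shuffle_sum H (map f w) = shuffle_sum (\<lambda>S T. H (map f S) (map f T)) w"
  by (induction w arbitrary: H) simp_all

definition letter_h :: "('g \<times> 'h) \<times> ('g \<times> 'h) \<Rightarrow> 'h \<times> 'h" where
  "letter_h = (\<lambda>(u, v). (snd u, snd v))"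

definition letter_inc :: "'h \<times> 'h \<Rightarrow> ('g::zero \<times> 'h) \<times> ('g \<times> 'h)" where
  "letter_inc = (\<lambda>(\<alpha>, \<beta>). ((0, \<alpha>), (0, \<beta>)))"

lemma letter_simps [simp]: "letter_h (u, v) = (snd u, snd v)" "letter_inc (\<alpha>, \<beta>) = ((0, \<alpha>), (0, \<beta>))"
  "letter_h (letter_inc X) = X"
  by (simp_all add: letter_h_def letter_inc_def split: prod.splits)

lemma embed_cochain_simps:
  "fst (embed_cochain P) w = (fst P (map letter_h w), 0)"
  "snd (embed_cochain P) w x = (snd P (map letter_h w) (snd x), 0)"
  by (simp_all add: embed_cochain_def letter_h_def)

lemma project_cochain_simps:
  "fst (project_cochain F) w = fst (fst F (map letter_inc w))"
  "snd (project_cochain F) w x = fst (snd F (map letter_inc w) (0, x))"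
  by (simp_all add: project_cochain_def letter_inc_def)

locale cochain_splitting = G: vector_space sg + H: vector_space sh
  for sg :: "'k::field_char_0 \<Rightarrow> 'g::ab_group_add \<Rightarrow> 'g"
    and sh :: "'k \<Rightarrow> 'h::ab_group_add \<Rightarrow> 'h"
begin

abbreviation s :: "'k \<Rightarrow> 'g \<times> 'h \<Rightarrow> 'g \<times> 'h" where
  "s \<equiv> module_prod.scale sg sh"

lemma s_def: "s c x = (sg c (fst x), sh c (snd x))"
proof -
  interpret module_prod sg sh by unfold_locales
  show ?thesis by (simp add: scale_def)
qed

lemma s_vs: "vector_space s"
  by (simp add: vector_space_def s_def G.scale_right_distrib H.scale_right_distrib
      G.scale_left_distrib H.scale_left_distrib)

lemma sg_vs: "vector_space sg" and sh_vs: "vector_space sh"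
  by unfold_locales

lemma embed_ml_cochains: "P \<in> ml_cochains sh sg \<Longrightarrow> embed_cochain P \<in> ml_cochains s s"
  unfolding ml_cochains_def mem_Collect_eq add_letters_def hom_letters_def alternating_def add_values_def hom_values_def fun_eq_iff
  by (simp add: embed_cochain_simps s_def prod_eq_iff)

lemma project_ml_cochains: "F \<in> ml_cochains s s \<Longrightarrow> project_cochain F \<in> ml_cochains sh sg"
proof -
  assume F: "F \<in> ml_cochains s s"
  have p: "(0 :: 'g, x + y) = (0, x) + (0, y)" "(0, sh c x) = s c (0, x)" for x y :: 'h and c
    by (simp_all add: s_def)
  show ?thesis using ml_cochainsD[OF F]
    unfolding ml_cochains_def mem_Collect_eq add_letters_def hom_letters_def alternating_def add_values_def hom_values_def
    by (simp add: project_cochain_simps p fun_eq_iff del: add_Pair) (simp add: s_def)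
qed

lemma embed_supp_in: "supp_in n P \<Longrightarrow> supp_in n (embed_cochain P)"
  by (simp add: supp_in_def embed_cochain_simps fun_eq_iff prod_eq_iff)

lemma project_supp_in: "supp_in n F \<Longrightarrow> supp_in n (project_cochain F)"
  by (simp add: supp_in_def project_cochain_simps fun_eq_iff)

lemma embed_cochains: "P \<in> cochains sh sg n \<Longrightarrow> embed_cochain P \<in> cochains s s n"
  by (simp add: cochains_iff sg_vs sh_vs s_vs embed_ml_cochains embed_supp_in)

lemma project_cochains: "F \<in> cochains s s n \<Longrightarrow> project_cochain F \<in> cochains sh sg n"
  by (simp add: cochains_iff sg_vs sh_vs s_vs project_ml_cochains project_supp_in)

lemma embed_add: "embed_cochain (P + Q) = embed_cochain P + embed_cochain Q" for P Q :: "('h, 'g) cochain"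
  by (simp add: prod_eq_iff fun_eq_iff embed_cochain_simps)

lemma embed_scale: "embed_cochain (cochain_scale sg c P) = cochain_scale s c (embed_cochain P)"
  by (simp add: prod_eq_iff fun_eq_iff embed_cochain_simps cochain_scale_def s_def)

lemma project_add: "project_cochain (P + Q) = project_cochain P + project_cochain Q"
  by (simp add: prod_eq_iff fun_eq_iff project_cochain_simps)

lemma project_scale: "project_cochain (cochain_scale s c P) = cochain_scale sg c (project_cochain P)"
  by (simp add: prod_eq_iff fun_eq_iff project_cochain_simps cochain_scale_def s_def)

lemma project_psign: "project_cochain (psign n P) = psign n (project_cochain P)"
  by (simp add: prod_eq_iff fun_eq_iff project_cochain_simps psign_def)

lemma project_diff: "project_cochain (P - Q) = project_cochain P - project_cochain Q"
  by (simp add: prod_eq_iff fun_eq_iff project_cochain_simps)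

text \<open>Elements of \<open>a\<close> have values in \<open>g\<close> and vanish on inputs from
  \<open>g\<close>, so the output of one never feeds the other.\<close>

lemma circ_embed:
  assumes P: "P \<in> ml_cochains sh sg" and Q: "Q \<in> ml_cochains sh sg"
  shows "circ (embed_cochain P) (embed_cochain Q) = 0"
proof -
  let ?P = "embed_cochain P" and ?Q = "embed_cochain Q"
  note Pd = ml_cochainsD[OF embed_ml_cochains[OF P]]
  have z: "snd ?P w (a, 0) = 0" for w a
    using add_values_0[OF ml_cochainsD(8)[OF P]] by (simp add: embed_cochain_simps zero_prod_def)
  have c: "shuffle_comp (snd ?P) (snd ?Q) w x = 0" for w x
    by (simp add: shuffle_comp_shuffle_sum[OF Pd(8)] embed_cochain_simps(2)[of Q] z shuffle_sum_zero)
  have h: "last_comp (snd ?P) (fst ?Q) w = 0" for w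
    by (cases w rule: rev_cases)
      (simp_all add: last_comp_shuffle_sum[OF Pd(8)] embed_cochain_simps(1)[of Q] z shuffle_sum_zero)
  have i1: "insertion (fst ?P) (snd ?Q) w = 0" for w
    by (simp add: insertion_shuffle_sum[OF Pd(2)] embed_cochain_simps add_letters_0_mid[OF ml_cochainsD(2)[OF P]]
        shuffle_sum_zero zero_prod_def[symmetric])
  have i2: "insertion (snd ?P) (snd ?Q) w x = 0" for w x
    unfolding insertion_apply[of "snd ?P"] insertion_shuffle_sum[OF add_letters_apply[OF Pd(5)]]
    by (simp add: embed_cochain_simps add_letters_0_mid[OF ml_cochainsD(5)[OF P]] shuffle_sum_zero zero_prod_def[symmetric])
  show ?thesis by (simp add: circ_def circ_II_def prod_eq_iff fun_eq_iff c h i1 i2)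
qed

text \<open>All inputs lie in \<open>h\<close>, and the output is projected to \<open>g\<close>. The
  output of \<open>B\<close> is split into its two parts: for the part in \<open>h\<close> the outer
  map sees only inputs from \<open>h\<close> and may be replaced by its projection; keeping the part
  in \<open>g\<close> replaces \<open>B\<close> by its projection.\<close>

lemma project_circ:
  assumes A: "A \<in> ml_cochains s s" and B: "B \<in> ml_cochains s s"
  shows "project_cochain (circ A B) = project_cochain (circ (embed_cochain (project_cochain A)) B)
    + project_cochain (circ A (embed_cochain (project_cochain B)))"
proof -
  let ?A = "embed_cochain (project_cochain A)" and ?B = "embed_cochain (project_cochain B)"
  let ?m = "map letter_inc :: ('h \<times> 'h) list \<Rightarrow> (('g \<times> 'h) \<times> ('g \<times> 'h)) list"
  have A': "?A \<in> ml_cochains s s" and B': "?B \<in> ml_cochains s s"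
    using A B by (simp_all add: embed_ml_cochains project_ml_cochains)
  note Ad = ml_cochainsD[OF A] and A'd = ml_cochainsD[OF A']
  have hm: "map letter_h (?m w) = w" for w by (simp add: comp_def)
  have split: "z = (fst z, 0) + (0, snd z)" for z :: "'g \<times> 'h" by simp
  have fz: "fst (z + w) = fst z + fst w" for z w :: "'g \<times> 'h" by simp
  have c1: "fst (snd A (?m S) z) = fst (snd ?A (?m S) z) + fst (snd A (?m S) (fst z, 0))" for S z
    by (subst split[of z], subst add_valuesD[OF Ad(8)])
      (simp add: embed_cochain_simps project_cochain_simps hm del: map_map)
  have B1: "snd ?B (?m T) (0, x) = (fst (snd B (?m T) (0, x)), 0)" "fst ?B (?m T) = (fst (fst B (?m T)), 0)" for T x
    by (simp_all add: embed_cochain_simps project_cochain_simps hm del: map_map)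
  have comp: "fst (shuffle_comp (snd A) (snd B) (?m w) (0, x)) =
      fst (shuffle_comp (snd ?A) (snd B) (?m w) (0, x)) + fst (shuffle_comp (snd A) (snd ?B) (?m w) (0, x))" for w x
    unfolding shuffle_comp_shuffle_sum[OF Ad(8)] shuffle_comp_shuffle_sum[OF A'd(8)] shuffle_sum_maps
      shuffle_sum_map[of fst, OF fz, symmetric] shuffle_sum_add[symmetric] B1
    by (subst c1) (rule refl)
  have half: "fst (last_comp (snd A) (fst B) (?m w)) =
      fst (last_comp (snd ?A) (fst B) (?m w)) + fst (last_comp (snd A) (fst ?B) (?m w))" for w
  proof (cases w rule: rev_cases)
    case (snoc u X)
    have m: "?m T @ [letter_inc X] = ?m (T @ [X])" for T by simp
    have d1: "fst (psign (int (length S)) (snd A (?m S) z)) = fst (psign (int (length S)) (snd ?A (?m S) z))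
        + fst (psign (int (length S)) (snd A (?m S) (fst z, 0)))" for S z
      using c1[of S z] by (simp add: psign_def)
    show ?thesis
      unfolding snoc map_append list.map last_comp_shuffle_sum[OF Ad(8)] last_comp_shuffle_sum[OF A'd(8)] shuffle_sum_maps
        shuffle_sum_map[of fst, OF fz, symmetric] shuffle_sum_add[symmetric] length_map
      unfolding m B1 by (subst d1) (rule refl)
  qed simp
  \<comment> \<open>The same splitting at the entry that takes up the output of \<open>B\<close>;
    \<open>F\<close> stands for either component of \<open>A\<close>.\<close>
  have ins: "fst (insertion F (snd B) (?m w)) =
      fst (insertion F' (snd B) (?m w)) + fst (insertion F (snd ?B) (?m w))"
    if F: "add_letters F" "add_letters F'" "\<And>v. F' v = (fst (F (?m (map letter_h v))), 0)"
    for F F' :: "(('g \<times> 'h) \<times> ('g \<times> 'h)) list \<Rightarrow> 'g \<times> 'h" and w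
  proof -
    have f: "fst (F (?m u @ (z, (0, y)) # ?m v)) = fst (F' (?m u @ (z, (0, y)) # ?m v)) + fst (F (?m u @ ((fst z, 0), (0, y)) # ?m v))"
      "fst (F (?m u @ ((0, y), z) # ?m v)) = fst (F' (?m u @ ((0, y), z) # ?m v)) + fst (F (?m u @ ((0, y), (fst z, 0)) # ?m v))"
      for u v y z
    proof -
      have "F (?m u @ (z, (0, y)) # ?m v) = F (?m u @ ((fst z, 0), (0, y)) # ?m v) + F (?m u @ ((0, snd z), (0, y)) # ?m v)"
        "F (?m u @ ((0, y), z) # ?m v) = F (?m u @ ((0, y), (fst z, 0)) # ?m v) + F (?m u @ ((0, y), (0, snd z)) # ?m v)"
        using F(1) split[of z] unfolding add_letters_def by metis+
      then show "fst (F (?m u @ (z, (0, y)) # ?m v)) = fst (F' (?m u @ (z, (0, y)) # ?m v)) + fst (F (?m u @ ((fst z, 0), (0, y)) # ?m v))"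
      "fst (F (?m u @ ((0, y), z) # ?m v)) = fst (F' (?m u @ ((0, y), z) # ?m v)) + fst (F (?m u @ ((0, y), (fst z, 0)) # ?m v))"
        unfolding F(3) by (simp_all add: comp_def)
    qed
    let ?H = "\<lambda>F G j S T. fst (F (S @ (G T (fst (?m w ! j)), snd (?m w ! j)) # drop (Suc j) (?m w))
     + F (S @ (fst (?m w ! j), G T (snd (?m w ! j))) # drop (Suc j) (?m w)))"
    have j: "shuffle_sum (?H F (snd B) j) (take j (?m w)) =
      shuffle_sum (?H F' (snd B) j) (take j (?m w)) + shuffle_sum (?H F (snd ?B) j) (take j (?m w))"
      if "j < length w" for j
    proof -
      obtain a b where ab: "w ! j = (a, b)" by (cases "w ! j")
      have n: "?m w ! j = ((0, a), (0, b))" using that ab by simp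
      show ?thesis
        unfolding take_map drop_map shuffle_sum_maps shuffle_sum_add[symmetric] n fst_conv snd_conv B1 fz
        by (subst f(1), subst f(2)) (simp add: add_ac)
    qed
    have e: "fst (insertion K K' (?m w)) = (\<Sum>j<length w. shuffle_sum (?H K K' j) (take j (?m w)))"
      if "add_letters K" for K :: "_ \<Rightarrow> 'g \<times> 'h" and K'
      unfolding insertion_shuffle_sum[OF that] fst_sum length_map
      by (intro sum.cong refl) (subst shuffle_sum_map[of fst, OF fz], rule refl)
    show ?thesis unfolding e[OF F(1)] e[OF F(2)] sum.distrib[symmetric]
      by (intro sum.cong refl j) simp
  qed
  have i1: "fst (insertion (fst A) (snd B) (?m w)) =
      fst (insertion (fst ?A) (snd B) (?m w)) + fst (insertion (fst A) (snd ?B) (?m w))" for w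
    by (rule ins[OF Ad(2) A'd(2)]) (simp add: embed_cochain_simps project_cochain_simps)
  have i2: "fst (insertion (snd A) (snd B) (?m w) (0, x)) =
      fst (insertion (snd ?A) (snd B) (?m w) (0, x)) + fst (insertion (snd A) (snd ?B) (?m w) (0, x))" for w x
    unfolding insertion_apply[of _ _ _ "(0, x)"]
    by (rule ins[OF add_letters_apply[OF Ad(5)] add_letters_apply[OF A'd(5)]]) (simp add: embed_cochain_simps project_cochain_simps)
  show ?thesis
    by (simp add: prod_eq_iff fun_eq_iff project_cochain_simps circ_def circ_II_def comp half i1 i2 add_ac)
qed

end

section \<open>Cochains as a graded vector space and as data for derived brackets\<close>

lemma vector_space_cochain_scale: "vector_space t \<Longrightarrow> vector_space (cochain_scale t)"
proof -
  assume "vector_space t"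
  then interpret vector_space t .
  show ?thesis
    by (simp add: vector_space_def cochain_scale_def prod_eq_iff fun_eq_iff scale_right_distrib scale_left_distrib)
qed

lemma supp_in_closed:
  "supp_in n 0" "supp_in n P \<Longrightarrow> supp_in n Q \<Longrightarrow> supp_in n (P + Q)"
  "vector_space t \<Longrightarrow> supp_in n P \<Longrightarrow> supp_in n (cochain_scale t c P)"
  by (auto simp: supp_in_def cochain_scale_def fun_eq_iff)

lemma subspace_ml_cochains:
  assumes t: "vector_space t"
  shows "module.subspace (cochain_scale t) (ml_cochains s t)"
proof -
  interpret V: vector_space "cochain_scale t" by (rule vector_space_cochain_scale[OF t])
  show ?thesis by (intro V.subspaceI ml_cochains_0 ml_cochains_add ml_cochains_scale t)
qed

lemma subspace_cochain_grading:
  assumes s: "vector_space s" and t: "vector_space t"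
  shows "module.subspace (cochain_scale t) (cochain_grading s t n)"
proof -
  interpret V: vector_space "cochain_scale t" by (rule vector_space_cochain_scale[OF t])
  show ?thesis
  proof (cases "n < 0")
    case True
    then show ?thesis by (simp add: cochain_grading_def)
  next
    case False
    then show ?thesis
      by (intro V.subspaceI)
        (auto simp: cochain_grading_def cochains_iff[OF s t] intro: ml_cochains_0 ml_cochains_add ml_cochains_scale t supp_in_closed)
  qed
qed

text \<open>At a word of length \<open>n\<close> only the summand of degree \<open>n\<close> can be
  non-zero; this gives independence.\<close>

lemma graded_vector_space_cochains:
  assumes s: "vector_space s" and t: "vector_space t"
  shows "graded_vector_space (cochain_scale t) (cochain_grading s t)"
proof -
  interpret V: vector_space "cochain_scale t" by (rule vector_space_cochain_scale[OF t])
  show ?thesis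
  proof
    show "V.subspace (cochain_grading s t n)" for n by (rule subspace_cochain_grading[OF s t])
    show "v n = 0" if F: "finite F" "\<And>n. n \<in> F \<Longrightarrow> v n \<in> cochain_grading s t n" "(\<Sum>n\<in>F. v n) = 0" "n \<in> F" for F v n
    proof (cases "n < 0")
      case True
      then show ?thesis using F(2)[OF F(4)] by (simp add: cochain_grading_def)
    next
      case False
      have z: "fst (v m) w = 0" "snd (v m) w = 0" if "m \<in> F" "int (length w) \<noteq> m" for m w
        using F(2)[OF that(1)] that(2)
        by (auto simp: cochain_grading_def cochains_iff[OF s t] supp_in_def split: if_splits)
      have "fst (v n) w = 0" for w
      proof (cases "int (length w) = n")
        case True
        have "(\<Sum>m\<in>F. fst (v m) w) = fst (\<Sum>m\<in>F. v m) w" by (simp add: fst_sum fun_sum_apply)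
        then have "0 = (\<Sum>m\<in>F. fst (v m) w)" using F(3) by simp
        also have "\<dots> = (\<Sum>m\<in>F. if m = n then fst (v n) w else 0)"
          using True z by (intro sum.cong) auto
        finally show ?thesis using F by simp
      qed (use z F in auto)
      moreover have "snd (v n) w x = 0" for w x
      proof (cases "int (length w) = n")
        case True
        have "(\<Sum>m\<in>F. snd (v m) w x) = snd (\<Sum>m\<in>F. v m) w x" by (simp add: snd_sum fun_sum_apply)
        then have "0 = (\<Sum>m\<in>F. snd (v m) w x)" using F(3) by simp
        also have "\<dots> = (\<Sum>m\<in>F. if m = n then snd (v n) w x else 0)"
          using True z by (intro sum.cong) auto
        finally show ?thesis using F by simp
      qed (use z F in auto)
      ultimately show ?thesis by (simp add: prod_eq_iff fun_eq_iff)
    qed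
  qed
qed

context cochain_splitting
begin

lemma embed_0: "embed_cochain (0 :: ('h, 'g) cochain) = 0"
  by (simp add: prod_eq_iff fun_eq_iff embed_cochain_simps)

lemma project_0: "project_cochain (0 :: ('g \<times> 'h, 'g \<times> 'h) cochain) = 0"
  by (simp add: prod_eq_iff fun_eq_iff project_cochain_simps)

lemma embed_grading: "u \<in> cochain_grading sh sg n \<Longrightarrow> embed_cochain u \<in> cochain_grading s s n"
  by (auto simp: cochain_grading_def embed_0 embed_cochains split: if_splits)

lemma project_grading: "F \<in> cochain_grading s s n \<Longrightarrow> project_cochain F \<in> cochain_grading sh sg n"
  by (auto simp: cochain_grading_def project_0 project_cochains split: if_splits)

lemma grading_ml_cochains: "F \<in> cochain_grading s s n \<Longrightarrow> F \<in> ml_cochains s s"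
  by (rule cochain_grading_ml_cochains[OF s_vs s_vs])

lemma ly_bracket_embed:
  assumes "u \<in> cochain_grading sh sg m" "v \<in> cochain_grading sh sg n"
  shows "ly_bracket s (embed_cochain u) (embed_cochain v) = 0"
proof (cases "u = 0 \<or> v = 0")
  case True
  then show ?thesis
    using ly_bracket_0[OF s_vs grading_ml_cochains[OF embed_grading[OF assms(1)]]]
      ly_bracket_0[OF s_vs grading_ml_cochains[OF embed_grading[OF assms(2)]]] embed_0 by auto
next
  case False
  then obtain p q where p: "u \<in> cochains sh sg p" and q: "v \<in> cochains sh sg q"
    using assms by (metis cochain_grading_cases)
  then have "u \<in> ml_cochains sh sg" "v \<in> ml_cochains sh sg" by (simp_all add: cochains_iff sg_vs sh_vs)
  then show ?thesis
    by (simp add: ly_bracket_circ[OF s_vs embed_cochains[OF p] embed_cochains[OF q]] circ_embed)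
qed

lemma project_ly_bracket:
  assumes X: "X \<in> cochain_grading s s m" and Y: "Y \<in> cochain_grading s s n"
  shows "project_cochain (ly_bracket s X Y) =
    project_cochain (ly_bracket s (embed_cochain (project_cochain X)) Y) +
    project_cochain (ly_bracket s X (embed_cochain (project_cochain Y)))"
proof (cases "X = 0 \<or> Y = 0")
  case True
  note m = grading_ml_cochains[OF X] grading_ml_cochains[OF Y] grading_ml_cochains[OF embed_grading[OF project_grading[OF X]]]
    grading_ml_cochains[OF embed_grading[OF project_grading[OF Y]]]
  show ?thesis using True
    ly_bracket_0[OF s_vs m(1)] ly_bracket_0[OF s_vs m(2)] ly_bracket_0[OF s_vs m(3)] ly_bracket_0[OF s_vs m(4)]
    by (auto simp: embed_0 project_0)
next
  case False
  then obtain p q where p: "X \<in> cochains s s p" and q: "Y \<in> cochains s s q"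
    using assms by (metis cochain_grading_cases)
  then have M: "X \<in> ml_cochains s s" "Y \<in> ml_cochains s s" by (simp_all add: cochains_iff s_vs)
  note p' = embed_cochains[OF project_cochains[OF p]] and q' = embed_cochains[OF project_cochains[OF q]]
  show ?thesis
    unfolding ly_bracket_circ[OF s_vs p q] ly_bracket_circ[OF s_vs p' q] ly_bracket_circ[OF s_vs p q']
      project_diff project_psign
    by (subst project_circ[OF M(1) M(2)], subst project_circ[OF M(2) M(1)]) (simp add: psign_add)
qed

sublocale D: derived_setting "cochain_scale s" "cochain_scale sg" "cochain_grading sh sg"
  "cochain_grading s s" "ml_cochains s s" "ly_bracket s" embed_cochain project_cochain
proof -
  interpret L: vector_space "cochain_scale s" by (rule vector_space_cochain_scale[OF s_vs])
  interpret A: graded_vector_space "cochain_scale sg" "cochain_grading sh sg"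
    by (rule graded_vector_space_cochains[OF sh_vs sg_vs])
  show "derived_setting (cochain_scale s) (cochain_scale sg) (cochain_grading sh sg)
    (cochain_grading s s) (ml_cochains s s) (ly_bracket s) embed_cochain project_cochain"
  proof (intro derived_setting.intro derived_setting_axioms.intro)
    show "vector_space (cochain_scale s)" by (rule L.vector_space_axioms)
    show "graded_vector_space (cochain_scale sg) (cochain_grading sh sg)" by (rule A.graded_vector_space_axioms)
    show "L.subspace (ml_cochains s s)" by (rule subspace_ml_cochains[OF s_vs])
    show "L.subspace (cochain_grading s s n)" for n by (rule subspace_cochain_grading[OF s_vs s_vs])
    show "cochain_grading s s n \<subseteq> ml_cochains s s" for n using grading_ml_cochains by blast
    show "Vector_Spaces.linear (cochain_scale sg) (cochain_scale s) (embed_cochain :: ('h, 'g) cochain \<Rightarrow> _)"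
      by (simp add: Vector_Spaces.linear_iff L.vector_space_axioms A.vector_space_axioms embed_add embed_scale)
    show "Vector_Spaces.linear (cochain_scale s) (cochain_scale sg) (project_cochain :: _ \<Rightarrow> ('h, 'g) cochain)"
      by (simp add: Vector_Spaces.linear_iff L.vector_space_axioms A.vector_space_axioms project_add project_scale)
  qed (fact ly_bracket_ml_cochains[OF s_vs] ly_bracket_add[OF s_vs] ly_bracket_scale[OF s_vs]
      ly_bracket_grading[OF s_vs] ly_bracket_antisym[OF s_vs] ly_bracket_jacobi[OF s_vs] embed_grading
      project_grading ly_bracket_embed project_ly_bracket)+
qed

text \<open>
  Bracketing with the projection onto \<open>g\<close> multiplies a cochain by its weight, the number of
  inputs from \<open>g\<close> minus \<open>1\<close> if the output lies in \<open>g\<close>.  Weights are at least \<open>-1\<close> and elements of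
  \<open>a\<close> have weight \<open>-1\<close>; those of the structure cochain are \<open>0, 1, 2\<close>, because \<open>g\<close> and \<open>h\<close> are
  subalgebras.  So four brackets with elements of \<open>a\<close> annihilate it.
\<close>

definition proj_cochain :: "('g \<times> 'h, 'g \<times> 'h) cochain" where
  "proj_cochain = linear_cochain (\<lambda>x. (fst x, 0))"

lemma proj_cochain_cochains: "proj_cochain \<in> cochains s s 0"
  unfolding proj_cochain_def by (rule linear_cochain_cochains) (simp add: Vector_Spaces.linear_iff s_vs s_def)

lemma proj_cochain_ml_cochains: "proj_cochain \<in> ml_cochains s s" "supp_in 0 proj_cochain"
  using proj_cochain_cochains by (simp_all add: cochains_iff s_vs)

lemma proj_cochain_grading: "proj_cochain \<in> cochain_grading s s 0"
  using proj_cochain_cochains by (simp add: cochain_grading_def)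

lemma proj_cochain_simp: "snd proj_cochain [] x = (fst x, 0)"
  by (simp add: proj_cochain_def linear_cochain_def)

text \<open>The number counts whether the vector is taken from \<open>g\<close>. It is a relation
  rather than a function: the zero vector counts either way, which is harmless since multilinear
  maps vanish on it.\<close>

inductive pure :: "'g \<times> 'h \<Rightarrow> nat \<Rightarrow> bool" where
  "pure (x, 0) 1"
| "pure (0, \<alpha>) 0"

inductive pure_word :: "(('g \<times> 'h) \<times> ('g \<times> 'h)) list \<Rightarrow> nat \<Rightarrow> bool" where
  "pure_word [] 0"
| "pure x i \<Longrightarrow> pure y j \<Longrightarrow> pure_word w n \<Longrightarrow> pure_word ((x, y) # w) (i + j + n)"

text \<open>The projection reproduces an entry from \<open>g\<close> and kills one from
  \<open>h\<close>, so the sum over all entries counts those from \<open>g\<close>.\<close>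

lemma insertion_proj_cochain:
  fixes F :: "(('g \<times> 'h) \<times> ('g \<times> 'h)) list \<Rightarrow> 'g \<times> 'h"
  shows "pure_word w n \<Longrightarrow> add_letters F \<Longrightarrow> insertion F (snd proj_cochain) w = s (of_nat n) (F w)"
proof (induction arbitrary: F rule: pure_word.induct)
  case 1
  then show ?case by (simp add: s_def prod_eq_iff)
next
  case (2 x i y j w n)
  have z: "F (((0, 0), y) # w) = 0" "F ((x, (0, 0)) # w) = 0"
    by (simp_all add: zero_prod_def[symmetric] add_letters_0[OF 2(5)])
  have s01: "s 0 v = 0" "s 1 v = v" for v by (simp_all add: s_def prod_eq_iff)
  have "F (((fst x, 0), y) # w) = s (of_nat i) (F ((x, y) # w))"
    using 2(1) by cases (use z in \<open>simp_all add: s01\<close>)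
  moreover have "F ((x, (fst y, 0)) # w) = s (of_nat j) (F ((x, y) # w))"
    using 2(2) by cases (use z in \<open>simp_all add: s01\<close>)
  moreover have "insertion (shift (x, y) F) (snd proj_cochain) w = s (of_nat n) (F ((x, y) # w))"
    using 2(4)[OF add_letters_shift[OF 2(5), of "(x, y)"]] unfolding shift_def[of "(x, y)" F w] .
  ultimately show ?case
    unfolding insertion_degree_0_Cons[OF 2(5) proj_cochain_ml_cochains(2)]
    by (simp add: proj_cochain_simp s_def G.scale_left_distrib H.scale_left_distrib prod_eq_iff add_ac)
qed

text \<open>The operator "weight plus \<open>c\<close>". Compositions of such operators serve as
  polynomials in the weight, in place of a decomposition of cochains into weight components.\<close>

definition weight_op :: "'k \<Rightarrow> ('g \<times> 'h, 'g \<times> 'h) cochain \<Rightarrow> ('g \<times> 'h, 'g \<times> 'h) cochain" where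
  "weight_op c X = ly_bracket s X proj_cochain + cochain_scale s c X"

lemma weight_op_grading: "X \<in> cochain_grading s s n \<Longrightarrow> weight_op c X \<in> cochain_grading s s n"
  unfolding weight_op_def using D.br_GL[OF _ proj_cochain_grading, of X n] by (intro D.GL_closed) simp_all

lemma weight_op_pure:
  assumes F: "F \<in> cochains s s p" and w: "pure_word w n"
  shows "fst (weight_op c F) w = (sg (of_nat n - 1 + c) (fst (fst F w)), sh (of_nat n + c) (snd (fst F w)))"
    and "pure x i \<Longrightarrow> snd (weight_op c F) w x =
      (sg (of_nat (n + i) - 1 + c) (fst (snd F w x)), sh (of_nat (n + i) + c) (snd (snd F w x)))"
proof -
  have M: "F \<in> ml_cochains s s" using F by (simp add: cochains_iff s_vs)
  have b: "ly_bracket s F proj_cochain = circ F proj_cochain - circ proj_cochain F"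
    using ly_bracket_circ[OF s_vs F proj_cochain_cochains] by simp
  note e = circ_degree_0_left[OF proj_cochain_ml_cochains M] circ_degree_0_right[OF proj_cochain_ml_cochains M]
  show "fst (weight_op c F) w = (sg (of_nat n - 1 + c) (fst (fst F w)), sh (of_nat n + c) (snd (fst F w)))"
    unfolding weight_op_def b e
    by (simp add: insertion_proj_cochain[OF w ml_cochainsD(2)[OF M]] proj_cochain_simp cochain_scale_def s_def prod_eq_iff
        G.scale_left_distrib H.scale_left_distrib G.scale_left_diff_distrib)
  assume x: "pure x i"
  have "snd F w (fst x, 0) = s (of_nat i) (snd F w x)"
    using x by cases (simp_all add: s_def add_values_0[OF ml_cochainsD(8)[OF M], unfolded zero_prod_def])
  then show "snd (weight_op c F) w x =
      (sg (of_nat (n + i) - 1 + c) (fst (snd F w x)), sh (of_nat (n + i) + c) (snd (snd F w x)))"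
    unfolding weight_op_def b e
    by (simp add: insertion_proj_cochain[OF w add_letters_apply[OF ml_cochainsD(5)[OF M]]] proj_cochain_simp cochain_scale_def s_def prod_eq_iff
        G.scale_left_distrib H.scale_left_distrib G.scale_left_diff_distrib)
qed

text \<open>Every entry is the sum of its parts in \<open>g\<close> and \<open>h\<close>, so
  additivity reduces the claim to pure words.\<close>

lemma add_letters_pure_zero:
  fixes F :: "(('g \<times> 'h) \<times> ('g \<times> 'h)) list \<Rightarrow> 'c::ab_group_add"
  shows "add_letters F \<Longrightarrow> (\<And>w n. pure_word w n \<Longrightarrow> F w = 0) \<Longrightarrow> F w = 0"
proof (induction w arbitrary: F)
  case Nil
  then show ?case using pure_word.intros(1) by blast
next
  case (Cons Z w)
  obtain a b a' b' where Z: "Z = ((a, b), (a', b'))" by (metis surj_pair)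
  have p: "F ((x, y) # w) = 0" if "pure x i" "pure y j" for x y i j
  proof -
    have "shift (x, y) F w = 0"
    proof (rule Cons.IH)
      fix v n assume "pure_word v n"
      from Cons.prems(2)[OF pure_word.intros(2)[OF that this]] show "shift (x, y) F v = 0"
        by (simp add: shift_def)
    qed (use Cons.prems(1) in simp)
    then show ?thesis by (simp add: shift_def)
  qed
  have s: "(a, b) = (a, 0) + (0, b)" "(a', b') = (a', 0) + (0, b')" by simp_all
  have q: "pure (a, 0) 1" "pure (0, b) 0" "pure (a', 0) 1" "pure (0, b') 0" by (rule pure.intros)+
  show ?case unfolding Z s add_lettersD1[OF Cons.prems(1)] add_lettersD2[OF Cons.prems(1)]
    using q by (simp add: p[OF q(1) q(3)] p[OF q(1) q(4)] p[OF q(2) q(3)] p[OF q(2) q(4)])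
qed

lemma cochain_pure_zero:
  assumes F: "F \<in> ml_cochains s s" and 1: "\<And>w n. pure_word w n \<Longrightarrow> fst F w = 0"
    and 2: "\<And>w n x i. pure_word w n \<Longrightarrow> pure x i \<Longrightarrow> snd F w x = 0"
  shows "F = 0"
proof -
  have "fst F w = 0" for w by (rule add_letters_pure_zero[OF ml_cochainsD(2)[OF F] 1])
  moreover have "snd F w x = 0" for w x
  proof -
    have p: "snd F w x = 0" if "pure x i" for x i
      by (rule add_letters_pure_zero[OF add_letters_apply[OF ml_cochainsD(5)[OF F]]]) (use 2 that in blast)
    have "snd F w ((fst x, 0) + (0, snd x)) = 0"
      unfolding add_valuesD[OF ml_cochainsD(8)[OF F]] using p[OF pure.intros(1)] p[OF pure.intros(2)] by simp
    then show ?thesis by simp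
  qed
  ultimately show ?thesis by (simp add: prod_eq_iff fun_eq_iff)
qed

text \<open>As weights are at least -1, the eigenvalues are at least \<open>k - 1\<close>; they are
  positive integers, hence non-zero in characteristic 0.\<close>

lemma weight_op_eq_0:
  assumes F: "F \<in> cochain_grading s s n" and k: "2 \<le> k" and z: "weight_op (of_nat k) F = 0"
  shows "F = 0"
  using F
proof (cases rule: cochain_grading_cases)
  case (2 p)
  have M: "F \<in> ml_cochains s s" using F by (rule grading_ml_cochains)
  have n: "of_nat m - 1 + of_nat k \<noteq> (0 :: 'k)" "of_nat m + of_nat k \<noteq> (0 :: 'k)" for m
  proof -
    have "of_nat m - 1 + of_nat k = (of_nat (m + k - 1) :: 'k)" using k by (simp add: of_nat_diff)
    also have "\<dots> \<noteq> 0" using k by (subst of_nat_eq_0_iff) simp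
    finally show "of_nat m - 1 + of_nat k \<noteq> (0 :: 'k)" .
    have "(of_nat (m + k) :: 'k) \<noteq> 0" using k by (subst of_nat_eq_0_iff) simp
    then show "of_nat m + of_nat k \<noteq> (0 :: 'k)" by simp
  qed
  show ?thesis
  proof (rule cochain_pure_zero[OF M])
    fix w m assume w: "pure_word w m"
    show "fst F w = 0"
      using weight_op_pure(1)[OF 2(2) w, of "of_nat k"] n[of m] by (simp add: z zero_prod_def prod_eq_iff)
    fix x i assume x: "pure x i"
    show "snd F w x = 0"
      using weight_op_pure(2)[OF 2(2) w x, of "of_nat k"] n[of "m + i"] by (simp add: z zero_prod_def prod_eq_iff)
  qed
qed

lemma ly_bracket_embed_proj_cochain:
  assumes "v \<in> cochain_grading sh sg n"
  shows "ly_bracket s (embed_cochain v) proj_cochain = - embed_cochain v"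
  using assms
proof (cases rule: cochain_grading_cases)
  case 1
  then show ?thesis using ly_bracket_0[OF s_vs proj_cochain_ml_cochains(1)] by (simp add: embed_0)
next
  case (2 p)
  have M: "v \<in> ml_cochains sh sg" using 2 by (simp add: cochains_iff sg_vs sh_vs)
  have z: "insertion F (snd proj_cochain) w = 0"
    if "add_letters F" "\<And>u a y v. F (u @ ((a, 0), y) # v) = 0" "\<And>u a y v. F (u @ (y, (a, 0)) # v) = 0"
    for F :: "(('g \<times> 'h) \<times> ('g \<times> 'h)) list \<Rightarrow> 'g \<times> 'h" and w
    using that
  proof (induction w arbitrary: F)
    case (Cons X w)
    have "insertion (shift X F) (snd proj_cochain) w = 0"
      by (intro Cons.IH add_letters_shift Cons.prems(1))
        (use Cons.prems(2)[of "X # u" for u] Cons.prems(3)[of "X # u" for u] in \<open>simp_all add: shift_def\<close>)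
    then show ?case unfolding insertion_degree_0_Cons[OF Cons.prems(1) proj_cochain_ml_cochains(2)]
      using Cons.prems(2)[of "[]"] Cons.prems(3)[of "[]"] by (simp add: proj_cochain_simp)
  qed simp
  note d = ml_cochainsD[OF embed_ml_cochains[OF M]]
  have "circ (embed_cochain v) proj_cochain = 0"
    unfolding circ_degree_0_right[OF proj_cochain_ml_cochains embed_ml_cochains[OF M]]
    using z[OF d(2)] z[OF add_letters_apply[OF d(5)]]
    by (simp add: prod_eq_iff fun_eq_iff proj_cochain_simp embed_cochain_simps add_letters_0_mid[OF ml_cochainsD(2)[OF M]]
        add_letters_0_mid[OF ml_cochainsD(5)[OF M]] add_values_0[OF ml_cochainsD(8)[OF M]] zero_prod_def)
  moreover have "circ proj_cochain (embed_cochain v) = embed_cochain v"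
    unfolding circ_degree_0_left[OF proj_cochain_ml_cochains embed_ml_cochains[OF M]]
    by (simp add: prod_eq_iff fun_eq_iff proj_cochain_simp embed_cochain_simps)
  ultimately show ?thesis
    using ly_bracket_circ[OF s_vs embed_cochains[OF 2(2)] proj_cochain_cochains] by simp
qed

text \<open>Weights add under the bracket and elements of \<open>a\<close> have weight -1, for which
  the constant is raised by one.\<close>

lemma weight_op_br:
  assumes X: "X \<in> cochain_grading s s m" and v: "v \<in> cochain_grading sh sg n"
  shows "weight_op (c + 1) (ly_bracket s X (embed_cochain v)) = ly_bracket s (weight_op c X) (embed_cochain v)"
proof -
  let ?v = "embed_cochain v"
  have M: "X \<in> ml_cochains s s" "?v \<in> ml_cochains s s" "ly_bracket s X proj_cochain \<in> ml_cochains s s"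
    using grading_ml_cochains[OF X] grading_ml_cochains[OF embed_grading[OF v]]
    by (auto intro: D.br_M proj_cochain_ml_cochains)
  have "ly_bracket s (ly_bracket s X ?v) proj_cochain = - ly_bracket s X ?v + ly_bracket s (ly_bracket s X proj_cochain) ?v"
    using D.br_jacobi[OF X embed_grading[OF v] proj_cochain_grading] D.br_scale_right[OF M(2,1), of "- 1"]
    by (simp add: ly_bracket_embed_proj_cochain[OF v] cochain_scale_m1[OF s_vs])
  moreover have "ly_bracket s (weight_op c X) ?v = ly_bracket s (ly_bracket s X proj_cochain) ?v + cochain_scale s c (ly_bracket s X ?v)"
    unfolding weight_op_def using M by (simp add: D.br_add_left D.br_scale_left D.M_closed)
  ultimately show ?thesis
    by (simp add: weight_op_def D.L.scale_left_distrib)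
qed

lemma weight_op_iterate:
  "X \<in> cochain_grading s s m \<Longrightarrow> (\<And>v. v \<in> set vs \<Longrightarrow> \<exists>d. v \<in> cochain_grading sh sg d) \<Longrightarrow>
    weight_op (c + of_nat (length vs)) (D.iterate X vs) = D.iterate (weight_op c X) vs \<and> (\<exists>d. D.iterate X vs \<in> cochain_grading s s d)"
proof (induction vs arbitrary: X c m)
  case (Cons v vs)
  obtain d where d: "v \<in> cochain_grading sh sg d" using Cons.prems(2)[of v] by auto
  have "ly_bracket s X (embed_cochain v) \<in> cochain_grading s s (m + d)"
    by (intro D.br_GL Cons.prems embed_grading d)
  from Cons.IH[OF this, of "c + 1"] show ?case
    using Cons.prems weight_op_br[OF Cons.prems(1) d, of c] by (simp add: add_ac)
qed auto

text \<open>The cubic polynomial in the weight that annihilates \<Theta> has the roots 0, 1, 2. Four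
  brackets move them to -4, -3, -2, below every possible weight, so its factors can be cancelled one
  after the other.\<close>

lemma iterate_4_eq_0:
  assumes T: "\<Theta> \<in> cochain_grading s s 1" "weight_op 0 (weight_op (- 1) (weight_op (- 2) \<Theta>)) = 0"
    and vs: "length vs = 4" "\<And>v. v \<in> set vs \<Longrightarrow> \<exists>d. v \<in> cochain_grading sh sg d"
  shows "D.iterate \<Theta> vs = 0"
proof -
  have w: "weight_op (c + 4) (D.iterate X vs) = D.iterate (weight_op c X) vs" "\<exists>d. D.iterate X vs \<in> cochain_grading s s d"
    if "X \<in> cochain_grading s s 1" for X c
    using weight_op_iterate[OF that, of vs c] vs by auto
  have m: "embed_cochain ` set vs \<subseteq> ml_cochains s s" using vs(2) D.emb_M by blast
  note T1 = weight_op_grading[OF T(1), of "- 2"]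
  note T2 = weight_op_grading[OF T1, of "- 1"]
  have e: "D.iterate X vs = 0"
    if "X \<in> cochain_grading s s 1" "c + 4 = of_nat k" "2 \<le> k" "D.iterate (weight_op c X) vs = 0" for X c k
    using w[OF that(1)] weight_op_eq_0[OF _ that(3), of "D.iterate X vs"] that(2,4) by metis
  have "D.iterate (weight_op (- 1) (weight_op (- 2) \<Theta>)) vs = 0"
    using T(2) D.iterate_0[OF m] by (intro e[OF T2, of 0 4]) simp_all
  then have "D.iterate (weight_op (- 2) \<Theta>) vs = 0" by (intro e[OF T1, of "- 1" 3]) simp_all
  then show ?thesis by (intro e[OF T(1), of "- 2" 2]) simp_all
qed

text \<open>With \<open>n\<close> inputs from \<open>g\<close>, an output in \<open>g\<close> has
  weight \<open>n - 1\<close> and one in \<open>h\<close> has weight \<open>n\<close>. The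
  assumptions on the two summands exclude the extreme values -1 and 3.\<close>

lemma weight_op_structure_cochain:
  assumes ly: "lie_yamaguti_algebra s br tri"
    and g: "\<And>a b. snd (br (a, 0) (b, 0)) = 0" "\<And>a b c. snd (tri (a, 0) (b, 0) (c, 0)) = 0"
    and h: "\<And>a b. fst (br (0, a) (0, b)) = 0" "\<And>a b c. fst (tri (0, a) (0, b) (0, c)) = 0"
  shows "weight_op 0 (weight_op (- 1) (weight_op (- 2) (structure_cochain br tri))) = 0"
proof -
  let ?P = "structure_cochain br tri"
  have P: "?P \<in> cochain_grading s s 1"
    using structure_cochain_cochains[OF ly] by (simp add: cochain_grading_def)
  have c: "F \<in> cochains s s 1" if "F \<in> cochain_grading s s 1" for F
    using that by (simp add: cochain_grading_def)
  note P1 = weight_op_grading[OF P, of "- 2"]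
  note P2 = weight_op_grading[OF P1, of "- 1"]
  note P3 = weight_op_grading[OF P2, of 0]
  have f: "fst ?P w = (case w of [Z] \<Rightarrow> br (fst Z) (snd Z) | _ \<Rightarrow> 0)"
    "snd ?P w x = (case w of [Z] \<Rightarrow> tri (fst Z) (snd Z) x | _ \<Rightarrow> 0)" for w x
    by (auto simp: structure_cochain_def split: list.splits)
  \<comment> \<open>For the binary operation only weight -1 has to be excluded, at
    \<open>n = 0\<close>; an output in \<open>h\<close> for \<open>n = 2\<close> would have the
    admissible weight 2.\<close>
  have 1: "n = 0 \<and> fst (fst ?P w) = 0 \<or> n = 1 \<or> n = 2 \<or> fst ?P w = 0" if "pure_word w n" for w n
    using that
  proof (cases rule: pure_word.cases)
    case (2 x i y j v m)
    show ?thesis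
    proof (cases "v = []")
      case True
      then have "m = 0" using 2(5) by (auto elim: pure_word.cases)
      then show ?thesis using 2(3,4) True unfolding 2(1,2)
        by (elim pure.cases) (simp_all add: f g h)
    next
      case False
      then show ?thesis unfolding 2(1) by (cases v) (simp_all add: f)
    qed
  qed (simp add: f)
  \<comment> \<open>For the ternary operation weight 3 has to be excluded as well, at three inputs
    from \<open>g\<close>.\<close>
  have 2: "n + i = 0 \<and> fst (snd ?P w x) = 0 \<or> n + i = 1 \<or> n + i = 2 \<or> n + i = 3 \<and> snd (snd ?P w x) = 0 \<or>
      snd ?P w x = 0" if "pure_word w n" "pure x i" for w n x i
    using that(1)
  proof (cases rule: pure_word.cases)
    case (2 y j z k v m)
    show ?thesis
    proof (cases "v = []")
      case True
      then have "m = 0" using 2(5) by (auto elim: pure_word.cases)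
      then show ?thesis using 2(3,4) that(2) True unfolding 2(1,2)
        by (elim pure.cases) (simp_all add: f g h)
    next
      case False
      then show ?thesis unfolding 2(1) by (cases v) (simp_all add: f)
    qed
  qed (simp add: f)
  show ?thesis
  proof (rule cochain_pure_zero[OF grading_ml_cochains[OF P3]])
    fix w n assume w: "pure_word w n"
    show "fst (weight_op 0 (weight_op (- 1) (weight_op (- 2) ?P))) w = 0"
      using 1[OF w]
      by (elim disjE conjE) (simp_all add: weight_op_pure(1)[OF c[OF P2] w] weight_op_pure(1)[OF c[OF P1] w]
        weight_op_pure(1)[OF c[OF P] w] zero_prod_def)
    fix x i assume x: "pure x i"
    show "snd (weight_op 0 (weight_op (- 1) (weight_op (- 2) ?P))) w x = 0"
      using 2[OF w x]
      by (elim disjE conjE) (simp_all add: weight_op_pure(2)[OF c[OF P2] w x] weight_op_pure(2)[OF c[OF P1] w x]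
        weight_op_pure(2)[OF c[OF P] w x] zero_prod_def del: of_nat_add)
  qed
qed

lemma embed_linear_cochain:
  "embed_cochain (linear_cochain r :: ('h, 'g) cochain) = linear_cochain (\<lambda>x. (r (snd x), 0))"
  by (auto simp: prod_eq_iff fun_eq_iff embed_cochain_simps linear_cochain_def)

lemma ly_bracket_linear_cochain:
  assumes F: "F \<in> cochains s s 1" and f: "Vector_Spaces.linear s s f"
  shows "fst (ly_bracket s F (linear_cochain f)) [(x, y)] =
      fst F [(f x, y)] + fst F [(x, f y)] - f (fst F [(x, y)])"
    and "snd (ly_bracket s F (linear_cochain f)) [(x, y)] z =
      snd F [(f x, y)] z + snd F [(x, f y)] z + snd F [(x, y)] (f z) - f (snd F [(x, y)] z)"
proof -
  have R: "linear_cochain f \<in> cochains s s 0" by (rule linear_cochain_cochains[OF f])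
  have M: "linear_cochain f \<in> ml_cochains s s" "supp_in 0 (linear_cochain f)" "F \<in> ml_cochains s s"
    using R F by (simp_all add: cochains_iff s_vs)
  have l: "snd (linear_cochain f) [] x = f x" for x by (simp add: linear_cochain_def)
  note d = ml_cochainsD[OF M(3)]
  have b: "ly_bracket s F (linear_cochain f) = circ F (linear_cochain f) - circ (linear_cochain f) F"
    using ly_bracket_circ[OF s_vs F R] by simp
  show "fst (ly_bracket s F (linear_cochain f)) [(x, y)] =
      fst F [(f x, y)] + fst F [(x, f y)] - f (fst F [(x, y)])"
    unfolding b circ_degree_0_left[OF M] circ_degree_0_right[OF M]
    by (simp add: insertion_degree_0_Cons[OF d(2) M(2)] l del: insertion.simps(2))
  show "snd (ly_bracket s F (linear_cochain f)) [(x, y)] z =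
      snd F [(f x, y)] z + snd F [(x, f y)] z + snd F [(x, y)] (f z) - f (snd F [(x, y)] z)"
    unfolding b circ_degree_0_left[OF M] circ_degree_0_right[OF M]
    by (simp add: insertion_degree_0_Cons[OF add_letters_apply[OF d(5)] M(2)] l del: insertion.simps(2))
qed

text \<open>The inverse of the shear \<open>1 + f\<close> is \<open>1 - f\<close>. Conjugation
  applies \<open>1 + f\<close> to every input, which makes \<open>(r \<alpha>, \<alpha>)\<close> out
  of \<open>(0, \<alpha>)\<close>, and \<open>1 - f\<close> to the output, whose part in
  \<open>g\<close> becomes the difference on the right.\<close>

lemma project_exp_twist:
  assumes ly: "lie_yamaguti_algebra s br tri"
    and g: "\<And>a b. snd (br (a, 0) (b, 0)) = 0" "\<And>a b c. snd (tri (a, 0) (b, 0) (c, 0)) = 0"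
    and r: "Vector_Spaces.linear sh sg r"
  defines "T \<equiv> project_cochain (D.exp_twist (structure_cochain br tri) (linear_cochain r))"
  shows "fst T [(\<alpha>, \<beta>)] = fst (br (r \<alpha>, \<alpha>) (r \<beta>, \<beta>)) - r (snd (br (r \<alpha>, \<alpha>) (r \<beta>, \<beta>)))"
    and "snd T [(\<alpha>, \<beta>)] \<gamma> = fst (tri (r \<alpha>, \<alpha>) (r \<beta>, \<beta>) (r \<gamma>, \<gamma>)) - r (snd (tri (r \<alpha>, \<alpha>) (r \<beta>, \<beta>) (r \<gamma>, \<gamma>)))"
    and "supp_in 1 T"
proof -
  let ?P = "structure_cochain br tri"
  interpret LY: lie_yamaguti_algebra s br tri by (rule ly)
  have rl: "r (x + y) = r x + r y" "r (sh c x) = sg c (r x)" for x y c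
    using r by (auto simp: Vector_Spaces.linear_iff)
  have r0: "r 0 = 0" using rl(1)[of 0 0] by simp
  define f where "f x = (r (snd x), 0 :: 'h)" for x :: "'g \<times> 'h"
  have f: "Vector_Spaces.linear s s f"
    by (simp add: Vector_Spaces.linear_iff s_vs f_def rl s_def)
  have fa: "f (x + y) = f x + f y" "f (s c x) = s c (f x)" for x y c
    using f unfolding Vector_Spaces.linear_iff by blast+
  \<comment> \<open>No place can take \<open>f\<close> twice. The term of order \<open>n\<close> in
    the series therefore has \<open>f\<close> in \<open>n\<close> distinct places, each choice
    occurring \<open>n!\<close> times, which cancels the coefficient of the exponential.\<close>
  have ff: "f (f x) = 0" for x by (simp add: f_def r0 prod_eq_iff)
  have f0: "f 0 = 0" by (simp add: f_def r0 prod_eq_iff)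
  have fm: "f (- x) = - f x" for x using fa(2)[of "- 1" x] by simp
  have fd: "f (x - y) = f x - f y" for x y using fa(1)[of x "- y"] by (simp add: fm)
  have lin: "br (x + x') y = br x y + br x' y" "br y (x + x') = br y x + br y x'"
    "tri (x + x') y z = tri x y z + tri x' y z" "tri y (x + x') z = tri y x z + tri y x' z"
    "tri y z (x + x') = tri y z x + tri y z x'" for x x' y z
    by (simp_all add: LY.br_linear1[unfolded Vector_Spaces.linear_iff] LY.br_linear2[unfolded Vector_Spaces.linear_iff]
      LY.tri_linear1[unfolded Vector_Spaces.linear_iff] LY.tri_linear2[unfolded Vector_Spaces.linear_iff]
      LY.tri_linear3[unfolded Vector_Spaces.linear_iff])
  have lin0: "br 0 y = 0" "br y 0 = 0" "tri 0 y z = 0" "tri y 0 z = 0" "tri y z 0 = 0" for y z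
    using lin(1)[of 0 0 y] lin(2)[of y 0 0] lin(3)[of 0 0 y z] lin(4)[of y 0 0 z] lin(5)[of y z 0 0] by simp_all
  let ?R = "linear_cochain r :: ('h, 'g) cochain"
  have e: "embed_cochain ?R = linear_cochain f" by (simp add: embed_linear_cochain f_def[abs_def])
  have R: "?R \<in> cochain_grading sh sg 0"
    using linear_cochain_cochains[OF r] by (simp add: cochain_grading_def)
  have P: "?P \<in> cochains s s 1" by (rule structure_cochain_cochains[OF ly])
  define T1 T2 T3 where "T1 = ly_bracket s ?P (linear_cochain f)"
    and "T2 = ly_bracket s T1 (linear_cochain f)" and "T3 = ly_bracket s T2 (linear_cochain f)"
  have fc: "linear_cochain f \<in> cochains s s 0" by (rule linear_cochain_cochains[OF f])
  have C: "T1 \<in> cochains s s 1" "T2 \<in> cochains s s 1" "T3 \<in> cochains s s 1"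
    using ly_bracket_cochains[OF s_vs _ fc, of _ 1] P by (simp_all add: T1_def T2_def T3_def)
  have T: "T = project_cochain (?P + T1 + cochain_scale s (1 / 2) T2 + cochain_scale s (1 / 6) T3)"
    by (simp add: T_def D.exp_twist_def e T1_def T2_def T3_def)
  have "?P + T1 + cochain_scale s (1 / 2) T2 + cochain_scale s (1 / 6) T3 \<in> cochain_grading s s 1"
    using P C by (intro D.GL_closed) (simp_all add: cochain_grading_def)
  then show "supp_in 1 T"
    unfolding T by (intro project_supp_in) (simp add: cochain_grading_def cochains_iff s_vs)
  have b0: "fst ?P [(x, y)] = br x y" "snd ?P [(x, y)] z = tri x y z" for x y z
    by (simp_all add: structure_cochain_def)
  have b1: "fst T1 [(x, y)] = br (f x) y + br x (f y) - f (br x y)" for x y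
    unfolding T1_def by (simp add: ly_bracket_linear_cochain[OF P f] b0)
  have b2: "fst T2 [(x, y)] = (br (f x) (f y) - f (br (f x) y) - f (br x (f y)))
      + (br (f x) (f y) - f (br (f x) y) - f (br x (f y)))" for x y
    unfolding T2_def by (simp add: ly_bracket_linear_cochain[OF C(1) f] b1 ff lin0 fa fd f0)
  have b3: "fst T3 [(x, y)] = - (f (br (f x) (f y)) + f (br (f x) (f y)) + f (br (f x) (f y))
     + f (br (f x) (f y)) + f (br (f x) (f y)) + f (br (f x) (f y)))" for x y
    unfolding T3_def by (simp add: ly_bracket_linear_cochain[OF C(2) f] b2 ff lin0 fa fd f0)
  have t1: "snd T1 [(x, y)] z = tri (f x) y z + tri x (f y) z + tri x y (f z) - f (tri x y z)" for x y z
    unfolding T1_def by (simp add: ly_bracket_linear_cochain[OF P f] b0)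
  have t2: "snd T2 [(x, y)] z =
      (tri (f x) (f y) z + tri (f x) y (f z) + tri x (f y) (f z) - f (tri (f x) y z) - f (tri x (f y) z) - f (tri x y (f z)))
      + (tri (f x) (f y) z + tri (f x) y (f z) + tri x (f y) (f z) - f (tri (f x) y z) - f (tri x (f y) z) - f (tri x y (f z)))" for x y z
    unfolding T2_def by (simp add: ly_bracket_linear_cochain[OF C(1) f] t1 ff lin0 fa fd f0)
  define K where "K x y z = tri (f x) (f y) (f z) - f (tri (f x) (f y) z) - f (tri (f x) y (f z)) - f (tri x (f y) (f z))" for x y z
  have t3: "snd T3 [(x, y)] z = K x y z + K x y z + K x y z + K x y z + K x y z + K x y z" for x y z
    unfolding T3_def K_def by (simp add: ly_bracket_linear_cochain[OF C(2) f] t2 ff lin0 fa fd f0)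
  have half: "s (1 / 2) (x + x) = x" for x
    using LY.scale_left_distrib[of "1 / 2" "1 / 2" x] by (simp add: LY.scale_right_distrib)
  have six: "s (1 / 6) (x + x + x + x + x + x) = x" for x
  proof -
    have "x + x + x + x + x + x = s 6 x"
      using LY.scale_left_distrib[of 1 1 x] LY.scale_left_distrib[of 2 1 x] LY.scale_left_distrib[of 3 1 x]
        LY.scale_left_distrib[of 4 1 x] LY.scale_left_distrib[of 5 1 x] by simp
    then show ?thesis by simp
  qed
  \<comment> \<open>\<open>f\<close> kills \<open>g\<close>, and \<open>g\<close> is closed under
    both operations. This removes the top term of each conjugated operation: it has order three for
    the binary one, and order four, beyond the series, for the ternary one.\<close>
  have g': "f (br (f x) (f y)) = 0" "f (tri (f x) (f y) (f z)) = 0" for x y z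
    by (simp_all add: f_def g r0 prod_eq_iff)
  have x: "(r \<alpha>, \<alpha>) = (0, \<alpha>) + f (0, \<alpha>)" for \<alpha> by (simp add: f_def)
  have fx: "fst x - r (snd x) = fst (x - f x)" for x :: "'g \<times> 'h" by (simp add: f_def)
  show "fst T [(\<alpha>, \<beta>)] = fst (br (r \<alpha>, \<alpha>) (r \<beta>, \<beta>)) - r (snd (br (r \<alpha>, \<alpha>) (r \<beta>, \<beta>)))"
    unfolding T x fx project_cochain_simps
    by (simp only: list.map letter_simps fst_add plus_fun_apply cochain_scale_def fst_conv b0 b1 b2 b3 half lin fa g')
      (simp add: LY.scale_right_distrib algebra_simps)
  show "snd T [(\<alpha>, \<beta>)] \<gamma> = fst (tri (r \<alpha>, \<alpha>) (r \<beta>, \<beta>) (r \<gamma>, \<gamma>)) - r (snd (tri (r \<alpha>, \<alpha>) (r \<beta>, \<beta>) (r \<gamma>, \<gamma>)))"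
    unfolding T x fx project_cochain_simps
    by (simp only: list.map letter_simps fst_add snd_add plus_fun_apply cochain_scale_def fst_conv snd_conv b0 t1 t2 t3 half six lin fa K_def g')
      (simp add: algebra_simps)
qed

end

theorem theorem5p7:
  fixes sg :: "'k::field_char_0 \<Rightarrow> 'g::ab_group_add \<Rightarrow> 'g"
    and sh :: "'k \<Rightarrow> 'h::ab_group_add \<Rightarrow> 'h"
    and brg :: "'g \<Rightarrow> 'g \<Rightarrow> 'g" and trg :: "'g \<Rightarrow> 'g \<Rightarrow> 'g \<Rightarrow> 'g"
    and brh :: "'h \<Rightarrow> 'h \<Rightarrow> 'h" and trh :: "'h \<Rightarrow> 'h \<Rightarrow> 'h \<Rightarrow> 'h"
    and \<rho> :: "'g \<Rightarrow> 'h \<Rightarrow> 'h" and \<mu> :: "'g \<Rightarrow> 'g \<Rightarrow> 'h \<Rightarrow> 'h"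
    and \<psi> :: "'h \<Rightarrow> 'g \<Rightarrow> 'g" and \<nu> :: "'h \<Rightarrow> 'h \<Rightarrow> 'g \<Rightarrow> 'g"
    and r :: "'h \<Rightarrow> 'g"
  assumes matched_pair: "ly_matched_pair sg brg trg sh brh trh \<rho> \<mu> \<psi> \<nu>"
    and bicrossed_product: "lie_yamaguti_algebra (module_prod.scale sg sh)
      (bicrossed_br brg brh \<rho> \<psi>) (bicrossed_tri brg trg brh trh \<rho> \<mu> \<psi> \<nu>)"
    and deformation_map: "deformation_map sg brg trg sh brh trh \<rho> \<mu> \<psi> \<nu> r"
  shows "let \<Theta> = structure_cochain
                 (bicrossed_br brg brh \<rho> \<psi>) (bicrossed_tri brg trg brh trh \<rho> \<mu> \<psi> \<nu>);
             l = derived_brackets (module_prod.scale sg sh) \<Theta>;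
             l_r = twisted_brackets (cochain_scale sg) l (linear_cochain r)
         in L_infinity_algebra (cochain_scale sg) (cochain_grading sh sg) l_r \<and>
            (\<forall>r'. Vector_Spaces.linear sh sg r' \<longrightarrow>
               (deformation_map sg brg trg sh brh trh \<rho> \<mu> \<psi> \<nu> (\<lambda>\<alpha>. r \<alpha> + r' \<alpha>) \<longleftrightarrow>
                maurer_cartan (cochain_scale sg) (cochain_grading sh sg) l_r (linear_cochain r')))"
proof -
  interpret mp: ly_matched_pair sg brg trg sh brh trh \<rho> \<mu> \<psi> \<nu> by (rule matched_pair)
  interpret cochain_splitting sg sh by unfold_locales
  let ?br = "bicrossed_br brg brh \<rho> \<psi>" and ?tri = "bicrossed_tri brg trg brh trh \<rho> \<mu> \<psi> \<nu>"
  let ?\<Theta> = "structure_cochain ?br ?tri" and ?l = "derived_brackets s (structure_cochain ?br ?tri)"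
  note z = mp.G.\<rho>_linear2[THEN vs_linear_0] mp.G.\<mu>_linear3[THEN vs_linear_0]
    mp.H.\<rho>_linear2[THEN vs_linear_0] mp.H.\<mu>_linear3[THEN vs_linear_0]
    mp.G.tri_linear3[THEN vs_linear_0] mp.H.tri_linear3[THEN vs_linear_0]
    mp.G.br_alt mp.H.br_alt
  \<comment> \<open>Closure of the two summands under the bicrossed operations feeds the weight
    argument.\<close>
  have g: "snd (?br (a, 0) (b, 0)) = 0" "snd (?tri (a, 0) (b, 0) (c, 0)) = 0" for a b c
    by (simp_all add: z rep_D_def)
  have h: "fst (?br (0, \<alpha>) (0, \<beta>)) = 0" "fst (?tri (0, \<alpha>) (0, \<beta>) (0, \<gamma>)) = 0" for \<alpha> \<beta> \<gamma>
    by (simp_all add: z rep_D_def)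
  have \<Theta>: "?\<Theta> \<in> cochain_grading s s 1"
    using structure_cochain_cochains[OF bicrossed_product] by (simp add: cochain_grading_def)
  interpret tw: exp_twist_setting "cochain_scale s" "cochain_scale sg" "cochain_grading sh sg"
    "cochain_grading s s" "ml_cochains s s" "ly_bracket s" embed_cochain project_cochain ?\<Theta> ?l
  proof
    show "D.iterate ?\<Theta> vs = 0" if "length vs = 4" "\<And>v. v \<in> set vs \<Longrightarrow> \<exists>d. v \<in> cochain_grading sh sg d" for vs
      by (rule iterate_4_eq_0[OF \<Theta> weight_op_structure_cochain[OF bicrossed_product g h] that])
  qed (simp_all add: \<Theta> ly_bracket_structure_cochain[OF bicrossed_product])
  have grade: "linear_cochain r' \<in> cochain_grading sh sg 0" if "Vector_Spaces.linear sh sg r'" for r'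
    using linear_cochain_cochains[OF that] by (simp add: cochain_grading_def)
  \<comment> \<open>The two equations of a deformation map are the two components of the projected
    exponential at a single letter. There are no other values, as it has degree 1.\<close>
  have def_iff: "deformation_map sg brg trg sh brh trh \<rho> \<mu> \<psi> \<nu> r' \<longleftrightarrow>
      project_cochain (D.exp_twist ?\<Theta> (linear_cochain r')) = 0" (is "_ \<longleftrightarrow> ?T = 0")
    if r': "Vector_Spaces.linear sh sg r'" for r'
  proof -
    note pt = project_exp_twist[OF bicrossed_product g r']
    have "?T = 0 \<longleftrightarrow> (\<forall>\<alpha> \<beta>. fst ?T [(\<alpha>, \<beta>)] = 0) \<and> (\<forall>\<alpha> \<beta> \<gamma>. snd ?T [(\<alpha>, \<beta>)] \<gamma> = 0)"
    proof
      assume R: "(\<forall>\<alpha> \<beta>. fst ?T [(\<alpha>, \<beta>)] = 0) \<and> (\<forall>\<alpha> \<beta> \<gamma>. snd ?T [(\<alpha>, \<beta>)] \<gamma> = 0)"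
      have "fst ?T w = 0 \<and> snd ?T w = 0" for w
      proof (cases "length w = 1")
        case True
        then obtain \<alpha> \<beta> where "w = [(\<alpha>, \<beta>)]" by (auto simp: length_Suc_conv)
        then show ?thesis using R by (simp add: fun_eq_iff)
      next
        case False
        then show ?thesis using pt(3) by (simp add: supp_in_def)
      qed
      then show "?T = 0" by (simp add: prod_eq_iff fun_eq_iff)
    qed simp
    then show ?thesis
      using r' unfolding pt(1,2) deformation_map_def by simp
  qed
  have lin: "Vector_Spaces.linear sh sg r"
    using deformation_map by (simp add: deformation_map_def)
  have MC: "project_cochain (D.exp_twist ?\<Theta> (linear_cochain r)) = 0"
    using def_iff[OF lin] deformation_map by simp
  have "L_infinity_algebra (cochain_scale sg) (cochain_grading sh sg)
      (twisted_brackets (cochain_scale sg) ?l (linear_cochain r))"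
    by (rule tw.L_infinity_twisted[OF grade[OF lin] MC])
  moreover have "deformation_map sg brg trg sh brh trh \<rho> \<mu> \<psi> \<nu> (\<lambda>\<alpha>. r \<alpha> + r' \<alpha>) \<longleftrightarrow>
      maurer_cartan (cochain_scale sg) (cochain_grading sh sg)
        (twisted_brackets (cochain_scale sg) ?l (linear_cochain r)) (linear_cochain r')"
    if r': "Vector_Spaces.linear sh sg r'" for r'
  proof -
    have l: "Vector_Spaces.linear sh sg (\<lambda>\<alpha>. r \<alpha> + r' \<alpha>)"
      using lin r' by (auto simp: Vector_Spaces.linear_iff scale_add algebra_simps)
    have e: "linear_cochain (\<lambda>\<alpha>. r \<alpha> + r' \<alpha>) = linear_cochain r + linear_cochain r'"
      by (intro prod_eqI ext) (simp_all add: linear_cochain_def)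
    show ?thesis
      unfolding def_iff[OF l] e tw.maurer_cartan_twisted[OF grade[OF lin] MC grade[OF r']] ..
  qed
  ultimately show ?thesis by (simp add: Let_def)
qed

end
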